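(* Let $\varphi\colon\Gamma\to G$ be a homomorphism of finite groups. Then the canonical map $\varphi_\infty\colon\Gamma\to\Gamma_\infty=\Gamma_{\infty,\varphi}$ induces an isomorphism of the descending central series quotients $\Gamma/\gamma_i(\Gamma)\cong\Gamma_\infty/\gamma_i(\Gamma_\infty)$ for all $i\ge 1$.
   Context: For a group $H$, $H=\gamma_1(H)\ge\gamma_2(H)\ge\cdots$ is the descending (lower) central series. Composition is written right to left. A normal map (= crossed module) is a group homomorphism $n\colon M\to G$ together with a right action $m\mapsto m^g$ of $G$ on $M$ by automorphisms such that $n(m^g)=g^{-1}n(m)g$ and $m^{n(m')}=m'^{-1}mm'$ for all $m,m'\in M$, $g\in G$. Given normal maps $n\colon M\to G$ and $n'\colon M'\to G$, a normal morphism over $G$ is a homomorphism $\mu\colon M\to M'$ with $n'\circ\mu=n$ and $\mu(m^g)=\mu(m)^g$ for all $m\in M$, $g\in G$. The (free) normal closure of a homomorphism $\varphi\colon\Gamma\to G$ is the universal factorization $\Gamma\xrightarrow{c_\varphi}\Gamma^{\varphi}\xrightarrow{\overline{\varphi}}G$ of $\varphi$ with $\overline{\varphi}$ a normal map: for every factorization $\varphi=n\circ\psi$ with $\psi\colon\Gamma\to M$ a homomorphism and $n\colon M\to G$ a normal map there is a unique normal morphism $u\colon\Gamma^\varphi\to M$ over $G$ with $u\circ c_\varphi=\psi$. It exists and is unique up to unique isomorphism. The normal closures tower of $\varphi$ is defined by $\Gamma_1=\Gamma_{1,\varphi}=G$, $\varphi_1=\varphi$, and inductively $\Gamma_{i+1}=\Gamma_{i+1,\varphi}=\Gamma^{\varphi_i}$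 (the normal closure of $\varphi_i\colon\Gamma\to\Gamma_i$), $\varphi_{i+1}=c_{\varphi_i}\colon\Gamma\to\Gamma_{i+1}$, with normal map $\overline{\varphi_i}\colon\Gamma_{i+1}\to\Gamma_i$. Then $\Gamma_\infty=\Gamma_{\infty,\varphi}=\varprojlim\Gamma_i$ is the inverse limit of $\cdots\to\Gamma_3\to\Gamma_2\to\Gamma_1=G$, and $\varphi_\infty\colon\Gamma\to\Gamma_\infty$ is the map induced by the $\varphi_i$. *)

theory Defs
  imports "HOL-Algebra.Algebra"
begin

section \<open>Normal maps and normal morphisms\<close>

text \<open>The action is written \<open>act m g\<close> for $m^g$; it is a right action.\<close>

definition normal_map ::
    "'m monoid \<Rightarrow> 'h monoid \<Rightarrow> ('m \<Rightarrow> 'h \<Rightarrow> 'm) \<Rightarrow> ('m \<Rightarrow> 'h) \<Rightarrow> bool" where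
  "normal_map M H act n \<longleftrightarrow>
     group M \<and> group H \<and> n \<in> hom M H \<and>
     (\<forall>g\<in>carrier H. (\<lambda>m. act m g) \<in> iso M M) \<and>
     (\<forall>m\<in>carrier M. act m \<one>\<^bsub>H\<^esub> = m) \<and>
     (\<forall>m\<in>carrier M. \<forall>g\<in>carrier H. \<forall>g'\<in>carrier H. act m (g \<otimes>\<^bsub>H\<^esub> g') = act (act m g) g') \<and>
     (\<forall>m\<in>carrier M. \<forall>g\<in>carrier H. n (act m g) = inv\<^bsub>H\<^esub> g \<otimes>\<^bsub>H\<^esub> n m \<otimes>\<^bsub>H\<^esub> g) \<and>
     (\<forall>m\<in>carrier M. \<forall>m'\<in>carrier M. act m (n m') = inv\<^bsub>M\<^esub> m' \<otimes>\<^bsub>M\<^esub> m \<otimes>\<^bsub>M\<^esub> m')"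

definition normal_morphism ::
    "'h monoid \<Rightarrow> 'm monoid \<Rightarrow> ('m \<Rightarrow> 'h \<Rightarrow> 'm) \<Rightarrow> ('m \<Rightarrow> 'h) \<Rightarrow>
     'k monoid \<Rightarrow> ('k \<Rightarrow> 'h \<Rightarrow> 'k) \<Rightarrow> ('k \<Rightarrow> 'h) \<Rightarrow> ('m \<Rightarrow> 'k) \<Rightarrow> bool" where
  "normal_morphism H M act n M' act' n' \<mu> \<longleftrightarrow>
     \<mu> \<in> hom M M' \<and>
     (\<forall>m\<in>carrier M. n' (\<mu> m) = n m) \<and>
     (\<forall>m\<in>carrier M. \<forall>g\<in>carrier H. \<mu> (act m g) = act' (\<mu> m) g)"

section \<open>The free normal closure\<close>

definition normal_factorization ::
    "'a monoid \<Rightarrow> 'h monoid \<Rightarrow> ('a \<Rightarrow> 'h) \<Rightarrow>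
     'm monoid \<Rightarrow> ('m \<Rightarrow> 'h \<Rightarrow> 'm) \<Rightarrow> ('m \<Rightarrow> 'h) \<Rightarrow> ('a \<Rightarrow> 'm) \<Rightarrow> bool" where
  "normal_factorization \<Gamma> H \<phi> M act n \<psi> \<longleftrightarrow>
     normal_map M H act n \<and> \<psi> \<in> hom \<Gamma> M \<and> (\<forall>x\<in>carrier \<Gamma>. n (\<psi> x) = \<phi> x)"

text \<open>The universal property of a factorization, tested against the factorizations through
  groups on a given type. The functions are restricted to be \<open>undefined\<close> outside the carrier,
  so that uniqueness is uniqueness on the carrier.\<close>

definition universal_among ::
    "'k itself \<Rightarrow> 'a monoid \<Rightarrow> 'h monoid \<Rightarrow> ('a \<Rightarrow> 'h) \<Rightarrow>
     'm monoid \<Rightarrow> ('m \<Rightarrow> 'h \<Rightarrow> 'm) \<Rightarrow> ('m \<Rightarrow> 'h) \<Rightarrow> ('a \<Rightarrow> 'm) \<Rightarrow> bool" where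
  "universal_among _ \<Gamma> H \<phi> M act n c \<longleftrightarrow>
     (\<forall>(M' :: 'k monoid) act' n' \<psi>. normal_factorization \<Gamma> H \<phi> M' act' n' \<psi> \<longrightarrow>
        (\<exists>!u. u \<in> extensional (carrier M) \<and> normal_morphism H M act n M' act' n' u \<and>
              (\<forall>x\<in>carrier \<Gamma>. u (c x) = \<psi> x)))"

text \<open>A HOL formula cannot quantify over all types. It suffices to test against groups on the
  type of the closure itself and against groups on one type that is large enough to carry a
  free construction: by \<open>normal_closure_universal\<close> below, the universal property
  then holds among groups on every type.\<close>

definition is_normal_closure ::
    "'a monoid \<Rightarrow> 'h monoid \<Rightarrow> ('a \<Rightarrow> 'h) \<Rightarrow>
     'm monoid \<Rightarrow> ('m \<Rightarrow> 'h \<Rightarrow> 'm) \<Rightarrow> ('m \<Rightarrow> 'h) \<Rightarrow> ('a \<Rightarrow> 'm) \<Rightarrow> bool" where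
  "is_normal_closure \<Gamma> H \<phi> M act n c \<longleftrightarrow>
     normal_factorization \<Gamma> H \<phi> M act n c \<and>
     universal_among TYPE('m) \<Gamma> H \<phi> M act n c \<and>
     universal_among TYPE(('a \<times> 'h) list set) \<Gamma> H \<phi> M act n c"

section \<open>The normal closures tower and its limit\<close>

text \<open>Here \<open>T i\<close>, \<open>\<phi>s i\<close> and \<open>ns i\<close> are $\Gamma_i$, $\varphi_i : \Gamma \to \Gamma_i$ and
  $\overline{\varphi_i} : \Gamma_{i+1} \to \Gamma_i$, and \<open>acts i\<close> is the action of $\Gamma_i$ on
  $\Gamma_{i+1}$. Values at index 0 are irrelevant.\<close>

definition normal_closures_tower ::
    "'a monoid \<Rightarrow> 'u monoid \<Rightarrow> ('a \<Rightarrow> 'u) \<Rightarrow>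
     (nat \<Rightarrow> 'u monoid) \<Rightarrow> (nat \<Rightarrow> 'u \<Rightarrow> 'u \<Rightarrow> 'u) \<Rightarrow> (nat \<Rightarrow> 'u \<Rightarrow> 'u) \<Rightarrow> (nat \<Rightarrow> 'a \<Rightarrow> 'u) \<Rightarrow> bool" where
  "normal_closures_tower \<Gamma> G \<phi> T acts ns \<phi>s \<longleftrightarrow>
     T 1 = G \<and> \<phi>s 1 = \<phi> \<and>
     (\<forall>i\<ge>1. is_normal_closure \<Gamma> (T i) (\<phi>s i) (T (Suc i)) (acts i) (ns i) (\<phi>s (Suc i)))"

definition tower_limit :: "(nat \<Rightarrow> 'u monoid) \<Rightarrow> (nat \<Rightarrow> 'u \<Rightarrow> 'u) \<Rightarrow> (nat \<Rightarrow> 'u) monoid" where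
  "tower_limit T ns =
     (product_group {1..} T)
       \<lparr>carrier := {x \<in> carrier (product_group {1..} T). \<forall>i\<ge>1. ns i (x (Suc i)) = x i}\<rparr>"

definition tower_limit_map :: "(nat \<Rightarrow> 'a \<Rightarrow> 'u) \<Rightarrow> 'a \<Rightarrow> nat \<Rightarrow> 'u" where
  "tower_limit_map \<phi>s x = (\<lambda>i\<in>{1..}. \<phi>s i x)"

section \<open>The lower central series\<close>

definition commutator_subgroup :: "('a, 'b) monoid_scheme \<Rightarrow> 'a set \<Rightarrow> 'a set \<Rightarrow> 'a set" where
  "commutator_subgroup G A B =
     generate G (\<Union>a\<in>A. \<Union>b\<in>B. {a \<otimes>\<^bsub>G\<^esub> b \<otimes>\<^bsub>G\<^esub> inv\<^bsub>G\<^esub> a \<otimes>\<^bsub>G\<^esub> inv\<^bsub>G\<^esub> b})"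

text \<open>The series starts at index 1; index 0 is a dummy.\<close>

fun lower_central :: "('a, 'b) monoid_scheme \<Rightarrow> nat \<Rightarrow> 'a set" where
  "lower_central G 0 = carrier G"
| "lower_central G (Suc 0) = carrier G"
| "lower_central G (Suc (Suc i)) = commutator_subgroup G (lower_central G (Suc i)) (carrier G)"

section \<open>Existence of normal closures, and the universal property for all types\<close>

lemma normal_mapD:
  assumes "normal_map M H act n"
  shows "group M" "group H" "n \<in> hom M H"
    "\<And>m m' g. \<lbrakk>m \<in> carrier M; m' \<in> carrier M; g \<in> carrier H\<rbrakk> \<Longrightarrow> act (m \<otimes>\<^bsub>M\<^esub> m') g = act m g \<otimes>\<^bsub>M\<^esub> act m' g"
    "\<And>m g. \<lbrakk>m \<in> carrier M; g \<in> carrier H\<rbrakk> \<Longrightarrow> act m g \<in> carrier M"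
    "\<And>m. m \<in> carrier M \<Longrightarrow> act m \<one>\<^bsub>H\<^esub> = m"
    "\<And>m g g'. \<lbrakk>m \<in> carrier M; g \<in> carrier H; g' \<in> carrier H\<rbrakk> \<Longrightarrow> act m (g \<otimes>\<^bsub>H\<^esub> g') = act (act m g) g'"
    "\<And>m g. \<lbrakk>m \<in> carrier M; g \<in> carrier H\<rbrakk> \<Longrightarrow> n (act m g) = inv\<^bsub>H\<^esub> g \<otimes>\<^bsub>H\<^esub> n m \<otimes>\<^bsub>H\<^esub> g"
    "\<And>m m'. \<lbrakk>m \<in> carrier M; m' \<in> carrier M\<rbrakk> \<Longrightarrow> act m (n m') = inv\<^bsub>M\<^esub> m' \<otimes>\<^bsub>M\<^esub> m \<otimes>\<^bsub>M\<^esub> m'"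
  using assms by (auto simp: normal_map_def iso_def hom_def)

lemma normal_morphism_comp:
  assumes "normal_morphism H M act n M' act' n' u" "normal_morphism H M' act' n' M'' act'' n'' v"
    and act: "\<And>m g. m \<in> carrier M \<Longrightarrow> g \<in> carrier H \<Longrightarrow> act m g \<in> carrier M"
    and M: "group M"
  shows "normal_morphism H M act n M'' act'' n'' (\<lambda>x\<in>carrier M. v (u x))"
proof -
  have "\<And>x y. x \<in> carrier M \<Longrightarrow> y \<in> carrier M \<Longrightarrow> x \<otimes>\<^bsub>M\<^esub> y \<in> carrier M"
    using M by (simp add: group.is_monoid monoid.m_closed)
  moreover have "\<And>x. x \<in> carrier M \<Longrightarrow> u x \<in> carrier M'"
    using assms(1) by (auto simp: normal_morphism_def hom_def)
  ultimately show ?thesis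
    using assms(1,2) act unfolding normal_morphism_def hom_def Pi_def by simp
qed

lemma universal_amongD:
  fixes M' :: "'k monoid"
  assumes "universal_among TYPE('k) \<Gamma> H \<phi> M act n c" "normal_factorization \<Gamma> H \<phi> M' act' n' \<psi>"
  obtains u where "normal_morphism H M act n M' act' n' u" "\<And>x. x \<in> carrier \<Gamma> \<Longrightarrow> u (c x) = \<psi> x"
  using assms unfolding universal_among_def by blast

lemma ex1_eqD: "\<exists>!x. P x \<Longrightarrow> P a \<Longrightarrow> P b \<Longrightarrow> a = b"
  by blast

lemma universal_among_unique:
  fixes M' :: "'k monoid"
  assumes "universal_among TYPE('k) \<Gamma> H \<phi> M act n c" "normal_factorization \<Gamma> H \<phi> M' act' n' \<psi>"
    and fac: "normal_factorization \<Gamma> H \<phi> M act n c"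
    and u: "normal_morphism H M act n M' act' n' u" "\<And>x. x \<in> carrier \<Gamma> \<Longrightarrow> u (c x) = \<psi> x"
    and v: "normal_morphism H M act n M' act' n' v" "\<And>x. x \<in> carrier \<Gamma> \<Longrightarrow> v (c x) = \<psi> x"
    and x: "x \<in> carrier M"
  shows "u x = v x"
proof -
  have nm: "normal_map M H act n" and c: "\<And>x. x \<in> carrier \<Gamma> \<Longrightarrow> c x \<in> carrier M"
    using fac by (auto simp: normal_factorization_def hom_def)
  have id: "normal_morphism H M' act' n' M' act' n' id"
    by (simp add: normal_morphism_def hom_def)
  note r = normal_morphism_comp[OF _ id, unfolded id_def, OF _ normal_mapD(5)[OF nm] normal_mapD(1)[OF nm]]
  from assms(1,2) have ex1: "\<exists>!w. w \<in> extensional (carrier M) \<and> normal_morphism H M act n M' act' n' w \<and>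
              (\<forall>x\<in>carrier \<Gamma>. w (c x) = \<psi> x)" unfolding universal_among_def by blast
  have "(\<lambda>x\<in>carrier M. u x) \<in> extensional (carrier M) \<and>
      normal_morphism H M act n M' act' n' (\<lambda>x\<in>carrier M. u x) \<and>
      (\<forall>x\<in>carrier \<Gamma>. (\<lambda>x\<in>carrier M. u x) (c x) = \<psi> x)"
    using r[OF u(1)] u(2) c by simp
  moreover have "(\<lambda>x\<in>carrier M. v x) \<in> extensional (carrier M) \<and>
      normal_morphism H M act n M' act' n' (\<lambda>x\<in>carrier M. v x) \<and>
      (\<forall>x\<in>carrier \<Gamma>. (\<lambda>x\<in>carrier M. v x) (c x) = \<psi> x)"
    using r[OF v(1)] v(2) c by simp
  ultimately have "(\<lambda>x\<in>carrier M. u x) = (\<lambda>x\<in>carrier M. v x)"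
    by (rule ex1_eqD[OF ex1])
  then show ?thesis using x by (metis restrict_apply')
qed

text \<open>Words in the letters \<open>(x, g)\<close>, read as $c(x)^g$, modulo the relations that define the free
  crossed module. The parameter \<open>q\<close> maps words onto names for their classes.\<close>

locale peiffer_words =
  \<Gamma>: group \<Gamma> + H: group H for \<Gamma> :: "'a monoid" and H :: "'h monoid" +
  fixes \<phi> :: "'a \<Rightarrow> 'h"
  assumes \<phi>_hom: "\<phi> \<in> hom \<Gamma> H"
begin

definition W where "W = lists (carrier \<Gamma> \<times> carrier H)"

lemma W_simps [simp]: "[] \<in> W" "(x, g) # w \<in> W \<longleftrightarrow> x \<in> carrier \<Gamma> \<and> g \<in> carrier H \<and> w \<in> W"
  "v @ w \<in> W \<longleftrightarrow> v \<in> W \<and> w \<in> W"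
  by (auto simp: W_def)

definition bd :: "('a \<times> 'h) list \<Rightarrow> 'h" where
  "bd w = foldr (\<lambda>(x, g) a. (inv\<^bsub>H\<^esub> g \<otimes>\<^bsub>H\<^esub> \<phi> x \<otimes>\<^bsub>H\<^esub> g) \<otimes>\<^bsub>H\<^esub> a) w \<one>\<^bsub>H\<^esub>"

definition ac :: "('a \<times> 'h) list \<Rightarrow> 'h \<Rightarrow> ('a \<times> 'h) list" where
  "ac w h = map (\<lambda>(x, g). (x, g \<otimes>\<^bsub>H\<^esub> h)) w"

inductive eqv :: "('a \<times> 'h) list \<Rightarrow> ('a \<times> 'h) list \<Rightarrow> bool" where
  refl: "w \<in> W \<Longrightarrow> eqv w w"
| sym: "eqv v w \<Longrightarrow> eqv w v"
| trans: "eqv u v \<Longrightarrow> eqv v w \<Longrightarrow> eqv u w"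
| append: "eqv v v' \<Longrightarrow> eqv w w' \<Longrightarrow> eqv (v @ w) (v' @ w')"
| unit: "g \<in> carrier H \<Longrightarrow> eqv [(\<one>\<^bsub>\<Gamma>\<^esub>, g)] []"
| mult: "x \<in> carrier \<Gamma> \<Longrightarrow> y \<in> carrier \<Gamma> \<Longrightarrow> g \<in> carrier H \<Longrightarrow>
         eqv [(x, g), (y, g)] [(x \<otimes>\<^bsub>\<Gamma>\<^esub> y, g)]"
| peiffer: "v \<in> W \<Longrightarrow> w \<in> W \<Longrightarrow> eqv (w @ ac v (bd w)) (v @ w)"

lemma phi_closed [simp]: "x \<in> carrier \<Gamma> \<Longrightarrow> \<phi> x \<in> carrier H"
  using \<phi>_hom by (auto simp: hom_def)

lemma phi_mult: "x \<in> carrier \<Gamma> \<Longrightarrow> y \<in> carrier \<Gamma> \<Longrightarrow> \<phi> (x \<otimes>\<^bsub>\<Gamma>\<^esub> y) = \<phi> x \<otimes>\<^bsub>H\<^esub> \<phi> y"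
  using \<phi>_hom by (auto simp: hom_def)

lemma phi_one [simp]: "\<phi> \<one>\<^bsub>\<Gamma>\<^esub> = \<one>\<^bsub>H\<^esub>"
  using \<phi>_hom by (simp add: hom_one)

lemma bd_simps: "bd [] = \<one>\<^bsub>H\<^esub>"
  "bd ((x, g) # w) = (inv\<^bsub>H\<^esub> g \<otimes>\<^bsub>H\<^esub> \<phi> x \<otimes>\<^bsub>H\<^esub> g) \<otimes>\<^bsub>H\<^esub> bd w"
  by (simp_all add: bd_def)

lemma ac_simps: "ac [] h = []" "ac ((x, g) # w) h = (x, g \<otimes>\<^bsub>H\<^esub> h) # ac w h"
  "ac (v @ w) h = ac v h @ ac w h"
  by (simp_all add: ac_def)

lemma bd_closed [simp]: "w \<in> W \<Longrightarrow> bd w \<in> carrier H"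
  by (induction w) (auto simp: bd_simps)

lemma ac_closed [simp]: "w \<in> W \<Longrightarrow> h \<in> carrier H \<Longrightarrow> ac w h \<in> W"
  by (induction w) (auto simp: ac_simps)

lemma bd_append: "v \<in> W \<Longrightarrow> w \<in> W \<Longrightarrow> bd (v @ w) = bd v \<otimes>\<^bsub>H\<^esub> bd w"
  by (induction v) (auto simp: bd_simps H.m_assoc)

lemma conj_mult: "a \<in> carrier H \<Longrightarrow> b \<in> carrier H \<Longrightarrow> g \<in> carrier H \<Longrightarrow>
    (inv\<^bsub>H\<^esub> g \<otimes>\<^bsub>H\<^esub> a \<otimes>\<^bsub>H\<^esub> g) \<otimes>\<^bsub>H\<^esub> (inv\<^bsub>H\<^esub> g \<otimes>\<^bsub>H\<^esub> b \<otimes>\<^bsub>H\<^esub> g) = inv\<^bsub>H\<^esub> g \<otimes>\<^bsub>H\<^esub> (a \<otimes>\<^bsub>H\<^esub> b) \<otimes>\<^bsub>H\<^esub> g"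
  by (simp add: H.m_assoc) (simp add: H.m_assoc[symmetric])

lemma bd_ac: "w \<in> W \<Longrightarrow> h \<in> carrier H \<Longrightarrow> bd (ac w h) = inv\<^bsub>H\<^esub> h \<otimes>\<^bsub>H\<^esub> bd w \<otimes>\<^bsub>H\<^esub> h"
proof (induction w)
  case Nil then show ?case by (simp add: bd_simps ac_simps)
next
  case (Cons p w)
  obtain x g where p: "p = (x, g)" by force
  have x: "x \<in> carrier \<Gamma>" "g \<in> carrier H" "w \<in> W" using Cons.prems p by auto
  have "bd (ac (p # w) h) = (inv\<^bsub>H\<^esub> h \<otimes>\<^bsub>H\<^esub> (inv\<^bsub>H\<^esub> g \<otimes>\<^bsub>H\<^esub> \<phi> x \<otimes>\<^bsub>H\<^esub> g) \<otimes>\<^bsub>H\<^esub> h) \<otimes>\<^bsub>H\<^esub> (inv\<^bsub>H\<^esub> h \<otimes>\<^bsub>H\<^esub> bd w \<otimes>\<^bsub>H\<^esub> h)"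
    using x Cons p by (simp add: ac_simps bd_simps H.inv_mult_group H.m_assoc)
  then show ?case using x Cons.prems p by (simp add: conj_mult bd_simps)
qed

lemma ac_ac: "w \<in> W \<Longrightarrow> g \<in> carrier H \<Longrightarrow> h \<in> carrier H \<Longrightarrow> ac (ac w g) h = ac w (g \<otimes>\<^bsub>H\<^esub> h)"
  by (induction w) (auto simp: ac_simps H.m_assoc)

lemma ac_one: "w \<in> W \<Longrightarrow> ac w \<one>\<^bsub>H\<^esub> = w"
  by (induction w) (auto simp: ac_simps)

lemma eqv_W: "eqv v w \<Longrightarrow> v \<in> W \<and> w \<in> W"
  by (induction rule: eqv.induct) auto

lemma eqv_bd: "eqv v w \<Longrightarrow> bd v = bd w"
proof (induction rule: eqv.induct)
  case (append v v' w w')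
  then show ?case using eqv_W[OF append(1)] eqv_W[OF append(2)] by (simp add: bd_append)
next
  case (peiffer v w)
  then show ?case by (simp add: bd_append bd_ac) (simp add: H.m_assoc[symmetric])
qed (simp_all add: bd_simps phi_mult conj_mult)

lemma eqv_ac: "eqv v w \<Longrightarrow> h \<in> carrier H \<Longrightarrow> eqv (ac v h) (ac w h)"
proof (induction rule: eqv.induct)
  case (peiffer v w)
  have "ac (w @ ac v (bd w)) h = ac w h @ ac (ac v h) (bd (ac w h))"
    using peiffer by (simp add: ac_simps bd_ac ac_ac H.m_assoc[symmetric])
  then show ?case using peiffer eqv.peiffer[of "ac v h" "ac w h"] by (simp add: ac_simps)
qed (auto simp: ac_simps intro: eqv.intros)

lemma eqv_inverse: "w \<in> W \<Longrightarrow> \<exists>v\<in>W. eqv (v @ w) []"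
proof (induction w)
  case Nil
  then show ?case using eqv.refl[of "[]"] by (intro bexI[of _ "[]"]) auto
next
  case (Cons p w)
  obtain x g where p: "p = (x, g)" by force
  have x: "x \<in> carrier \<Gamma>" "g \<in> carrier H" "w \<in> W" using Cons.prems p by auto
  obtain v where v: "v \<in> W" "eqv (v @ w) []" using Cons x by auto
  have "eqv ([(inv\<^bsub>\<Gamma>\<^esub> x, g)] @ [(x, g)]) []"
    using eqv.trans[OF eqv.mult[of "inv\<^bsub>\<Gamma>\<^esub> x" x g]] eqv.unit x by simp
  then have "eqv (v @ (([(inv\<^bsub>\<Gamma>\<^esub> x, g)] @ [(x, g)]) @ w)) (v @ ([] @ w))"
    using x v by (intro eqv.append eqv.refl)
  then have "eqv ((v @ [(inv\<^bsub>\<Gamma>\<^esub> x, g)]) @ p # w) []"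
    using v(2) p eqv.trans by auto
  then show ?case using x v by (intro bexI[of _ "v @ [(inv\<^bsub>\<Gamma>\<^esub> x, g)]"]) auto
qed

end

locale peiffer_quotient = peiffer_words \<Gamma> H \<phi> for \<Gamma> :: "'a monoid" and H :: "'h monoid" and \<phi> +
  fixes q :: "('a \<times> 'h) list \<Rightarrow> 'm"
  assumes q_iff: "v \<in> W \<Longrightarrow> w \<in> W \<Longrightarrow> q v = q w \<longleftrightarrow> eqv v w"
begin

definition dec where "dec a = (SOME w. w \<in> W \<and> q w = a)"

definition F :: "'m monoid" where
  "F = \<lparr>carrier = q ` W, monoid.mult = (\<lambda>a b. q (dec a @ dec b)), one = q []\<rparr>"

definition Fact where "Fact a h = q (ac (dec a) h)"
definition Fn where "Fn a = bd (dec a)"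
definition Fc where "Fc x = q [(x, \<one>\<^bsub>H\<^esub>)]"

lemma dec_q: assumes "w \<in> W" shows "dec (q w) \<in> W" "q (dec (q w)) = q w" "eqv (dec (q w)) w"
proof -
  have "dec (q w) \<in> W \<and> q (dec (q w)) = q w"
    unfolding dec_def by (rule someI[of _ w]) (use assms in simp)
  then show "dec (q w) \<in> W" "q (dec (q w)) = q w" "eqv (dec (q w)) w"
    using q_iff assms by auto
qed

lemma F_mult: "v \<in> W \<Longrightarrow> w \<in> W \<Longrightarrow> q v \<otimes>\<^bsub>F\<^esub> q w = q (v @ w)"
  using dec_q[of v] dec_q[of w] by (simp add: F_def q_iff eqv.append)

lemma F_act: "w \<in> W \<Longrightarrow> h \<in> carrier H \<Longrightarrow> Fact (q w) h = q (ac w h)"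
  using dec_q[of w] by (simp add: Fact_def q_iff eqv_ac)

lemma F_n: "w \<in> W \<Longrightarrow> Fn (q w) = bd w"
  using dec_q[of w] by (simp add: Fn_def eqv_bd)

lemma F_carrier: "carrier F = q ` W" by (simp add: F_def)

lemma F_one: "\<one>\<^bsub>F\<^esub> = q []" by (simp add: F_def)

lemma F_group: "group F"
proof (rule groupI)
  fix a assume "a \<in> carrier F"
  then obtain w where w: "w \<in> W" "a = q w" by (auto simp: F_carrier)
  obtain v where "v \<in> W" "eqv (v @ w) []" using eqv_inverse[OF w(1)] by auto
  then show "\<exists>b\<in>carrier F. b \<otimes>\<^bsub>F\<^esub> a = \<one>\<^bsub>F\<^esub>"
    using w by (intro bexI[of _ "q v"]) (auto simp: F_mult F_one F_carrier q_iff)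
qed (auto simp: F_carrier F_mult F_one intro!: imageI)

lemma F_normal_map: "normal_map F H Fact Fn"
proof -
  interpret F: group F by (rule F_group)
  have act_hom: "(\<lambda>m. Fact m g) \<in> hom F F" if "g \<in> carrier H" for g
    using that by (auto simp: hom_def F_carrier F_mult F_act ac_simps)
  have act_act: "Fact (Fact m g) g' = Fact m (g \<otimes>\<^bsub>H\<^esub> g')"
    if "m \<in> carrier F" "g \<in> carrier H" "g' \<in> carrier H" for m g g'
    using that by (auto simp: F_carrier F_act ac_ac)
  have act_one: "Fact m \<one>\<^bsub>H\<^esub> = m" if "m \<in> carrier F" for m
    using that by (auto simp: F_carrier F_act ac_one)
  have "(\<lambda>m. Fact m g) \<in> iso F F" if g: "g \<in> carrier H" for g
  proof -
    have "bij_betw (\<lambda>m. Fact m g) (carrier F) (carrier F)"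
      by (rule bij_betwI[of _ _ _ "\<lambda>m. Fact m (inv\<^bsub>H\<^esub> g)"])
         (use g act_hom[of g] act_hom[of "inv\<^bsub>H\<^esub> g"] in \<open>auto simp: act_act act_one hom_def\<close>)
    then show ?thesis using act_hom[OF g] by (simp add: iso_def)
  qed
  moreover have "Fact m (Fn m') = inv\<^bsub>F\<^esub> m' \<otimes>\<^bsub>F\<^esub> m \<otimes>\<^bsub>F\<^esub> m'"
    if "m \<in> carrier F" "m' \<in> carrier F" for m m'
  proof -
    obtain v w where v: "v \<in> W" "m = q v" and w: "w \<in> W" "m' = q w"
      using \<open>m \<in> carrier F\<close> \<open>m' \<in> carrier F\<close> by (auto simp: F_carrier)
    have c: "Fact m (Fn m') \<in> carrier F"
      using v w by (simp add: F_n F_act F_carrier)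
    have "m' \<otimes>\<^bsub>F\<^esub> Fact m (Fn m') = m \<otimes>\<^bsub>F\<^esub> m'"
      using v w eqv.peiffer[OF v(1) w(1)] by (simp add: F_n F_act F_mult q_iff)
    then have "inv\<^bsub>F\<^esub> m' \<otimes>\<^bsub>F\<^esub> (m' \<otimes>\<^bsub>F\<^esub> Fact m (Fn m')) = inv\<^bsub>F\<^esub> m' \<otimes>\<^bsub>F\<^esub> m \<otimes>\<^bsub>F\<^esub> m'"
      using that by (simp add: F.m_assoc)
    then show ?thesis using that c by (simp add: F.m_assoc[symmetric])
  qed
  moreover have "Fn \<in> hom F H"
    by (auto simp: hom_def F_carrier F_n F_mult bd_append)
  moreover have "Fn (Fact m g) = inv\<^bsub>H\<^esub> g \<otimes>\<^bsub>H\<^esub> Fn m \<otimes>\<^bsub>H\<^esub> g" if "m \<in> carrier F" "g \<in> carrier H" for m g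
    using that by (auto simp: F_carrier F_n F_act bd_ac)
  ultimately show ?thesis
    using F_group H.is_group act_act act_one by (simp add: normal_map_def)
qed

lemma F_factorization: "normal_factorization \<Gamma> H \<phi> F Fact Fn Fc"
proof -
  have "eqv [(x \<otimes>\<^bsub>\<Gamma>\<^esub> y, \<one>\<^bsub>H\<^esub>)] [(x, \<one>\<^bsub>H\<^esub>), (y, \<one>\<^bsub>H\<^esub>)]" if "x \<in> carrier \<Gamma>" "y \<in> carrier \<Gamma>" for x y
    using that by (intro eqv.sym[OF eqv.mult]) auto
  then have "Fc \<in> hom \<Gamma> F"
    by (auto simp: hom_def Fc_def F_carrier F_mult q_iff)
  then show ?thesis
    using F_normal_map by (auto simp: normal_factorization_def Fc_def F_n bd_simps)
qed

lemma F_universal: "universal_among TYPE('k) \<Gamma> H \<phi> F Fact Fn Fc"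
  unfolding universal_among_def
proof (intro allI impI)
  fix M :: "'k monoid" and act n \<psi>
  assume fac: "normal_factorization \<Gamma> H \<phi> M act n \<psi>"
  then have nm: "normal_map M H act n" and psi: "\<psi> \<in> hom \<Gamma> M"
    and npsi: "\<And>x. x \<in> carrier \<Gamma> \<Longrightarrow> n (\<psi> x) = \<phi> x"
    by (auto simp: normal_factorization_def)
  note D = normal_mapD[OF nm]
  interpret M: group M by (rule D(1))
  interpret F: group F by (rule F_group)
  interpret nh: group_hom M H n by unfold_locales (rule D(3))
  interpret ps: group_hom \<Gamma> M \<psi> by unfold_locales (rule psi)
  have act_one: "act \<one>\<^bsub>M\<^esub> g = \<one>\<^bsub>M\<^esub>" if "g \<in> carrier H" for g
    using D(4)[of "\<one>\<^bsub>M\<^esub>" "\<one>\<^bsub>M\<^esub>" g] D(5)[of "\<one>\<^bsub>M\<^esub>" g] that M.l_cancel_one' by fastforce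
  define ev where "ev w = foldr (\<lambda>(x, g) a. act (\<psi> x) g \<otimes>\<^bsub>M\<^esub> a) w \<one>\<^bsub>M\<^esub>" for w
  have ev_simps: "ev [] = \<one>\<^bsub>M\<^esub>" "ev ((x, g) # w) = act (\<psi> x) g \<otimes>\<^bsub>M\<^esub> ev w" for x g w
    by (simp_all add: ev_def)
  have ev_closed [simp]: "ev w \<in> carrier M" if "w \<in> W" for w
    using that by (induction w) (auto simp: ev_simps D(5))
  have ev_append: "ev (v @ w) = ev v \<otimes>\<^bsub>M\<^esub> ev w" if "v \<in> W" "w \<in> W" for v w
    using that by (induction v) (auto simp: ev_simps D(5) M.m_assoc)
  have ev_ac: "ev (ac w h) = act (ev w) h" if "w \<in> W" "h \<in> carrier H" for w h
    using that by (induction w) (auto simp: ev_simps ac_simps D act_one)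
  have n_ev: "n (ev w) = bd w" if "w \<in> W" for w
    using that by (induction w) (auto simp: ev_simps bd_simps D npsi)
  have ev_eqv: "ev v = ev w" if "eqv v w" for v w
    using that
  proof (induction rule: eqv.induct)
    case (append v v' w w')
    then show ?case using eqv_W[OF append(1)] eqv_W[OF append(2)] by (simp add: ev_append)
  next
    case (unit g)
    then show ?case by (simp add: ev_simps act_one)
  next
    case (mult x y g)
    then show ?case by (simp add: ev_simps D)
  next
    case (peiffer v w)
    then have "ev (w @ ac v (bd w)) = ev w \<otimes>\<^bsub>M\<^esub> act (ev v) (n (ev w))"
      by (simp add: ev_append ev_ac n_ev)
    also have "\<dots> = ev v \<otimes>\<^bsub>M\<^esub> ev w"
      using peiffer by (simp add: D(9)) (simp add: M.m_assoc[symmetric])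
    finally show ?case using peiffer by (simp add: ev_append)
  qed simp_all
  define u where "u = (\<lambda>a\<in>carrier F. ev (dec a))"
  have u_q: "u (q w) = ev w" if "w \<in> W" for w
    using that dec_q[OF that] by (simp add: u_def F_carrier ev_eqv)
  have u_nm: "normal_morphism H F Fact Fn M act n u"
    by (auto simp: normal_morphism_def hom_def F_carrier u_q F_mult F_n F_act ev_append ev_ac n_ev)
  have u_c: "u (Fc x) = \<psi> x" if "x \<in> carrier \<Gamma>" for x
    using that by (simp add: Fc_def u_q ev_simps D)
  show "\<exists>!u. u \<in> extensional (carrier F) \<and> normal_morphism H F Fact Fn M act n u \<and>
          (\<forall>x\<in>carrier \<Gamma>. u (Fc x) = \<psi> x)"
  proof (rule ex1I[of _ u])
    show "u \<in> extensional (carrier F) \<and> normal_morphism H F Fact Fn M act n u \<and>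
          (\<forall>x\<in>carrier \<Gamma>. u (Fc x) = \<psi> x)"
      using u_nm u_c by (simp add: u_def)
  next
    fix v assume v: "v \<in> extensional (carrier F) \<and> normal_morphism H F Fact Fn M act n v \<and>
          (\<forall>x\<in>carrier \<Gamma>. v (Fc x) = \<psi> x)"
    then interpret vh: group_hom F M v
      by unfold_locales (simp add: normal_morphism_def)
    have "v (q w) = ev w" if "w \<in> W" for w
      using that
    proof (induction w)
      case Nil
      then show ?case using vh.hom_one by (simp add: F_one ev_simps)
    next
      case (Cons p w)
      obtain x g where p: "p = (x, g)" by force
      have x: "x \<in> carrier \<Gamma>" "g \<in> carrier H" "w \<in> W" using Cons.prems p by auto
      have "q (p # w) = Fact (Fc x) g \<otimes>\<^bsub>F\<^esub> q w"
        using x p by (simp add: Fc_def F_act F_mult ac_simps)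
      moreover have "Fact (Fc x) g \<in> carrier F" "q w \<in> carrier F" "Fc x \<in> carrier F"
        using x by (auto simp: F_carrier Fc_def F_act ac_simps)
      moreover have "v (Fact (Fc x) g) = act (\<psi> x) g"
        using v x \<open>Fc x \<in> carrier F\<close> by (simp add: normal_morphism_def)
      ultimately show ?case using Cons x p by (simp add: ev_simps)
    qed
    then have "v a = u a" if "a \<in> carrier F" for a
      using that by (auto simp: F_carrier u_q)
    then show "v = u"
      using v by (intro extensionalityI[of v "carrier F"]) (auto simp: u_def)
  qed
qed

lemma F_is_normal_closure: "is_normal_closure \<Gamma> H \<phi> F Fact Fn Fc"
  unfolding is_normal_closure_def by (intro conjI F_factorization F_universal)

end

context peiffer_words begin

sublocale cls: peiffer_quotient \<Gamma> H \<phi> "\<lambda>w. {v. eqv w v}"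
proof
  fix v w assume "v \<in> W" "w \<in> W"
  then have "eqv v v" by (simp add: eqv.refl)
  moreover have "eqv v x \<longleftrightarrow> eqv w x" if "eqv v w" for x
    using that by (meson eqv.sym eqv.trans)
  ultimately show "{x. eqv v x} = {x. eqv w x} \<longleftrightarrow> eqv v w"
    using eqv.sym by blast
qed

end

theorem normal_closure_universal:
  assumes nc: "is_normal_closure \<Gamma> H \<phi> M act n c"
    and \<Gamma>: "group \<Gamma>" and \<phi>: "\<phi> \<in> hom \<Gamma> H"
  shows "universal_among TYPE('k) \<Gamma> H \<phi> M act n c"
proof -
  have fac: "normal_factorization \<Gamma> H \<phi> M act n c" using nc by (simp add: is_normal_closure_def)
  then have nm: "normal_map M H act n" by (simp add: normal_factorization_def)
  note D = normal_mapD[OF nm]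
  interpret peiffer_words \<Gamma> H \<phi>
    using \<Gamma> \<phi> D(2) by (simp add: peiffer_words_def peiffer_words_axioms_def)
  have cM: "c x \<in> carrier M" if "x \<in> carrier \<Gamma>" for x
    using that fac by (auto simp: normal_factorization_def hom_def)
  have cF: "cls.Fc x \<in> carrier cls.F" if "x \<in> carrier \<Gamma>" for x
    using that cls.F_factorization by (auto simp: normal_factorization_def hom_def)
  note DF = normal_mapD[OF cls.F_normal_map]
  obtain u where u: "normal_morphism H M act n cls.F cls.Fact cls.Fn u"
    "\<And>x. x \<in> carrier \<Gamma> \<Longrightarrow> u (c x) = cls.Fc x"
    using universal_amongD[OF _ cls.F_factorization] nc unfolding is_normal_closure_def by metis
  have uF: "u x \<in> carrier cls.F" if "x \<in> carrier M" for x
    using that u(1) by (auto simp: normal_morphism_def hom_def)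
  obtain v where v: "normal_morphism H cls.F cls.Fact cls.Fn M act n v"
    "\<And>x. x \<in> carrier \<Gamma> \<Longrightarrow> v (cls.Fc x) = c x"
    using universal_amongD[OF cls.F_universal fac] by metis
  have idM: "normal_morphism H M act n M act n id"
    by (simp add: normal_morphism_def hom_def)
  have vu: "v (u x) = x" if "x \<in> carrier M" for x
  proof -
    have "(\<lambda>x\<in>carrier M. v (u x)) x = id x"
      by (rule universal_among_unique[OF _ fac fac normal_morphism_comp[OF u(1) v(1) D(5,1)] _ idM _ that])
         (use nc cM u(2) v(2) in \<open>auto simp: is_normal_closure_def\<close>)
    then show ?thesis using that by simp
  qed
  show ?thesis
    unfolding universal_among_def
  proof (intro allI impI)
    fix N :: "'k monoid" and act' n' \<psi>
    assume facN: "normal_factorization \<Gamma> H \<phi> N act' n' \<psi>"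
    obtain t where t: "normal_morphism H cls.F cls.Fact cls.Fn N act' n' t"
      "\<And>x. x \<in> carrier \<Gamma> \<Longrightarrow> t (cls.Fc x) = \<psi> x"
      using universal_amongD[OF cls.F_universal facN] by metis
    show "\<exists>!u. u \<in> extensional (carrier M) \<and> normal_morphism H M act n N act' n' u \<and>
          (\<forall>x\<in>carrier \<Gamma>. u (c x) = \<psi> x)"
    proof (rule ex1I[of _ "\<lambda>x\<in>carrier M. t (u x)"])
      show "(\<lambda>x\<in>carrier M. t (u x)) \<in> extensional (carrier M) \<and>
          normal_morphism H M act n N act' n' (\<lambda>x\<in>carrier M. t (u x)) \<and>
          (\<forall>x\<in>carrier \<Gamma>. (\<lambda>x\<in>carrier M. t (u x)) (c x) = \<psi> x)"
        using normal_morphism_comp[OF u(1) t(1) D(5,1)] t(2) u(2) cM by simp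
    next
      fix w assume w: "w \<in> extensional (carrier M) \<and> normal_morphism H M act n N act' n' w \<and>
          (\<forall>x\<in>carrier \<Gamma>. w (c x) = \<psi> x)"
      have wv: "(\<lambda>y\<in>carrier cls.F. w (v y)) y = t y" if "y \<in> carrier cls.F" for y
        by (rule universal_among_unique[OF cls.F_universal facN cls.F_factorization
              normal_morphism_comp[OF v(1) _ DF(5,1)] _ t that])
           (use w cF v(2) in auto)
      have "w x = t (u x)" if "x \<in> carrier M" for x
        using wv[OF uF[OF that]] uF[OF that] vu[OF that] by simp
      then show "w = (\<lambda>x\<in>carrier M. t (u x))"
        using w by (intro extensionalityI[of w "carrier M"]) auto
    qed
  qed
qed

theorem normal_closure_exists:
  fixes \<Gamma> :: "'a monoid" and H :: "'h monoid" and \<iota> :: "('a \<times> 'h) list \<Rightarrow> 'm"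
  assumes "group \<Gamma>" "group H" "\<phi> \<in> hom \<Gamma> H" and \<iota>: "inj \<iota>"
  shows "\<exists>(M :: 'm monoid) act n c. is_normal_closure \<Gamma> H \<phi> M act n c"
proof -
  interpret peiffer_words \<Gamma> H \<phi>
    using assms by (simp add: peiffer_words_def peiffer_words_axioms_def)
  interpret r: peiffer_quotient \<Gamma> H \<phi> "\<lambda>w. \<iota> (SOME v. eqv w v)"
  proof
    fix v w assume vw: "v \<in> W" "w \<in> W"
    have v: "eqv v (SOME x. eqv v x)" and w: "eqv w (SOME x. eqv w x)"
      by (rule someI[of "eqv v" v, OF eqv.refl[OF vw(1)]],
          rule someI[of "eqv w" w, OF eqv.refl[OF vw(2)]])
    have "eqv v = eqv w" if "eqv v w"
      using that by (intro ext) (meson eqv.sym eqv.trans)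
    moreover have "eqv v w" if "(SOME x. eqv v x) = (SOME x. eqv w x)"
      using eqv.trans[OF v eqv.sym[OF w, folded that]] .
    ultimately have "(SOME x. eqv v x) = (SOME x. eqv w x) \<longleftrightarrow> eqv v w"
      by metis
    then show "\<iota> (SOME x. eqv v x) = \<iota> (SOME x. eqv w x) \<longleftrightarrow> eqv v w"
      by (simp only: inj_eq[OF \<iota>])
  qed
  show ?thesis using r.F_is_normal_closure by blast
qed

theorem normal_closures_tower_exists:
  fixes \<Gamma> :: "'a monoid" and G :: "'u monoid" and \<iota> :: "('a \<times> 'u) list \<Rightarrow> 'u"
  assumes \<Gamma>: "group \<Gamma>" and G: "group G" "\<phi> \<in> hom \<Gamma> G" and \<iota>: "inj \<iota>"
  shows "\<exists>T acts ns \<phi>s. normal_closures_tower \<Gamma> G \<phi> T acts ns \<phi>s"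
proof -
  define P where "P = (\<lambda>(i :: nat) (s :: 'u monoid \<times> ('a \<Rightarrow> 'u)).
    group (fst s) \<and> snd s \<in> hom \<Gamma> (fst s) \<and> (i \<le> 1 \<longrightarrow> s = (G, \<phi>)))"
  define Q where "Q = (\<lambda>(i :: nat) (s :: 'u monoid \<times> ('a \<Rightarrow> 'u)) (t :: 'u monoid \<times> ('a \<Rightarrow> 'u)).
    i \<ge> 1 \<longrightarrow> (\<exists>act n. is_normal_closure \<Gamma> (fst s) (snd s) (fst t) act n (snd t)))"
  have "\<exists>s. \<forall>i. P i (s i) \<and> Q i (s i) (s (Suc i))"
  proof (rule dependent_nat_choice)
    show "\<exists>s. P 0 s" using G by (auto simp: P_def)
  next
    fix s i assume s: "P i s"
    show "\<exists>t. P (Suc i) t \<and> Q i s t"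
    proof (cases "i = 0")
      case True
      then show ?thesis using G by (auto simp: P_def Q_def)
    next
      case False
      obtain M :: "'u monoid" and act n c
        where nc: "is_normal_closure \<Gamma> (fst s) (snd s) M act n c"
        using normal_closure_exists[OF \<Gamma> _ _ \<iota>, of "fst s" "snd s"] s by (auto simp: P_def)
      then have "group M" "c \<in> hom \<Gamma> M"
        by (auto simp: is_normal_closure_def normal_factorization_def normal_map_def)
      then show ?thesis using nc False by (intro exI[of _ "(M, c)"]) (auto simp: P_def Q_def)
    qed
  qed
  then obtain s where s: "\<And>i. P i (s i)" "\<And>i. Q i (s i) (s (Suc i))" by blast
  then have "\<forall>i. \<exists>act n. i \<ge> 1 \<longrightarrow>
      is_normal_closure \<Gamma> (fst (s i)) (snd (s i)) (fst (s (Suc i))) act n (snd (s (Suc i)))"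
    by (auto simp: Q_def)
  then obtain acts ns where "\<forall>i\<ge>1. is_normal_closure \<Gamma> (fst (s i)) (snd (s i))
      (fst (s (Suc i))) (acts i) (ns i) (snd (s (Suc i)))" by metis
  moreover have "s 1 = (G, \<phi>)" using s(1)[of 1] by (auto simp: P_def)
  ultimately have "normal_closures_tower \<Gamma> G \<phi> (fst \<circ> s) acts ns (snd \<circ> s)"
    by (simp add: normal_closures_tower_def)
  then show ?thesis by blast
qed

end

theory Submission
  imports Defs
begin

text \<open>Write \<open>P\<close> for the limit $\Gamma_\infty$ of the tower and \<open>\<gamma>\<^sub>k\<close> for the terms of the lower central series.

Injectivity is formal. $\Gamma/\gamma_{k+1} \to \Gamma/\gamma_k$ is a central extension, and a normal
closure lifts through central extensions: pull the extension back along the map out of the base and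
apply the universal property (\<open>normal_closure_lifts_to_central_extension\<close>). Starting from the trivial
map on $G = \Gamma_1$, induction gives maps $\Gamma_k \to \Gamma/\gamma_k(\Gamma)$ under $\Gamma$. Hence an
element of $\Gamma$ whose image lies in $\gamma_k(P)$ lies in $\gamma_k(\Gamma)$.

Surjectivity asks for $P = \varphi_\infty(\Gamma)\,\gamma_k(P)$, and the case $k = 2$ implies the others
(\<open>supplement_descends\<close>). Every $\Gamma_i$ is finite, by Dietzmann's lemma. Let $S_i$ be the image of $P$
in $\Gamma_i$. Because $\Gamma_{j+1} \to \Gamma_j$ hits exactly the normal closure of the image of $\Gamma$,
and because images of finite groups stabilize along the tower, $S_i$ is normally generated by the image of
$\Gamma$ in it; therefore $S_i = \varphi_i(\Gamma)\,[S_i, S_i]$. This equation passes to the limit by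
compactness as soon as the number of commutators needed is bounded independently of $i$.

The bound (\<open>supplement_commutator_width\<close>) rests on the fact that the kernel $K$ of $S_i \to G$ has a
series, given by the levels of the tower, whose factors are central; its length grows with $i$, but $S_i/K$
embeds in $G$. Choose $R \lhd S_i$ minimal with $\varphi_i(\Gamma) R = S_i$. Minimality forces $[R, S_i] = R$,
and such an $R$ centralizes $K$ (\<open>perfect_centralizes_chain\<close>). So $R$ modulo its centre has at
most $|G|$ elements, and Schur's argument bounds the commutator width of $[R, R]$ in terms of $|G|$. In the abelian
group $R/[R, R]$ the map $r \mapsto [r, a]$ is a homomorphism for each $a$, so every element
is a product of one commutator $[r_a, a]$ for each $a \in \varphi_i(\Gamma)$.\<close>

section \<open>Products of words and Dietzmann's lemma\<close>

definition commutator :: "('a, 'b) monoid_scheme \<Rightarrow> 'a \<Rightarrow> 'a \<Rightarrow> 'a" where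
  "commutator G x y = x \<otimes>\<^bsub>G\<^esub> y \<otimes>\<^bsub>G\<^esub> inv\<^bsub>G\<^esub> x \<otimes>\<^bsub>G\<^esub> inv\<^bsub>G\<^esub> y"

definition list_prod :: "('a, 'b) monoid_scheme \<Rightarrow> 'a list \<Rightarrow> 'a" where
  "list_prod G xs = foldr (\<otimes>\<^bsub>G\<^esub>) xs \<one>\<^bsub>G\<^esub>"

lemma list_prod_simps [simp]:
  "list_prod G [] = \<one>\<^bsub>G\<^esub>" "list_prod G (x # xs) = x \<otimes>\<^bsub>G\<^esub> list_prod G xs"
  by (simp_all add: list_prod_def)

context group
begin

lemma inv_mult_cancel: "x \<in> carrier G \<Longrightarrow> y \<in> carrier G \<Longrightarrow> inv x \<otimes> (x \<otimes> y) = y"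
  by (simp add: m_assoc[symmetric])

lemma mult_inv_cancel: "x \<in> carrier G \<Longrightarrow> y \<in> carrier G \<Longrightarrow> x \<otimes> (inv x \<otimes> y) = y"
  by (simp add: m_assoc[symmetric])

lemmas group_normalize = m_assoc inv_mult_group inv_mult_cancel mult_inv_cancel

lemma commutator_closed [simp]:
  "x \<in> carrier G \<Longrightarrow> y \<in> carrier G \<Longrightarrow> commutator G x y \<in> carrier G"
  by (simp add: commutator_def)

lemma inv_commutator:
  "x \<in> carrier G \<Longrightarrow> y \<in> carrier G \<Longrightarrow> inv (commutator G x y) = commutator G y x"
  by (simp add: commutator_def group_normalize)

lemma commutator_eq_one_iff:
  assumes "x \<in> carrier G" "y \<in> carrier G"
  shows "commutator G x y = \<one> \<longleftrightarrow> x \<otimes> y = y \<otimes> x"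
proof -
  have "commutator G x y = (x \<otimes> y) \<otimes> inv (y \<otimes> x)"
    using assms by (simp add: commutator_def group_normalize)
  then show ?thesis
    using inv_solve_right[of \<one> "x \<otimes> y" "y \<otimes> x"] assms by (metis l_one m_closed one_closed)
qed

lemma conj_commutator:
  "x \<in> carrier G \<Longrightarrow> y \<in> carrier G \<Longrightarrow> g \<in> carrier G \<Longrightarrow>
    g \<otimes> commutator G x y \<otimes> inv g = commutator G (g \<otimes> x \<otimes> inv g) (g \<otimes> y \<otimes> inv g)"
  by (simp add: commutator_def group_normalize)

lemma list_prod_closed [simp]: "set xs \<subseteq> carrier G \<Longrightarrow> list_prod G xs \<in> carrier G"
  by (induction xs) auto

lemma list_prod_append:
  "set xs \<subseteq> carrier G \<Longrightarrow> set ys \<subseteq> carrier G \<Longrightarrow>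
    list_prod G (xs @ ys) = list_prod G xs \<otimes> list_prod G ys"
  by (induction xs) (auto simp: m_assoc)

lemma list_prod_replicate: "x \<in> carrier G \<Longrightarrow> list_prod G (replicate n x) = x [^] n"
  by (induction n) (simp_all, metis nat_pow_Suc2 nat_pow_Suc)

lemma list_prod_in_subgroup: "subgroup H G \<Longrightarrow> set xs \<subseteq> H \<Longrightarrow> list_prod G xs \<in> H"
  by (induction xs) (auto simp: subgroup.one_closed subgroup.m_closed)

lemma conj_list_prod:
  assumes "g \<in> carrier G" "set xs \<subseteq> carrier G"
  shows "g \<otimes> list_prod G xs \<otimes> inv g = list_prod G (map (\<lambda>x. g \<otimes> x \<otimes> inv g) xs)"
  using assms(2)
proof (induction xs)
  case (Cons x xs)
  have "g \<otimes> (x \<otimes> list_prod G xs) \<otimes> inv g = (g \<otimes> x \<otimes> inv g) \<otimes> (g \<otimes> list_prod G xs \<otimes> inv g)"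
    using Cons.prems assms(1) by (simp add: group_normalize)
  then show ?case using Cons by simp
qed (use assms in simp)

lemma generate_eq_list_prod:
  assumes L: "L \<subseteq> carrier G" and L_inv: "\<And>x. x \<in> L \<Longrightarrow> inv x \<in> L"
  shows "generate G L = list_prod G ` lists L"
proof
  show "generate G L \<subseteq> list_prod G ` lists L"
  proof
    fix x assume "x \<in> generate G L"
    then show "x \<in> list_prod G ` lists L"
    proof induction
      case one
      show ?case by (rule image_eqI[of _ _ "[]"]) auto
    next
      case (incl h)
      then show ?case using L by (intro image_eqI[of _ _ "[h]"]) auto
    next
      case (inv h)
      then show ?case using L L_inv[OF inv] by (intro image_eqI[of _ _ "[inv h]"]) auto
    next
      case (eng h1 h2)
      then obtain xs ys where "xs \<in> lists L" "h1 = list_prod G xs" "ys \<in> lists L" "h2 = list_prod G ys"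
        by auto
      moreover from this have "set xs \<subseteq> carrier G" "set ys \<subseteq> carrier G" using L by auto
      ultimately show ?case
        by (intro image_eqI[of _ _ "xs @ ys"]) (auto simp: list_prod_append)
    qed
  qed
  show "list_prod G ` lists L \<subseteq> generate G L"
    using list_prod_in_subgroup[OF generate_is_subgroup[OF L]] generate.incl[of _ L G] by auto
qed

text \<open>Letters are moved to the front one at a time. Moving \<open>l\<close> past a word conjugates the word,
  and taking the first occurrence of \<open>l\<close> leaves all the other occurrences untouched.\<close>

lemma collect_letter:
  assumes L: "L \<subseteq> carrier G" and conj: "\<And>a b. a \<in> L \<Longrightarrow> b \<in> L \<Longrightarrow> inv a \<otimes> b \<otimes> a \<in> L"
    and l: "l \<in> L"
  shows "set vs \<subseteq> L \<Longrightarrow> k \<le> count_list vs l \<Longrightarrow>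
    \<exists>ws. set ws \<subseteq> L \<and> length ws + k = length vs \<and> list_prod G vs = l [^] k \<otimes> list_prod G ws"
proof (induction k arbitrary: vs)
  case 0
  then show ?case using L by (intro exI[of _ vs]) auto
next
  case (Suc k)
  have lc: "l \<in> carrier G" using l L by auto
  have "l \<in> set vs" using Suc.prems(2) by (metis count_notin not_less_eq_eq zero_le)
  then obtain us ts where vs: "vs = us @ l # ts" "l \<notin> set us" by (meson split_list_first)
  define us' where "us' = map (\<lambda>u. inv l \<otimes> u \<otimes> inv (inv l)) us"
  have us: "set us \<subseteq> carrier G" "set ts \<subseteq> carrier G" "set us \<subseteq> L" "set ts \<subseteq> L"
    using vs Suc.prems L by auto
  have us'_L: "set us' \<subseteq> L" using us(3) l lc conj by (auto simp: us'_def)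
  have "k \<le> count_list ts l" using Suc.prems(2) vs by simp
  then have "k \<le> count_list (us' @ ts) l" by simp
  then obtain ws where ws: "set ws \<subseteq> L" "length ws + k = length (us' @ ts)"
      "list_prod G (us' @ ts) = l [^] k \<otimes> list_prod G ws"
    using Suc.IH[of "us' @ ts"] us'_L us by auto
  have "list_prod G us' = inv l \<otimes> list_prod G us \<otimes> inv (inv l)"
    unfolding us'_def using conj_list_prod[of "inv l" us] us lc by simp
  then have "list_prod G vs = l \<otimes> list_prod G (us' @ ts)"
    using us us'_L L lc by (simp add: vs list_prod_append group_normalize)
  also have "\<dots> = l [^] Suc k \<otimes> list_prod G ws"
    using ws(1,3) L lc by (simp only: nat_pow_Suc2[OF lc]) (simp add: m_assoc subset_iff)
  finally have "list_prod G vs = l [^] Suc k \<otimes> list_prod G ws" .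
  moreover have "length ws + Suc k = length vs" using ws(2) vs(1) by (simp add: us'_def)
  ultimately show ?case using ws(1) by blast
qed

text \<open>Collecting $n+1$ equal letters at the front and replacing their product by a shorter word shortens
any word in which some letter occurs more than $n$ times. The bound holds both for torsion letters, where
the replacement is the empty word, and for commutators in a group that is finite modulo its centre, where no
power of a letter need be trivial (\<open>commutator_power_merge\<close>).\<close>

theorem bounded_words:
  assumes L: "L \<subseteq> carrier G" and fin: "finite L"
    and conj: "\<And>a b. a \<in> L \<Longrightarrow> b \<in> L \<Longrightarrow> inv a \<otimes> b \<otimes> a \<in> L"
    and pow: "\<And>l. l \<in> L \<Longrightarrow> \<exists>ws. set ws \<subseteq> L \<and> length ws \<le> n \<and> list_prod G ws = l [^] Suc n"
    and vs: "set vs \<subseteq> L"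
  shows "\<exists>ws. set ws \<subseteq> L \<and> length ws \<le> card L * n \<and> list_prod G ws = list_prod G vs"
  using vs
proof (induction "length vs" arbitrary: vs rule: less_induct)
  case less
  show ?case
  proof (cases "\<exists>l\<in>L. Suc n \<le> count_list vs l")
    case True
    then obtain l where l: "l \<in> L" "Suc n \<le> count_list vs l" by auto
    obtain ts where ts: "set ts \<subseteq> L" "length ts + Suc n = length vs"
        "list_prod G vs = l [^] Suc n \<otimes> list_prod G ts"
      using collect_letter[OF L conj l(1) less.prems l(2)] by blast
    obtain us where us: "set us \<subseteq> L" "length us \<le> n" "list_prod G us = l [^] Suc n"
      using pow[OF l(1)] by blast
    have "list_prod G (us @ ts) = list_prod G vs"
      using us ts L by (simp add: list_prod_append)
    then show ?thesis
      using less.hyps[of "us @ ts"] us ts by auto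
  next
    case False
    have "length vs = (\<Sum>l\<in>set vs. count_list vs l)" by (simp add: sum_count_set)
    also have "\<dots> \<le> (\<Sum>l\<in>set vs. n)" using False less.prems by (intro sum_mono) (meson not_less_eq_eq subsetD)
    also have "\<dots> = card (set vs) * n" by simp
    also have "\<dots> \<le> card L * n" using card_mono[OF fin less.prems] by simp
    finally show ?thesis using less.prems by blast
  qed
qed

text \<open>Dietzmann's lemma: a finite set of torsion elements that is closed under conjugation generates a
finite group.\<close>

corollary dietzmann:
  assumes L: "L \<subseteq> carrier G" and fin: "finite L" and L_inv: "\<And>x. x \<in> L \<Longrightarrow> inv x \<in> L"
    and conj: "\<And>a b. a \<in> L \<Longrightarrow> b \<in> L \<Longrightarrow> inv a \<otimes> b \<otimes> a \<in> L"
    and pow: "\<And>l. l \<in> L \<Longrightarrow> l [^] Suc n = \<one>"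
  shows "finite (generate G L)"
proof -
  have pow': "\<exists>ws. set ws \<subseteq> L \<and> length ws \<le> n \<and> list_prod G ws = l [^] Suc n" if "l \<in> L" for l
    using pow[OF that] by (intro exI[of _ "[]"]) (simp del: nat_pow_Suc)
  have "generate G L \<subseteq> list_prod G ` {ws. set ws \<subseteq> L \<and> length ws \<le> card L * n}"
  proof
    fix x assume "x \<in> generate G L"
    then obtain vs where "vs \<in> lists L" "x = list_prod G vs"
      using generate_eq_list_prod[OF L L_inv] by blast
    then obtain ws where "set ws \<subseteq> L" "length ws \<le> card L * n" "x = list_prod G ws"
      using bounded_words[OF L fin conj pow', of vs] by (metis in_lists_conv_set subsetI)
    then show "x \<in> list_prod G ` {ws. set ws \<subseteq> L \<and> length ws \<le> card L * n}"
      by blast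
  qed
  then show ?thesis
    by (rule finite_subset) (intro finite_imageI finite_lists_length_le fin)
qed

end

section \<open>Supplements and perfect normal subgroups\<close>

context group
begin

lemma commutator_subgroup_altdef:
  "commutator_subgroup G A B = generate G {commutator G a b | a b. a \<in> A \<and> b \<in> B}"
proof -
  have "(\<Union>a\<in>A. \<Union>b\<in>B. {a \<otimes> b \<otimes> inv a \<otimes> inv b}) = {commutator G a b | a b. a \<in> A \<and> b \<in> B}"
    by (auto simp: commutator_def)
  then show ?thesis by (simp add: commutator_subgroup_def)
qed

lemma commutator_in_commutator_subgroup:
  "a \<in> A \<Longrightarrow> b \<in> B \<Longrightarrow> commutator G a b \<in> commutator_subgroup G A B"
  unfolding commutator_subgroup_altdef by (rule generate.incl) blast

lemma commutator_subgroup_least: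
  assumes "subgroup H G" "\<And>a b. a \<in> A \<Longrightarrow> b \<in> B \<Longrightarrow> commutator G a b \<in> H"
  shows "commutator_subgroup G A B \<subseteq> H"
  unfolding commutator_subgroup_altdef
  by (rule generate_subgroup_incl[OF _ assms(1)]) (use assms(2) in blast)

lemma commutator_subgroup_is_subgroup:
  "A \<subseteq> carrier G \<Longrightarrow> B \<subseteq> carrier G \<Longrightarrow> subgroup (commutator_subgroup G A B) G"
  unfolding commutator_subgroup_altdef by (rule generate_is_subgroup) (blast intro: commutator_closed)

lemma conj_eq_self:
  assumes "x \<in> carrier G" "y \<in> carrier G" "commutator G x y = \<one>"
  shows "x \<otimes> y \<otimes> inv x = y"
proof -
  have "x \<otimes> y = y \<otimes> x" using assms by (simp add: commutator_eq_one_iff)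
  then have "x \<otimes> y \<otimes> inv x = y \<otimes> x \<otimes> inv x" by simp
  then show ?thesis using assms by (simp add: m_assoc)
qed

lemma commutator_in_normal:
  assumes "N \<lhd> G" "x \<in> carrier G" "y \<in> carrier G" "x \<in> N \<or> y \<in> N"
  shows "commutator G x y \<in> N"
proof -
  interpret N: normal N G by fact
  have "commutator G x y = x \<otimes> (y \<otimes> inv x \<otimes> inv y)" "commutator G x y = (x \<otimes> y \<otimes> inv x) \<otimes> inv y"
    using assms by (simp_all add: commutator_def group_normalize)
  then show ?thesis
    using assms N.inv_op_closed2 by (metis N.m_closed N.m_inv_closed)
qed

lemma normal_commutator_subgroup:
  assumes "N \<lhd> G"
  shows "commutator_subgroup G N (carrier G) \<lhd> G" "commutator_subgroup G N (carrier G) \<subseteq> N"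
proof -
  interpret N: normal N G by fact
  show "commutator_subgroup G N (carrier G) \<subseteq> N"
    by (rule commutator_subgroup_least[OF N.is_subgroup])
       (use assms commutator_in_normal N.mem_carrier in blast)
  show "commutator_subgroup G N (carrier G) \<lhd> G"
    unfolding commutator_subgroup_altdef
  proof (rule normal_generateI)
    show "{commutator G a b |a b. a \<in> N \<and> b \<in> carrier G} \<subseteq> carrier G" by auto
    fix h g assume "h \<in> {commutator G a b |a b. a \<in> N \<and> b \<in> carrier G}" and g: "g \<in> carrier G"
    then obtain a b where h: "h = commutator G a b" "a \<in> N" "b \<in> carrier G" by blast
    then show "g \<otimes> h \<otimes> inv g \<in> {commutator G a b |a b. a \<in> N \<and> b \<in> carrier G}"
      using conj_commutator[of a b g] N.inv_op_closed2[OF g h(2)] g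
      by (intro CollectI exI[of _ "g \<otimes> a \<otimes> inv g"] exI[of _ "g \<otimes> b \<otimes> inv g"]) simp
  qed
qed

lemma commutator_mult_left:
  "x \<in> carrier G \<Longrightarrow> y \<in> carrier G \<Longrightarrow> z \<in> carrier G \<Longrightarrow>
    commutator G (x \<otimes> y) z = (x \<otimes> commutator G y z \<otimes> inv x) \<otimes> commutator G x z"
  by (simp add: commutator_def group_normalize)

lemma commutator_mult_right:
  "x \<in> carrier G \<Longrightarrow> y \<in> carrier G \<Longrightarrow> z \<in> carrier G \<Longrightarrow>
    commutator G x (y \<otimes> z) = commutator G x y \<otimes> (y \<otimes> commutator G x z \<otimes> inv y)"
  by (simp add: commutator_def group_normalize)

text \<open>Modulo $[R, G]$ the subgroup $R$ is central, so in $G = AR$ commutators of elements of $G$ are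
commutators of elements of $A$. Thus $[G, G] \subseteq A[R, G]$, and $G = A[G, G]$ finishes the argument.\<close>

lemma supplement_descends:
  assumes A: "subgroup A G" and R: "R \<lhd> G" and AR: "A <#> R = carrier G"
    and AD: "A <#> commutator_subgroup G (carrier G) (carrier G) = carrier G"
  shows "A <#> commutator_subgroup G R (carrier G) = carrier G"
proof -
  define N where "N = commutator_subgroup G R (carrier G)"
  have N: "N \<lhd> G" "N \<subseteq> R" unfolding N_def using normal_commutator_subgroup[OF R] by auto
  interpret R: normal R G by fact
  interpret N: normal N G by (rule N)
  interpret A: subgroup A G by fact
  have B: "subgroup (A <#> N) G"
    using mult_norm_subgroup[OF N(1) A] commut_normal[OF A N(1)] by simp
  have prod_B: "a \<otimes> b \<in> A <#> N" if "a \<in> A" "b \<in> N" for a b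
    using that by (auto simp: set_mult_def)
  have A_B: "A \<subseteq> A <#> N"
    using prod_B[OF _ N.one_closed] by auto
  have N_B: "N \<subseteq> A <#> N"
    using prod_B[OF A.one_closed] by auto
  have "commutator_subgroup G (carrier G) (carrier G) \<subseteq> A <#> N"
  proof (rule commutator_subgroup_least[OF B])
    fix x y assume "x \<in> carrier G" and y: "y \<in> carrier G"
    then obtain a r a' r' where x: "x = a \<otimes> r" "a \<in> A" "r \<in> R" and y': "y = a' \<otimes> r'" "a' \<in> A" "r' \<in> R"
      unfolding AR[symmetric] by (auto simp: set_mult_def)
    have "commutator G r y \<in> N"
      unfolding N_def using x y by (intro commutator_in_commutator_subgroup)
    moreover have "commutator G r' a \<in> N"
      unfolding N_def using x y' by (intro commutator_in_commutator_subgroup) auto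
    then have "commutator G a r' \<in> N"
      using N.m_inv_closed inv_commutator[of r' a] x y' by fastforce
    ultimately have n: "a \<otimes> commutator G r y \<otimes> inv a \<in> A <#> N" "a' \<otimes> commutator G a r' \<otimes> inv a' \<in> A <#> N"
      using N.inv_op_closed2 x y' N_B by auto
    have "commutator G a a' \<in> A" using x y' by (simp add: commutator_def)
    then have "commutator G a a' \<in> A <#> N" using A_B by blast
    then have "(a \<otimes> commutator G r y \<otimes> inv a) \<otimes> (commutator G a a' \<otimes> (a' \<otimes> commutator G a r' \<otimes> inv a')) \<in> A <#> N"
      by (intro subgroup.m_closed[OF B] n)
    moreover have "commutator G x y = (a \<otimes> commutator G r y \<otimes> inv a) \<otimes> commutator G a y"
      unfolding x(1) using x(2,3) y by (intro commutator_mult_left) auto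
    moreover have "commutator G a y = commutator G a a' \<otimes> (a' \<otimes> commutator G a r' \<otimes> inv a')"
      unfolding y'(1) using x(2) y'(2,3) by (intro commutator_mult_right) auto
    ultimately show "commutator G x y \<in> A <#> N" by (simp only:)
  qed
  then have "A <#> commutator_subgroup G (carrier G) (carrier G) \<subseteq> A <#> N"
    using A_B subgroup.m_closed[OF B] unfolding set_mult_def[of _ A "commutator_subgroup G (carrier G) (carrier G)"] by blast
  then show ?thesis
    using AD subgroup.subset[OF B] by (simp add: N_def)
qed

lemma subgroup_mult_carrier:
  assumes "subgroup A G"
  shows "A <#> carrier G = carrier G"
proof
  show "A <#> carrier G \<subseteq> carrier G"
    using subgroup.subset[OF assms] by (auto simp: set_mult_def)
  show "carrier G \<subseteq> A <#> carrier G"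
  proof
    fix g assume "g \<in> carrier G"
    then have "\<one> \<otimes> g \<in> A <#> carrier G"
      using subgroup.one_closed[OF assms] unfolding set_mult_def by blast
    then show "g \<in> A <#> carrier G" using \<open>g \<in> carrier G\<close> by simp
  qed
qed

text \<open>A normal supplement of \<open>A\<close> of least order cannot shrink any further under \<open>supplement_descends\<close>.\<close>

lemma exists_perfect_supplement:
  assumes fin: "finite (carrier G)" and A: "subgroup A G"
    and AD: "A <#> commutator_subgroup G (carrier G) (carrier G) = carrier G"
  obtains R where "R \<lhd> G" "A <#> R = carrier G" "commutator_subgroup G R (carrier G) = R"
proof -
  have G: "carrier G \<lhd> G" by (simp add: normal_inv_iff subgroup_self)
  have "A <#> carrier G = carrier G" by (rule subgroup_mult_carrier[OF A])
  then obtain R where R: "R \<lhd> G \<and> A <#> R = carrier G"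
      and min: "\<And>S. S \<lhd> G \<and> A <#> S = carrier G \<Longrightarrow> card R \<le> card S"
    using ex_has_least_nat[of "\<lambda>R. R \<lhd> G \<and> A <#> R = carrier G" "carrier G" card] G by metis
  have "finite R" using R fin by (meson finite_subset normal_imp_subgroup subgroup.subset)
  then have "commutator_subgroup G R (carrier G) = R"
    using normal_commutator_subgroup[of R] R supplement_descends[OF A _ _ AD, of R]
    by (intro card_seteq min) auto
  then show thesis using R that by blast
qed

text \<open>Descending induction on \<open>t\<close>. If \<open>R\<close> centralizes $K_{t+1}$ and $k \in K_t$, then
$\beta(x) = [x, k]$ takes values in $K_{t+1}$, hence is multiplicative up to order on \<open>R\<close>; it also commutes with conjugation by $G$
because $k$ and its conjugates differ by elements of $K_{t+1}$. Therefore $\beta([x, g])$ is a commutator of $g$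
with $\beta(x)^{\pm 1}$, and as $R = [R, G]$, a second induction pushes $\beta(R)$ down the whole chain to the
trivial group.\<close>

lemma perfect_centralizes_chain:
  assumes R: "R \<lhd> G" and perfect: "commutator_subgroup G R (carrier G) = R"
    and K: "\<And>t. t \<le> n \<Longrightarrow> subgroup (K t) G"
    and K_step: "\<And>t k g. t < n \<Longrightarrow> k \<in> K t \<Longrightarrow> g \<in> carrier G \<Longrightarrow> commutator G k g \<in> K (Suc t)"
    and K_last: "K n = {\<one>}"
    and "t \<le> n" "r \<in> R" "k \<in> K t"
  shows "commutator G r k = \<one>"
proof -
  interpret R: normal R G by fact
  have "\<forall>r\<in>R. \<forall>k\<in>K t. commutator G r k = \<one>"
    using \<open>t \<le> n\<close>
  proof (induction rule: inc_induct)
    case base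
    show ?case using K_last by (simp add: commutator_def)
  next
    case (step t)
    then have t: "t < n" "t \<le> n" by auto
    note central = step.IH
    show ?case
    proof (intro ballI)
      fix r k assume r: "r \<in> R" and k: "k \<in> K t"
      have kc: "k \<in> carrier G" using k subgroup.mem_carrier[OF K[OF t(2)]] by blast
      define \<beta> where "\<beta> = (\<lambda>x. commutator G x k)"
      have \<beta>_closed: "\<beta> x \<in> carrier G" if "x \<in> R" for x using that kc by (simp add: \<beta>_def)
      have \<beta>_K: "\<beta> x \<in> K (Suc t)" if "x \<in> R" for x
      proof -
        have "commutator G k x \<in> K (Suc t)" using K_step[OF t(1) k] that by auto
        then show ?thesis
          using subgroup.m_inv_closed[OF K[of "Suc t"]] inv_commutator[OF kc R.mem_carrier[OF that]] t
          unfolding \<beta>_def by fastforce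
      qed
      have \<beta>_mult: "\<beta> (x \<otimes> y) = \<beta> y \<otimes> \<beta> x" if "x \<in> R" "y \<in> R" for x y
      proof -
        have "commutator G x (\<beta> y) = \<one>" using central \<beta>_K that by blast
        then have "x \<otimes> \<beta> y \<otimes> inv x = \<beta> y"
          using conj_eq_self that \<beta>_closed by simp
        then show ?thesis
          using commutator_mult_left[of x y k] that kc by (simp add: \<beta>_def)
      qed
      have \<beta>_conj: "\<beta> (g \<otimes> x \<otimes> inv g) = g \<otimes> \<beta> x \<otimes> inv g" if "x \<in> R" "g \<in> carrier G" for x g
      proof -
        define k' where "k' = commutator G (inv k) (inv g)"
        have "inv k \<in> K t" using subgroup.m_inv_closed[OF K[OF t(2)] k] .
        then have k': "k' \<in> K (Suc t)" "k' \<in> carrier G"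
          unfolding k'_def using K_step[OF t(1)] that kc by auto
        have "commutator G x k' = \<one>" using central that k' by blast
        then have "commutator G x (k \<otimes> k') = \<beta> x"
          using commutator_mult_right[of x k k'] that kc k' by (simp add: \<beta>_def)
        moreover have "k \<otimes> k' = inv g \<otimes> k \<otimes> g"
          using that kc by (simp add: k'_def commutator_def group_normalize)
        ultimately have "g \<otimes> \<beta> x \<otimes> inv g = commutator G (g \<otimes> x \<otimes> inv g) (g \<otimes> (inv g \<otimes> k \<otimes> g) \<otimes> inv g)"
          using that kc conj_commutator[of x "inv g \<otimes> k \<otimes> g" g] by simp
        moreover have "g \<otimes> (inv g \<otimes> k \<otimes> g) \<otimes> inv g = k"
          using that kc by (simp add: group_normalize)
        ultimately show ?thesis by (simp add: \<beta>_def)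
      qed
      have \<beta>_one: "\<beta> \<one> = \<one>" using kc by (simp add: \<beta>_def commutator_def)
      have \<beta>_inv: "\<beta> (inv x) = inv (\<beta> x)" if "x \<in> R" for x
        using \<beta>_mult[of x "inv x"] \<beta>_one that \<beta>_closed by (intro inv_equality[symmetric]) simp_all
      \<comment> \<open>The second induction: perfectness of \<open>R\<close> moves the values of \<open>\<beta>\<close> one step down the chain.\<close>
      have "\<forall>x\<in>R. \<beta> x \<in> K s" if "Suc t \<le> s" "s \<le> n" for s
        using that
      proof (induction rule: dec_induct)
        case base
        show ?case using \<beta>_K by blast
      next
        case (step s)
        then have s: "s < n" "s \<le> n" "Suc s \<le> n" and IH: "\<And>x. x \<in> R \<Longrightarrow> \<beta> x \<in> K s" by auto
        interpret Ks: subgroup "K (Suc s)" G by (rule K[OF s(3)])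
        have "subgroup {x \<in> R. \<beta> x \<in> K (Suc s)} G"
          by (rule subgroupI) (auto simp: \<beta>_mult \<beta>_inv \<beta>_one intro: exI[of _ \<one>])
        moreover have "commutator G x g \<in> {x \<in> R. \<beta> x \<in> K (Suc s)}" if x: "x \<in> R" and g: "g \<in> carrier G" for x g
        proof -
          have gx: "g \<otimes> inv x \<otimes> inv g \<in> R" using R.inv_op_closed2 x g by simp
          have eq: "commutator G x g = x \<otimes> (g \<otimes> inv x \<otimes> inv g)"
            using x g by (simp add: commutator_def group_normalize)
          have "\<beta> (commutator G x g) = (g \<otimes> inv (\<beta> x) \<otimes> inv g) \<otimes> \<beta> x"
            unfolding eq using x g gx by (simp add: \<beta>_mult \<beta>_conj \<beta>_inv)
          also have "\<dots> = inv (commutator G (inv (\<beta> x)) g)"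
            using x g \<beta>_closed by (simp add: commutator_def group_normalize)
          also have "\<dots> \<in> K (Suc s)"
            using K_step[OF s(1) subgroup.m_inv_closed[OF K[OF s(2)] IH[OF x]] g] by simp
          finally show ?thesis using x g gx eq by simp
        qed
        ultimately have "commutator_subgroup G R (carrier G) \<subseteq> {x \<in> R. \<beta> x \<in> K (Suc s)}"
          by (intro commutator_subgroup_least)
        then show ?case using perfect by blast
      qed
      from this[of n] show "commutator G r k = \<one>"
        using t r K_last by (auto simp: \<beta>_def)
    qed
  qed
  then show ?thesis using assms by blast
qed

end

section \<open>A uniform bound on commutator width\<close>

context group
begin

text \<open>If $c = [x, y]$ and $c^{n+1}$ commutes with $x$, then $c^{n+2} = (x c x^{-1})^{n+1} c$, and the last
two factors $x c x^{-1} \cdot c = [x^2, y]$ merge into one commutator. This is the shortening step in Schur's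
theorem.\<close>

lemma commutator_power_merge:
  assumes x: "x \<in> carrier G" and y: "y \<in> carrier G"
    and comm: "commutator G x (commutator G x y [^] Suc n) = \<one>"
  shows "commutator G x y [^] Suc (Suc n) =
    list_prod G (replicate n (commutator G x (x \<otimes> y \<otimes> inv x)) @ [commutator G (x \<otimes> x) y])"
proof -
  define c where "c = commutator G x y"
  have c: "c \<in> carrier G" using x y by (simp add: c_def)
  have d: "x \<otimes> c \<otimes> inv x = commutator G x (x \<otimes> y \<otimes> inv x)"
    using conj_commutator[of x y x] x y by (simp add: c_def group_normalize)
  have xcc: "x \<otimes> c \<otimes> inv x \<otimes> c = commutator G (x \<otimes> x) y"
    using commutator_mult_left[of x x y] x y by (simp add: c_def)
  have "c [^] Suc (Suc n) = x \<otimes> c [^] Suc n \<otimes> inv x \<otimes> c"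
    using conj_eq_self[of x "c [^] Suc n"] x c comm by (simp add: c_def)
  also have "x \<otimes> c [^] Suc n \<otimes> inv x = x \<otimes> list_prod G (replicate (Suc n) c) \<otimes> inv x"
    using c list_prod_replicate[of c "Suc n"] by simp
  also have "\<dots> = list_prod G (replicate (Suc n) (x \<otimes> c \<otimes> inv x))"
    by (subst conj_list_prod) (use x c in \<open>auto simp: map_replicate_const\<close>)
  also have "\<dots> = (x \<otimes> c \<otimes> inv x) [^] n \<otimes> (x \<otimes> c \<otimes> inv x)"
    using list_prod_replicate[of "x \<otimes> c \<otimes> inv x" "Suc n"] x c by simp
  also have "\<dots> \<otimes> c = (x \<otimes> c \<otimes> inv x) [^] n \<otimes> (x \<otimes> c \<otimes> inv x \<otimes> c)"
    using x c by (simp add: m_assoc)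
  also have "\<dots> = list_prod G (replicate n (x \<otimes> c \<otimes> inv x) @ [x \<otimes> c \<otimes> inv x \<otimes> c])"
    using x c by (subst list_prod_append) (auto simp: list_prod_replicate)
  finally show ?thesis unfolding xcc unfolding d by (simp add: c_def)
qed

end

text \<open>A quantitative form of Schur's theorem. A commutator of elements of $R$ depends only on the images of its entries in $H$,
so there are at most $|H|^2$ of them, and $|H|$-th powers of commutators are central in $R$.\<close>

lemma (in group_hom) schur_width:
  assumes fin: "finite (carrier H)" and R: "subgroup R G"
    and central: "\<And>r k. r \<in> R \<Longrightarrow> k \<in> kernel G H h \<Longrightarrow> commutator G r k = \<one>"
    and d: "d \<in> commutator_subgroup G R R"
  shows "\<exists>ws. set ws \<subseteq> {commutator G x y | x y. x \<in> R \<and> y \<in> R} \<and>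
      length ws \<le> (order H)\<^sup>2 * order H \<and> list_prod G ws = d"
proof -
  interpret R: subgroup R G by fact
  define L where "L = {commutator G x y | x y. x \<in> R \<and> y \<in> R}"
  have L_R: "L \<subseteq> R" by (auto simp: L_def commutator_def)
  then have L: "L \<subseteq> carrier G" using R.subset by blast
  have conj: "inv a \<otimes> b \<otimes> a \<in> L" if "a \<in> R" "b \<in> L" for a b
  proof -
    obtain x y where b: "b = commutator G x y" "x \<in> R" "y \<in> R" using \<open>b \<in> L\<close> by (auto simp: L_def)
    have "inv a \<otimes> b \<otimes> a = commutator G (inv a \<otimes> x \<otimes> a) (inv a \<otimes> y \<otimes> a)"
      using G.conj_commutator[of x y "inv a"] b that by simp
    then show ?thesis using that b unfolding L_def
      by (intro CollectI exI[of _ "inv a \<otimes> x \<otimes> a"] exI[of _ "inv a \<otimes> y \<otimes> a"]) simp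
  qed
  have L_inv: "inv a \<in> L" if "a \<in> L" for a
    using that G.inv_commutator by (fastforce simp: L_def)
  have same: "commutator G x y = commutator G x' y"
    if "x \<in> R" "x' \<in> R" "y \<in> R" "h x = h x'" for x x' y
  proof -
    have k: "inv x \<otimes> x' \<in> kernel G H h" using that by (simp add: kernel_def)
    then have "commutator G (inv x \<otimes> x') y = \<one>"
      using central[OF \<open>y \<in> R\<close>] G.inv_commutator[of y "inv x \<otimes> x'"] that by fastforce
    then show ?thesis
      using G.commutator_mult_left[of x "inv x \<otimes> x'" y] that by (simp add: G.mult_inv_cancel)
  qed
  have same': "commutator G y x = commutator G y x'"
    if "x \<in> R" "x' \<in> R" "y \<in> R" "h x = h x'" for x x' y
    using same[OF that] G.inv_commutator that by (metis R.mem_carrier)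
  define \<sigma> where "\<sigma> = (\<lambda>b. SOME x. x \<in> R \<and> h x = b)"
  have \<sigma>: "\<sigma> (h x) \<in> R \<and> h (\<sigma> (h x)) = h x" if "x \<in> R" for x
    unfolding \<sigma>_def by (rule someI[of _ x]) (use that in simp)
  have "L \<subseteq> (\<lambda>(a, b). commutator G (\<sigma> a) (\<sigma> b)) ` (carrier H \<times> carrier H)"
  proof
    fix c assume "c \<in> L"
    then obtain x y where c: "c = commutator G x y" "x \<in> R" "y \<in> R" by (auto simp: L_def)
    then have "c = commutator G (\<sigma> (h x)) (\<sigma> (h y))"
      using same[of x "\<sigma> (h x)" y] same'[of y "\<sigma> (h y)" "\<sigma> (h x)"] \<sigma> by simp
    then show "c \<in> (\<lambda>(a, b). commutator G (\<sigma> a) (\<sigma> b)) ` (carrier H \<times> carrier H)"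
      using c by (intro image_eqI[of _ _ "(h x, h y)"]) auto
  qed
  moreover have "finite (carrier H \<times> carrier H)" using fin by simp
  ultimately have fin_L: "finite L" and "card L \<le> card (carrier H \<times> carrier H)"
    by (meson finite_imageI finite_subset, meson card_image_le card_mono finite_imageI le_trans)
  then have card_L: "card L \<le> (order H)\<^sup>2"
    by (simp add: order_def card_cartesian_product power2_eq_square)
  obtain n where n: "order H = Suc n"
    using H.order_gt_0_iff_finite fin by (metis gr0_implies_Suc)
  have pow: "\<exists>ws. set ws \<subseteq> L \<and> length ws \<le> Suc n \<and> list_prod G ws = c [^] Suc (Suc n)" if "c \<in> L" for c
  proof -
    obtain x y where c: "c = commutator G x y" "x \<in> R" "y \<in> R" using \<open>c \<in> L\<close> by (auto simp: L_def)
    have cG: "c \<in> carrier G" using that L by auto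
    have "h (c [^] Suc n) = \<one>\<^bsub>H\<^esub>"
      using H.pow_order_eq_1[of "h c"] cG hom_nat_pow[of c "Suc n"] n by simp
    then have "c [^] Suc n \<in> kernel G H h" using cG by (simp add: kernel_def del: G.nat_pow_Suc)
    then have "commutator G x (c [^] Suc n) = \<one>" using central c by blast
    then have "c [^] Suc (Suc n) =
        list_prod G (replicate n (commutator G x (x \<otimes> y \<otimes> inv x)) @ [commutator G (x \<otimes> x) y])"
      unfolding c(1) using c by (intro G.commutator_power_merge) auto
    moreover have "x \<otimes> y \<otimes> inv x \<in> R" "x \<otimes> x \<in> R" using c by auto
    then have "commutator G x (x \<otimes> y \<otimes> inv x) \<in> L" "commutator G (x \<otimes> x) y \<in> L"
      using c unfolding L_def by blast+
    ultimately show ?thesis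
      by (intro exI[of _ "replicate n (commutator G x (x \<otimes> y \<otimes> inv x)) @ [commutator G (x \<otimes> x) y]"]) auto
  qed
  have "d \<in> generate G L" using d by (simp add: G.commutator_subgroup_altdef L_def)
  then obtain vs where vs: "set vs \<subseteq> L" "d = list_prod G vs"
    using G.generate_eq_list_prod[OF L L_inv] by auto
  obtain ws where ws: "set ws \<subseteq> L" "length ws \<le> card L * Suc n" "list_prod G ws = list_prod G vs"
    using G.bounded_words[OF L fin_L _ pow vs(1)] conj L_R by blast
  have "length ws \<le> (order H)\<^sup>2 * order H"
    using ws(2) mult_le_mono1[OF card_L, of "Suc n"] n by simp
  then show ?thesis
    using ws(1,3) vs(2) unfolding L_def by blast
qed

context group
begin

text \<open>In the application below the group is the quotient by $[R, R]$, of which only the image of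
$R$ is abelian, so commutation is assumed just for the values that occur.\<close>

lemma list_prod_pointwise:
  assumes closed: "\<And>a. a \<in> set as \<Longrightarrow> f a \<in> carrier G" "\<And>a. a \<in> set as \<Longrightarrow> g a \<in> carrier G"
    and comm: "\<And>a b. a \<in> set as \<Longrightarrow> b \<in> set as \<Longrightarrow> g a \<otimes> f b = f b \<otimes> g a"
  shows "list_prod G (map (\<lambda>a. f a \<otimes> g a) as) = list_prod G (map f as) \<otimes> list_prod G (map g as)"
  using assms
proof (induction as)
  case (Cons a as)
  define F where "F = list_prod G (map f as)"
  define K where "K = list_prod G (map g as)"
  have FK: "F \<in> carrier G" "K \<in> carrier G"
    unfolding F_def K_def using Cons.prems(1,2) by (auto intro!: list_prod_closed)
  have cl: "f a \<in> carrier G" "g a \<in> carrier G" using Cons.prems by auto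
  have comm: "g a \<otimes> F = F \<otimes> g a"
  proof -
    have "set bs \<subseteq> set as \<Longrightarrow> g a \<otimes> list_prod G (map f bs) = list_prod G (map f bs) \<otimes> g a" for bs
    proof (induction bs)
      case (Cons b bs)
      have b: "f b \<in> carrier G" "list_prod G (map f bs) \<in> carrier G" "g a \<otimes> f b = f b \<otimes> g a"
        using Cons.prems \<open>\<And>a'. a' \<in> set (a # as) \<Longrightarrow> f a' \<in> carrier G\<close>
          \<open>\<And>a' b. a' \<in> set (a # as) \<Longrightarrow> b \<in> set (a # as) \<Longrightarrow> g a' \<otimes> f b = f b \<otimes> g a'\<close>
        by (auto intro!: list_prod_closed simp: subset_iff)
      have "g a \<otimes> (f b \<otimes> list_prod G (map f bs)) = f b \<otimes> (g a \<otimes> list_prod G (map f bs))"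
        using b cl by (simp add: m_assoc[symmetric])
      also have "\<dots> = f b \<otimes> (list_prod G (map f bs) \<otimes> g a)" using Cons by simp
      finally show ?case using b cl by (simp add: m_assoc)
    qed (use cl in simp)
    then show ?thesis by (simp add: F_def)
  qed
  have "list_prod G (map (\<lambda>a. f a \<otimes> g a) as) = F \<otimes> K"
    unfolding F_def K_def by (rule Cons.IH) (use Cons.prems in auto)
  then have "list_prod G (map (\<lambda>a. f a \<otimes> g a) (a # as)) = f a \<otimes> ((g a \<otimes> F) \<otimes> K)"
    using cl FK by (simp add: m_assoc)
  also have "\<dots> = (f a \<otimes> F) \<otimes> (g a \<otimes> K)"
    unfolding comm using cl FK by (simp add: m_assoc)
  finally show ?case by (simp add: F_def K_def)
qed simp

lemma list_prod_single:
  assumes "distinct as" "a \<in> set as" "u \<in> carrier G"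
  shows "list_prod G (map (\<lambda>b. if b = a then u else \<one>) as) = u"
  using assms
proof (induction as)
  case (Cons b as)
  have absent: "a \<notin> set bs \<Longrightarrow> list_prod G (map (\<lambda>b. if b = a then u else \<one>) bs) = \<one>" for bs
    by (induction bs) auto
  show ?case
  proof (cases "b = a")
    case True
    then show ?thesis using Cons.prems absent[of as] by simp
  next
    case False
    then show ?thesis using Cons by simp
  qed
qed simp

end

lemma (in group_hom) hom_commutator:
  "x \<in> carrier G \<Longrightarrow> y \<in> carrier G \<Longrightarrow> h (commutator G x y) = commutator H (h x) (h y)"
  by (simp add: commutator_def)

lemma (in group_hom) hom_list_prod:
  "set xs \<subseteq> carrier G \<Longrightarrow> h (list_prod G xs) = list_prod H (map h xs)"
  by (induction xs) auto

context group
begin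

text \<open>Modulo $[R, R]$ the map $f_a(s) = [s, a]$ is a homomorphism on $R$ with values in an abelian
group, so the products $\prod_a f_a(\rho_a)$ form a subgroup. It contains all $[s, g]$: write $g = a t$ with
$t \in R$ and note that $[s, a t] \equiv [s, a]$. These elements generate $R = [R, G]$.\<close>

lemma perfect_width_modulo_derived:
  assumes R: "R \<lhd> G" and perfect: "commutator_subgroup G R (carrier G) = R"
    and as: "distinct as" "set as \<subseteq> carrier G" and AR: "set as <#> R = carrier G"
    and r: "r \<in> R"
  obtains \<rho> d where "\<rho> \<in> set as \<rightarrow> R" "d \<in> commutator_subgroup G R R"
    "r = list_prod G (map (\<lambda>a. commutator G (\<rho> a) a) as) \<otimes> d"
proof -
  interpret R: normal R G by fact
  define D where "D = commutator_subgroup G R R"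
  have "D = derived G R" by (simp add: D_def commutator_subgroup_def derived_def)
  then have D: "D \<lhd> G" using derived_is_normal[OF R] by simp
  interpret D: normal D G by (rule D)
  define Q where "Q = G Mod D"
  define q where "q = (\<lambda>x. D #> x)"
  have "group Q" unfolding Q_def by (rule D.factorgroup_is_group)
  then interpret Q: group Q .
  interpret q: group_hom G Q q
    by unfold_locales (simp add: q_def Q_def D.r_coset_hom_Mod)
  have q_one: "q x = \<one>\<^bsub>Q\<^esub>" if "x \<in> D" for x
    using coset_join2[of x D] that D.is_subgroup by (simp add: q_def Q_def)
  have q_oneD: "x \<in> D" if "q x = \<one>\<^bsub>Q\<^esub>" "x \<in> carrier G" for x
    using coset_join1[of D x] that D.is_subgroup by (simp add: q_def Q_def)
  have q_comm: "q u \<otimes>\<^bsub>Q\<^esub> q v = q v \<otimes>\<^bsub>Q\<^esub> q u" if "u \<in> R" "v \<in> R" for u v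
    using q_one[OF commutator_in_commutator_subgroup[of u R v R, folded D_def]] that
    by (simp add: q.hom_commutator Q.commutator_eq_one_iff)
  define f where "f = (\<lambda>a s. q (commutator G s a))"
  have comm_R: "commutator G s a \<in> R" if "s \<in> R" "a \<in> carrier G" for s a
    using that commutator_in_normal[OF R] by auto
  have f_closed: "f a s \<in> carrier Q" if "s \<in> R" "a \<in> carrier G" for a s
    using that by (simp add: f_def)
  have q_conj: "q (s \<otimes> u \<otimes> inv s) = q u" if "s \<in> R" "u \<in> R" for s u
  proof -
    have "q (s \<otimes> u \<otimes> inv s) = (q u \<otimes>\<^bsub>Q\<^esub> q s) \<otimes>\<^bsub>Q\<^esub> inv\<^bsub>Q\<^esub> q s"
      using that q_comm[OF that] by simp
    then show ?thesis using that by (simp add: Q.m_assoc)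
  qed
  have f_mult: "f a (s \<otimes> s') = f a s \<otimes>\<^bsub>Q\<^esub> f a s'" if "s \<in> R" "s' \<in> R" "a \<in> carrier G" for a s s'
  proof -
    have "f a (s \<otimes> s') = q (s \<otimes> commutator G s' a \<otimes> inv s) \<otimes>\<^bsub>Q\<^esub> q (commutator G s a)"
      using that by (simp add: f_def commutator_mult_left)
    then show ?thesis
      using q_conj[of s "commutator G s' a"] q_comm comm_R that by (simp add: f_def)
  qed
  have f_one: "f a \<one> = \<one>\<^bsub>Q\<^esub>" if "a \<in> carrier G" for a
    using that by (simp add: f_def commutator_def)
  have f_closed': "f a (\<rho> a) \<in> carrier Q" if "\<rho> \<in> set as \<rightarrow> R" "a \<in> set as" for \<rho> a
    using that as f_closed by blast
  define P where "P = (\<lambda>\<rho>. list_prod Q (map (\<lambda>a. f a (\<rho> a)) as))"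
  have P_closed: "P \<rho> \<in> carrier Q" if "\<rho> \<in> set as \<rightarrow> R" for \<rho>
    unfolding P_def using f_closed'[OF that] by (intro Q.list_prod_closed) auto
  have P_mult: "P \<rho> \<otimes>\<^bsub>Q\<^esub> P \<rho>' = P (\<lambda>a. \<rho> a \<otimes> \<rho>' a)" if "\<rho> \<in> set as \<rightarrow> R" "\<rho>' \<in> set as \<rightarrow> R" for \<rho> \<rho>'
  proof -
    have "f a (\<rho>' a) \<otimes>\<^bsub>Q\<^esub> f b (\<rho> b) = f b (\<rho> b) \<otimes>\<^bsub>Q\<^esub> f a (\<rho>' a)" if "a \<in> set as" "b \<in> set as" for a b
    proof -
      have "\<rho>' a \<in> R" "\<rho> b \<in> R" "a \<in> carrier G" "b \<in> carrier G"
        using that \<open>\<rho> \<in> _\<close> \<open>\<rho>' \<in> _\<close> as by auto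
      then show ?thesis unfolding f_def by (intro q_comm comm_R)
    qed
    then have "P \<rho> \<otimes>\<^bsub>Q\<^esub> P \<rho>' = list_prod Q (map (\<lambda>a. f a (\<rho> a) \<otimes>\<^bsub>Q\<^esub> f a (\<rho>' a)) as)"
      unfolding P_def using f_closed'[OF that(1)] f_closed'[OF that(2)]
      by (intro Q.list_prod_pointwise[symmetric]) auto
    also have "\<dots> = P (\<lambda>a. \<rho> a \<otimes> \<rho>' a)"
      unfolding P_def
    proof (intro arg_cong[of _ _ "list_prod Q"] map_cong refl)
      fix a assume "a \<in> set as"
      then have "\<rho> a \<in> R" "\<rho>' a \<in> R" "a \<in> carrier G" using that as by auto
      then show "f a (\<rho> a) \<otimes>\<^bsub>Q\<^esub> f a (\<rho>' a) = f a (\<rho> a \<otimes> \<rho>' a)" by (rule f_mult[symmetric])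
    qed
    finally show ?thesis .
  qed
  have P_one: "P (\<lambda>a. \<one>) = \<one>\<^bsub>Q\<^esub>"
  proof -
    have "set bs \<subseteq> carrier G \<Longrightarrow> list_prod Q (map (\<lambda>a. f a \<one>) bs) = \<one>\<^bsub>Q\<^esub>" for bs
      by (induction bs) (auto simp: f_one)
    then show ?thesis using as by (simp add: P_def)
  qed
  define Y where "Y = {x \<in> R. \<exists>\<rho> \<in> set as \<rightarrow> R. q x = P \<rho>}"
  have "subgroup Y G"
  proof (rule subgroupI)
    show "Y \<subseteq> carrier G" by (auto simp: Y_def)
    have "\<one> \<in> Y" unfolding Y_def using P_one by (auto intro!: bexI[of _ "\<lambda>a. \<one>"])
    then show "Y \<noteq> {}" by auto
  next
    fix x assume "x \<in> Y"
    then obtain \<rho> where x: "x \<in> R" "\<rho> \<in> set as \<rightarrow> R" "q x = P \<rho>" by (auto simp: Y_def)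
    define \<rho>' where "\<rho>' = (\<lambda>a. inv (\<rho> a))"
    have \<rho>': "\<rho>' \<in> set as \<rightarrow> R" using x by (auto simp: \<rho>'_def)
    have "P \<rho>' \<otimes>\<^bsub>Q\<^esub> P \<rho> = P (\<lambda>a. \<rho>' a \<otimes> \<rho> a)" by (rule P_mult[OF \<rho>' x(2)])
    also have "\<dots> = P (\<lambda>a. \<one>)"
      unfolding P_def
    proof (intro arg_cong[of _ _ "list_prod Q"] map_cong refl)
      fix a assume "a \<in> set as"
      then have "\<rho> a \<in> carrier G" using Pi_mem[OF x(2)] R.mem_carrier by blast
      then show "f a (\<rho>' a \<otimes> \<rho> a) = f a \<one>" by (simp add: \<rho>'_def)
    qed
    finally have "P \<rho>' \<otimes>\<^bsub>Q\<^esub> P \<rho> = \<one>\<^bsub>Q\<^esub>" using P_one by simp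
    then have "q (inv x) = P \<rho>'"
      using x P_closed \<rho>' by (simp add: Q.inv_equality)
    then show "inv x \<in> Y" using x \<rho>' by (auto simp: Y_def)
  next
    fix x y assume "x \<in> Y" "y \<in> Y"
    then obtain \<rho> \<rho>' where x: "x \<in> R" "\<rho> \<in> set as \<rightarrow> R" "q x = P \<rho>" and y: "y \<in> R" "\<rho>' \<in> set as \<rightarrow> R" "q y = P \<rho>'"
      by (auto simp: Y_def)
    then have "q (x \<otimes> y) = P (\<lambda>a. \<rho> a \<otimes> \<rho>' a)" by (simp add: P_mult)
    moreover have "(\<lambda>a. \<rho> a \<otimes> \<rho>' a) \<in> set as \<rightarrow> R" using x y by auto
    ultimately show "x \<otimes> y \<in> Y" using x y by (auto simp: Y_def)
  qed
  moreover have "commutator G s g \<in> Y" if s: "s \<in> R" and "g \<in> carrier G" for s g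
  proof -
    obtain a t where a: "g = a \<otimes> t" "a \<in> set as" "t \<in> R"
      using \<open>g \<in> carrier G\<close> unfolding AR[symmetric] by (auto simp: set_mult_def)
    have ac: "a \<in> carrier G" using a as by auto
    have "a \<otimes> commutator G s t \<otimes> inv a \<in> D"
      using commutator_in_commutator_subgroup[of s R t R, folded D_def] s a ac by (intro D.inv_op_closed2)
    then have "q (commutator G s g) = f a s"
      unfolding a(1) f_def using s a ac q_one by (simp add: commutator_mult_right)
    also have "\<dots> = list_prod Q (map (\<lambda>b. if b = a then f a s else \<one>\<^bsub>Q\<^esub>) as)"
      using as a f_closed[OF s ac] by (simp add: Q.list_prod_single)
    also have "\<dots> = P (\<lambda>b. if b = a then s else \<one>)"
      unfolding P_def using as f_one by (intro arg_cong[of _ _ "list_prod Q"] map_cong refl) auto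
    finally show ?thesis
      using s comm_R[OF s \<open>g \<in> carrier G\<close>] unfolding Y_def
      by (intro CollectI conjI bexI[of _ "\<lambda>b. if b = a then s else \<one>"]) auto
  qed
  ultimately have "commutator_subgroup G R (carrier G) \<subseteq> Y" by (intro commutator_subgroup_least)
  then obtain \<rho> where \<rho>: "\<rho> \<in> set as \<rightarrow> R" "q r = P \<rho>" using r perfect by (auto simp: Y_def)
  define p where "p = list_prod G (map (\<lambda>a. commutator G (\<rho> a) a) as)"
  have "\<rho> a \<in> carrier G" "a \<in> carrier G" if "a \<in> set as" for a
    using Pi_mem[OF \<rho>(1) that] R.mem_carrier that as by auto
  then have cl: "set (map (\<lambda>a. commutator G (\<rho> a) a) as) \<subseteq> carrier G" by auto
  then have p: "p \<in> carrier G" unfolding p_def by (rule list_prod_closed)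
  have "q p = P \<rho>"
    unfolding p_def P_def q.hom_list_prod[OF cl] by (simp add: f_def comp_def)
  then have "q (inv p \<otimes> r) = \<one>\<^bsub>Q\<^esub>" using p r \<rho>(2) P_closed[OF \<rho>(1)] by simp
  then have "inv p \<otimes> r \<in> D" using q_oneD p r by simp
  moreover have "r = p \<otimes> (inv p \<otimes> r)" using p r by (simp add: mult_inv_cancel)
  ultimately show thesis using that \<rho>(1) unfolding D_def p_def by blast
qed

end

text \<open>The bound depends on \<open>A\<close> and \<open>H\<close> only, in particular not on the length \<open>n\<close> of the chain; this uniformity is
what allows the passage to the limit of the tower.\<close>

theorem (in group_hom) supplement_commutator_width:
  assumes fin: "finite (carrier G)" "finite (carrier H)" and A: "subgroup A G"
    and AD: "A <#> commutator_subgroup G (carrier G) (carrier G) = carrier G"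
    and K: "\<And>t. t \<le> n \<Longrightarrow> subgroup (K t) G"
    and K_step: "\<And>t k g. t < n \<Longrightarrow> k \<in> K t \<Longrightarrow> g \<in> carrier G \<Longrightarrow> commutator G k g \<in> K (Suc t)"
    and K_first: "K 0 = kernel G H h" and K_last: "K n = {\<one>}"
    and g: "g \<in> carrier G"
  shows "\<exists>a ps. a \<in> A \<and> set ps \<subseteq> carrier G \<times> carrier G \<and> length ps \<le> card A + (order H)\<^sup>2 * order H \<and>
      g = a \<otimes> list_prod G (map (\<lambda>(x, y). commutator G x y) ps)"
proof -
  obtain R where R: "R \<lhd> G" "A <#> R = carrier G" "commutator_subgroup G R (carrier G) = R"
    using G.exists_perfect_supplement[OF fin(1) A AD] by blast
  interpret R: normal R G by (rule R)
  have A_carr: "A \<subseteq> carrier G" by (rule subgroup.subset[OF A])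
  then obtain as where as: "set as = A" "distinct as"
    using finite_distinct_list finite_subset fin(1) by metis
  obtain a r where a: "g = a \<otimes> r" "a \<in> A" "r \<in> R"
    using g unfolding R(2)[symmetric] by (auto simp: set_mult_def)
  obtain \<rho> d where \<rho>: "\<rho> \<in> set as \<rightarrow> R" "d \<in> commutator_subgroup G R R"
      "r = list_prod G (map (\<lambda>a. commutator G (\<rho> a) a) as) \<otimes> d"
    by (rule G.perfect_width_modulo_derived[OF R(1) R(3), of as r]) (use as A_carr R(2) a(3) in auto)
  have central: "commutator G s k = \<one>" if "s \<in> R" "k \<in> kernel G H h" for s k
    by (rule G.perfect_centralizes_chain[OF R(1) R(3) K K_step K_last, where t = 0])
       (use that K_first in auto)
  obtain ws where ws: "set ws \<subseteq> {commutator G x y | x y. x \<in> R \<and> y \<in> R}"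
      "length ws \<le> (order H)\<^sup>2 * order H" "list_prod G ws = d"
    using schur_width[OF fin(2) R.is_subgroup central \<rho>(2)] by blast
  have "{commutator G x y | x y. x \<in> R \<and> y \<in> R} = (\<lambda>(x, y). commutator G x y) ` (R \<times> R)" by auto
  then have "ws \<in> lists ((\<lambda>(x, y). commutator G x y) ` (R \<times> R))" using ws(1) by auto
  then obtain qs where qs: "set qs \<subseteq> R \<times> R" "ws = map (\<lambda>(x, y). commutator G x y) qs"
    unfolding lists_image by auto
  define ps where "ps = map (\<lambda>a. (\<rho> a, a)) as @ qs"
  have \<rho>_carr: "\<rho> a \<in> carrier G" "a \<in> carrier G" if "a \<in> set as" for a
    using Pi_mem[OF \<rho>(1) that] R.mem_carrier that as(1) A_carr by auto
  have ps: "set ps \<subseteq> carrier G \<times> carrier G" using \<rho>_carr qs by (auto simp: ps_def)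
  have cl: "set (map (\<lambda>a. commutator G (\<rho> a) a) as) \<subseteq> carrier G" using \<rho>_carr by auto
  have cl': "set ws \<subseteq> carrier G" using ws(1) by auto
  have "map (\<lambda>(x, y). commutator G x y) ps = map (\<lambda>a. commutator G (\<rho> a) a) as @ ws"
    by (simp add: ps_def qs(2) comp_def)
  then have "list_prod G (map (\<lambda>(x, y). commutator G x y) ps) = r"
    using \<rho>(3) ws(3) by (simp only: G.list_prod_append[OF cl cl'])
  moreover have "length ps \<le> card A + (order H)\<^sup>2 * order H"
    using ws(2) qs(2) distinct_card[OF as(2)] as(1) by (simp add: ps_def)
  ultimately show ?thesis using a ps by blast
qed

section \<open>Normal closures\<close>

lemma normal_closure_factorization:
  assumes "is_normal_closure \<Gamma> H \<phi> M act n c"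
  shows "normal_factorization \<Gamma> H \<phi> M act n c" "normal_map M H act n" "c \<in> hom \<Gamma> M"
    "\<And>x. x \<in> carrier \<Gamma> \<Longrightarrow> n (c x) = \<phi> x"
  using assms by (auto simp: is_normal_closure_def normal_factorization_def)

lemma normal_map_act_hom:
  assumes "normal_map M H act n" "g \<in> carrier H"
  shows "group_hom M M (\<lambda>m. act m g)"
  using normal_mapD(1)[OF assms(1)] assms unfolding group_hom_def group_hom_axioms_def
  by (auto simp: normal_map_def iso_def)

lemma normal_map_restrict:
  assumes nm: "normal_map M H act n" and S: "subgroup S M"
    and stable: "\<And>m g. m \<in> S \<Longrightarrow> g \<in> carrier H \<Longrightarrow> act m g \<in> S"
  shows "normal_map (M\<lparr>carrier := S\<rparr>) H act n"
proof -
  note D = normal_mapD[OF nm]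
  interpret M: group M by (rule D(1))
  interpret H: group H by (rule D(2))
  interpret S: subgroup S M by (rule S)
  have iso: "(\<lambda>m. act m g) \<in> iso (M\<lparr>carrier := S\<rparr>) (M\<lparr>carrier := S\<rparr>)" if g: "g \<in> carrier H" for g
  proof -
    have "act (act m g) (inv\<^bsub>H\<^esub> g) = m" "act (act m (inv\<^bsub>H\<^esub> g)) g = m" if "m \<in> S" for m
      using D(6,7)[of m] g that by (metis H.inv_closed H.r_inv H.l_inv S.mem_carrier)+
    then have "bij_betw (\<lambda>m. act m g) S S"
      using g by (intro bij_betwI[of _ _ _ "\<lambda>m. act m (inv\<^bsub>H\<^esub> g)"]) (auto simp: stable)
    then show ?thesis using g D(4) by (auto simp: iso_def hom_def stable)
  qed
  have inv: "inv\<^bsub>M\<lparr>carrier := S\<rparr>\<^esub> m = inv\<^bsub>M\<^esub> m" if "m \<in> S" for m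
    using M.m_inv_consistent[OF S that] .
  have "n \<in> hom (M\<lparr>carrier := S\<rparr>) H"
    using D(3) by (auto simp: hom_def)
  then show ?thesis
    using M.subgroup_imp_group[OF S] H.is_group iso D(6-9) inv
    unfolding normal_map_def by simp
qed

text \<open>The elements $c(x)^g$ generate a subgroup that is stable under the action, hence is again a normal map
under $\Gamma$. The universal map into it, followed by the inclusion, must be the identity.\<close>

lemma normal_closure_generated:
  fixes M :: "'m monoid"
  assumes nc: "is_normal_closure \<Gamma> H \<phi> M act n c"
  shows "generate M {act (c x) g | x g. x \<in> carrier \<Gamma> \<and> g \<in> carrier H} = carrier M"
proof -
  note fac = normal_closure_factorization[OF nc]
  note D = normal_mapD[OF fac(2)]
  interpret M: group M by (rule D(1))
  interpret H: group H by (rule D(2))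
  have c: "c x \<in> carrier M" if "x \<in> carrier \<Gamma>" for x
    using fac(3) that by (auto simp: hom_def)
  define L where "L = {act (c x) g | x g. x \<in> carrier \<Gamma> \<and> g \<in> carrier H}"
  define S where "S = generate M L"
  have L: "L \<subseteq> carrier M" using D(5) c by (auto simp: L_def)
  have S: "subgroup S M" unfolding S_def by (rule M.generate_is_subgroup[OF L])
  interpret S: subgroup S M by (rule S)
  have stable: "act m g \<in> S" if "m \<in> S" and g: "g \<in> carrier H" for m g
  proof -
    interpret a: group_hom M M "\<lambda>m. act m g" by (rule normal_map_act_hom[OF fac(2) g])
    have "(\<lambda>m. act m g) ` L \<subseteq> L"
    proof
      fix y assume "y \<in> (\<lambda>m. act m g) ` L"
      then obtain x g' where y: "y = act (act (c x) g') g" "x \<in> carrier \<Gamma>" "g' \<in> carrier H"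
        by (auto simp: L_def)
      then have "y = act (c x) (g' \<otimes>\<^bsub>H\<^esub> g)" using D(7) c g by simp
      then show "y \<in> L" using y g unfolding L_def by blast
    qed
    then have "generate M ((\<lambda>m. act m g) ` L) \<subseteq> S" unfolding S_def by (rule M.mono_generate)
    then show ?thesis using a.generate_img[OF L] that(1) unfolding S_def by blast
  qed
  define N where "N = M\<lparr>carrier := S\<rparr>"
  have nmN: "normal_map N H act n" unfolding N_def by (rule normal_map_restrict[OF fac(2) S stable])
  have cS: "c x \<in> S" if "x \<in> carrier \<Gamma>" for x
  proof -
    have "act (c x) \<one>\<^bsub>H\<^esub> \<in> L" using that H.one_closed unfolding L_def by blast
    then show ?thesis using D(6)[OF c[OF that]] generate.incl[of _ L M] by (simp add: S_def)
  qed
  have facN: "normal_factorization \<Gamma> H \<phi> N act n c"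
    using nmN fac(3,4) cS by (auto simp: normal_factorization_def N_def hom_def)
  have univ: "universal_among TYPE('m) \<Gamma> H \<phi> M act n c"
    using nc by (simp add: is_normal_closure_def)
  obtain u where u: "normal_morphism H M act n N act n u" "\<And>x. x \<in> carrier \<Gamma> \<Longrightarrow> u (c x) = c x"
    using universal_amongD[OF univ facN] by blast
  have u': "normal_morphism H M act n M act n u"
    using u(1) S.subset by (auto simp: normal_morphism_def N_def hom_def)
  have id: "normal_morphism H M act n M act n id"
    by (simp add: normal_morphism_def hom_def)
  have "carrier M \<subseteq> S"
  proof
    fix x assume x: "x \<in> carrier M"
    have "u x = id x"
      by (rule universal_among_unique[OF univ fac(1) fac(1) u' u(2) id _ x]) auto
    moreover have "u x \<in> S" using u(1) x by (auto simp: normal_morphism_def N_def hom_def)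
    ultimately show "x \<in> S" by simp
  qed
  then show ?thesis using S.subset by (auto simp: S_def L_def)
qed

text \<open>The generators $c(x)^g$ are finitely many torsion elements. They are permuted by conjugation, which by the
Peiffer identity is the action of an element of $H$, so Dietzmann's lemma applies.\<close>

lemma normal_closure_finite:
  assumes nc: "is_normal_closure \<Gamma> H \<phi> M act n c"
    and \<Gamma>: "group \<Gamma>" "finite (carrier \<Gamma>)" and fin: "finite (carrier H)"
  shows "finite (carrier M)"
proof -
  note fac = normal_closure_factorization[OF nc]
  note D = normal_mapD[OF fac(2)]
  interpret M: group M by (rule D(1))
  interpret H: group H by (rule D(2))
  interpret c: group_hom \<Gamma> M c
    using \<Gamma>(1) fac(3) D(1) by (simp add: group_hom_def group_hom_axioms_def)
  interpret n: group_hom M H n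
    using D(1-3) by (simp add: group_hom_def group_hom_axioms_def)
  define L where "L = {act (c x) g | x g. x \<in> carrier \<Gamma> \<and> g \<in> carrier H}"
  have L_memI: "act (c x) g \<in> L" if "x \<in> carrier \<Gamma>" "g \<in> carrier H" for x g
    using that unfolding L_def by blast
  have L: "L \<subseteq> carrier M" using D(5) by (auto simp: L_def)
  have "L = (\<lambda>(x, g). act (c x) g) ` (carrier \<Gamma> \<times> carrier H)" by (auto simp: L_def)
  then have fin_L: "finite L" using \<Gamma>(2) fin by simp
  have L_inv: "inv\<^bsub>M\<^esub> l \<in> L" if l: "l \<in> L" for l
  proof -
    obtain x g where l: "l = act (c x) g" "x \<in> carrier \<Gamma>" "g \<in> carrier H" using l by (auto simp: L_def)
    interpret a: group_hom M M "\<lambda>m. act m g" by (rule normal_map_act_hom[OF fac(2) l(3)])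
    have eq: "inv\<^bsub>M\<^esub> l = act (c (inv\<^bsub>\<Gamma>\<^esub> x)) g" using l by simp
    show ?thesis unfolding eq by (rule L_memI) (use l in auto)
  qed
  have conj: "inv\<^bsub>M\<^esub> a \<otimes>\<^bsub>M\<^esub> b \<otimes>\<^bsub>M\<^esub> a \<in> L" if a: "a \<in> L" and b: "b \<in> L" for a b
  proof -
    obtain x g where b': "b = act (c x) g" "x \<in> carrier \<Gamma>" "g \<in> carrier H" using b by (auto simp: L_def)
    have ab: "a \<in> carrier M" "b \<in> carrier M" using a b L by auto
    have "inv\<^bsub>M\<^esub> a \<otimes>\<^bsub>M\<^esub> b \<otimes>\<^bsub>M\<^esub> a = act b (n a)" using D(9)[OF ab(2,1)] by simp
    also have "\<dots> = act (c x) (g \<otimes>\<^bsub>H\<^esub> n a)" using b' ab D(7) by simp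
    finally show ?thesis using L_memI b' ab by simp
  qed
  obtain k where k: "order \<Gamma> = Suc k"
    using c.G.order_gt_0_iff_finite \<Gamma>(2) by (metis gr0_implies_Suc)
  have pow: "l [^]\<^bsub>M\<^esub> Suc k = \<one>\<^bsub>M\<^esub>" if l: "l \<in> L" for l
  proof -
    obtain x g where l: "l = act (c x) g" "x \<in> carrier \<Gamma>" "g \<in> carrier H" using l by (auto simp: L_def)
    interpret a: group_hom M M "\<lambda>m. act m g" by (rule normal_map_act_hom[OF fac(2) l(3)])
    have "l [^]\<^bsub>M\<^esub> Suc k = act (c (x [^]\<^bsub>\<Gamma>\<^esub> Suc k)) g"
      unfolding l(1) using l(2) by (simp add: a.hom_nat_pow[symmetric] c.hom_nat_pow[symmetric] del: c.G.nat_pow_Suc M.nat_pow_Suc)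
    also have "x [^]\<^bsub>\<Gamma>\<^esub> Suc k = \<one>\<^bsub>\<Gamma>\<^esub>" using c.G.pow_order_eq_1[OF l(2)] k by simp
    finally show ?thesis by simp
  qed
  have "finite (generate M L)" by (rule M.dietzmann[OF L fin_L L_inv conj pow])
  then show ?thesis unfolding L_def normal_closure_generated[OF nc] .
qed

lemma normal_map_kernel_central:
  assumes nm: "normal_map M H act n" and k: "k \<in> carrier M" "n k = \<one>\<^bsub>H\<^esub>" and m: "m \<in> carrier M"
  shows "commutator M k m = \<one>\<^bsub>M\<^esub>"
proof -
  note D = normal_mapD[OF nm]
  interpret M: group M by (rule D(1))
  have "m = inv\<^bsub>M\<^esub> k \<otimes>\<^bsub>M\<^esub> m \<otimes>\<^bsub>M\<^esub> k" using D(6)[OF m] D(9)[OF m k(1)] k(2) by simp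
  then have "k \<otimes>\<^bsub>M\<^esub> m = m \<otimes>\<^bsub>M\<^esub> k"
    using k m by (metis M.inv_closed M.m_assoc M.m_closed M.mult_inv_cancel)
  then show ?thesis using k m by (simp add: M.commutator_eq_one_iff)
qed

text \<open>The pullback of $N \to B$ along \<open>f\<close> is a normal map to \<open>H\<close>: an element $g$ acts on the second coordinate
by conjugation with any lift of $f(g)$ to $N$, and the choice of the lift does not matter because the kernel is
central. The universal property, tested against this pullback, yields the lift.\<close>

lemma normal_closure_lifts_to_central_extension:
  fixes N :: "'n monoid" and B :: "'b monoid"
  assumes nc: "is_normal_closure \<Gamma> H \<phi> M act n c" and \<Gamma>: "group \<Gamma>" and \<phi>: "\<phi> \<in> hom \<Gamma> H"
    and p: "group_hom N B p" and surj: "p ` carrier N = carrier B"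
    and central: "\<And>z w. z \<in> kernel N B p \<Longrightarrow> w \<in> carrier N \<Longrightarrow> commutator N z w = \<one>\<^bsub>N\<^esub>"
    and f: "f \<in> hom H B" and \<psi>: "\<psi> \<in> hom \<Gamma> N" and compat: "\<And>x. x \<in> carrier \<Gamma> \<Longrightarrow> p (\<psi> x) = f (\<phi> x)"
  obtains u where "u \<in> hom M N" "\<And>x. x \<in> carrier \<Gamma> \<Longrightarrow> u (c x) = \<psi> x"
proof -
  interpret p: group_hom N B p by (rule p)
  have "group H" using normal_mapD(2)[OF normal_closure_factorization(2)[OF nc]] .
  then interpret H: group H .
  interpret f: group_hom H B f
    using H.is_group p.H.is_group f by (simp add: group_hom_def group_hom_axioms_def)
  have "group (H \<times>\<times> N)" by (rule DirProd_group[OF H.is_group p.G.is_group])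
  then interpret HN: group "H \<times>\<times> N" .
  define S where "S = {(t, z). t \<in> carrier H \<and> z \<in> carrier N \<and> f t = p z}"
  have S: "subgroup S (H \<times>\<times> N)"
  proof (rule HN.subgroupI)
    have "(\<one>\<^bsub>H\<^esub>, \<one>\<^bsub>N\<^esub>) \<in> S" by (simp add: S_def)
    then show "S \<noteq> {}" by blast
  qed (auto simp: S_def inv_DirProd[OF H.is_group p.G.is_group])
  define P where "P = (H \<times>\<times> N)\<lparr>carrier := S\<rparr>"
  have P_simps: "carrier P = S" "(t, z) \<otimes>\<^bsub>P\<^esub> (t', z') = (t \<otimes>\<^bsub>H\<^esub> t', z \<otimes>\<^bsub>N\<^esub> z')" for t z t' z'
    by (simp_all add: P_def)
  have P_inv: "inv\<^bsub>P\<^esub> (t, z) = (inv\<^bsub>H\<^esub> t, inv\<^bsub>N\<^esub> z)" if "(t, z) \<in> S" for t z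
    using HN.m_inv_consistent[OF S that] inv_DirProd[OF H.is_group p.G.is_group, of t z] that
    by (simp add: P_def S_def)
  have P: "group P" unfolding P_def by (rule HN.subgroup_imp_group[OF S])
  \<comment> \<open>A set-theoretic section; by centrality all choices give the same action (\<open>conj_cong\<close>).\<close>
  define \<sigma> where "\<sigma> = (\<lambda>g. SOME z. z \<in> carrier N \<and> p z = f g)"
  have \<sigma>: "\<sigma> g \<in> carrier N" "p (\<sigma> g) = f g" if "g \<in> carrier H" for g
  proof -
    have "f g \<in> p ` carrier N" using that surj by simp
    then have "\<exists>z. z \<in> carrier N \<and> p z = f g" by auto
    then show "\<sigma> g \<in> carrier N" "p (\<sigma> g) = f g"
      unfolding \<sigma>_def using someI_ex[of "\<lambda>z. z \<in> carrier N \<and> p z = f g"] by auto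
  qed
  define conj where "conj = (\<lambda>z s. inv\<^bsub>N\<^esub> s \<otimes>\<^bsub>N\<^esub> z \<otimes>\<^bsub>N\<^esub> s)"
  have conj_cong: "conj z s = conj z s'"
    if "z \<in> carrier N" "s \<in> carrier N" "s' \<in> carrier N" "p s = p s'" for z s s'
  proof -
    define k where "k = s' \<otimes>\<^bsub>N\<^esub> inv\<^bsub>N\<^esub> s"
    have k: "k \<in> kernel N B p" "k \<in> carrier N" using that by (simp_all add: k_def kernel_def)
    have s': "s' = k \<otimes>\<^bsub>N\<^esub> s" using that by (simp add: k_def p.G.m_assoc)
    have "k \<otimes>\<^bsub>N\<^esub> z = z \<otimes>\<^bsub>N\<^esub> k"
      using central[OF k(1) that(1)] k(2) that(1) by (simp add: p.G.commutator_eq_one_iff)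
    then have "inv\<^bsub>N\<^esub> k \<otimes>\<^bsub>N\<^esub> (z \<otimes>\<^bsub>N\<^esub> k) = z"
      using k(2) that(1) p.G.inv_mult_cancel[of k z] by simp
    moreover have "conj z s' = inv\<^bsub>N\<^esub> s \<otimes>\<^bsub>N\<^esub> (inv\<^bsub>N\<^esub> k \<otimes>\<^bsub>N\<^esub> (z \<otimes>\<^bsub>N\<^esub> k)) \<otimes>\<^bsub>N\<^esub> s"
      unfolding conj_def s' using k(2) that(1,2) by (simp add: p.G.group_normalize)
    ultimately show ?thesis by (simp add: conj_def)
  qed
  define actP where "actP = (\<lambda>m g. (inv\<^bsub>H\<^esub> g \<otimes>\<^bsub>H\<^esub> fst m \<otimes>\<^bsub>H\<^esub> g, conj (snd m) (\<sigma> g)))"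
  have act_closed: "actP m g \<in> S" if "m \<in> S" "g \<in> carrier H" for m g
    using that \<sigma>[of g] by (auto simp: actP_def conj_def S_def)
  have act_one: "actP m \<one>\<^bsub>H\<^esub> = m" if "m \<in> S" for m
    using that \<sigma>[of "\<one>\<^bsub>H\<^esub>"] conj_cong[of "snd m" "\<sigma> \<one>\<^bsub>H\<^esub>" "\<one>\<^bsub>N\<^esub>"]
    by (auto simp: actP_def S_def conj_def)
  have act_act: "actP (actP m g) g' = actP m (g \<otimes>\<^bsub>H\<^esub> g')"
    if "m \<in> S" and g: "g \<in> carrier H" "g' \<in> carrier H" for m g g'
  proof -
    have m: "fst m \<in> carrier H" "snd m \<in> carrier N" using \<open>m \<in> S\<close> by (auto simp: S_def)
    have "conj (snd m) (\<sigma> (g \<otimes>\<^bsub>H\<^esub> g')) = conj (snd m) (\<sigma> g \<otimes>\<^bsub>N\<^esub> \<sigma> g')"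
      using \<sigma> g m by (intro conj_cong) auto
    also have "\<dots> = conj (conj (snd m) (\<sigma> g)) (\<sigma> g')"
      using \<sigma> g m by (simp add: conj_def p.G.group_normalize)
    finally show ?thesis
      using g m by (simp add: actP_def H.group_normalize)
  qed
  have act_hom: "(\<lambda>m. actP m g) \<in> hom P P" if g: "g \<in> carrier H" for g
  proof (rule homI)
    fix m m' assume "m \<in> carrier P" "m' \<in> carrier P"
    then have mS: "m \<in> S" "m' \<in> S" by (simp_all add: P_simps)
    obtain t z t' z' where tz: "m = (t, z)" "m' = (t', z')" by (metis surj_pair)
    with mS have m: "m = (t, z)" "m' = (t', z')" "t \<in> carrier H" "t' \<in> carrier H"
        "z \<in> carrier N" "z' \<in> carrier N" "(t, z) \<in> S" "(t', z') \<in> S"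
      by (auto simp: S_def)
    show "actP (m \<otimes>\<^bsub>P\<^esub> m') g = actP m g \<otimes>\<^bsub>P\<^esub> actP m' g"
      using m g \<sigma>[OF g] by (simp add: P_simps actP_def conj_def H.group_normalize p.G.group_normalize)
  qed (use act_closed g in \<open>simp add: P_simps\<close>)
  have act_iso: "(\<lambda>m. actP m g) \<in> iso P P" if g: "g \<in> carrier H" for g
  proof -
    have "bij_betw (\<lambda>m. actP m g) S S"
      by (rule bij_betwI[of _ _ _ "\<lambda>m. actP m (inv\<^bsub>H\<^esub> g)"])
         (use g in \<open>auto simp: act_closed act_act act_one\<close>)
    then show ?thesis using act_hom[OF g] by (simp add: iso_def P_simps)
  qed
  have peiffer: "actP m (fst m') = inv\<^bsub>P\<^esub> m' \<otimes>\<^bsub>P\<^esub> m \<otimes>\<^bsub>P\<^esub> m'" if "m \<in> S" "m' \<in> S" for m m'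
  proof -
    obtain t z t' z' where tz: "m = (t, z)" "m' = (t', z')" by (metis surj_pair)
    with that have m: "m = (t, z)" "m' = (t', z')" "t \<in> carrier H" "t' \<in> carrier H"
        "z \<in> carrier N" "z' \<in> carrier N" "(t, z) \<in> S" "(t', z') \<in> S" "f t' = p z'"
      by (auto simp: S_def)
    have "conj z (\<sigma> t') = conj z z'" using m \<sigma>[of t'] by (intro conj_cong) auto
    then show ?thesis using m by (simp add: actP_def P_inv P_simps) (simp add: conj_def)
  qed
  have nmP: "normal_map P H actP fst"
    unfolding normal_map_def
  proof (intro conjI ballI)
    show "fst \<in> hom P H" by (auto simp: hom_def P_simps S_def)
  qed (use P H.is_group act_iso act_one act_act peiffer in \<open>auto simp: P_simps actP_def\<close>)
  have "normal_factorization \<Gamma> H \<phi> P actP fst (\<lambda>x. (\<phi> x, \<psi> x))"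
    unfolding normal_factorization_def
  proof (intro conjI nmP ballI)
    show "(\<lambda>x. (\<phi> x, \<psi> x)) \<in> hom \<Gamma> P"
      using \<phi> \<psi> compat by (auto simp: hom_def P_simps S_def Pi_def)
  qed simp
  then obtain u where u: "normal_morphism H M act n P actP fst u"
      "\<And>x. x \<in> carrier \<Gamma> \<Longrightarrow> u (c x) = (\<phi> x, \<psi> x)"
    using universal_amongD[OF normal_closure_universal[OF nc \<Gamma> \<phi>]] by blast
  have "(\<lambda>m. snd (u m)) \<in> hom M N"
  proof (rule homI)
    fix m m' assume m: "m \<in> carrier M" "m' \<in> carrier M"
    have "u (m \<otimes>\<^bsub>M\<^esub> m') = u m \<otimes>\<^bsub>P\<^esub> u m'"
      using u(1) m by (simp add: normal_morphism_def hom_def)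
    then show "snd (u (m \<otimes>\<^bsub>M\<^esub> m')) = snd (u m) \<otimes>\<^bsub>N\<^esub> snd (u m')"
      using P_simps(2)[of "fst (u m)" "snd (u m)" "fst (u m')" "snd (u m')"] by simp
  next
    fix m assume "m \<in> carrier M"
    then have "u m \<in> S" using u(1) by (auto simp: normal_morphism_def hom_def P_simps)
    then show "snd (u m) \<in> carrier N" by (auto simp: S_def)
  qed
  then show thesis using that u(2) by simp
qed

section \<open>The lower central series and nilpotent quotients\<close>

lemma (in group_hom) image_commutator_subgroup:
  assumes "A \<subseteq> carrier G" "B \<subseteq> carrier G"
  shows "h ` commutator_subgroup G A B = commutator_subgroup H (h ` A) (h ` B)"
proof -
  define L where "L = {commutator G a b | a b. a \<in> A \<and> b \<in> B}"
  have "L \<subseteq> carrier G" using assms by (auto simp: L_def intro!: G.commutator_closed)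
  moreover have "h ` L = {commutator H a b | a b. a \<in> h ` A \<and> b \<in> h ` B}"
  proof -
    have "h (commutator G a b) = commutator H (h a) (h b)" if "a \<in> A" "b \<in> B" for a b
      using that assms hom_commutator by blast
    then have "(\<lambda>(a, b). h (commutator G a b)) ` (A \<times> B) = (\<lambda>(a, b). commutator H (h a) (h b)) ` (A \<times> B)"
      by (intro image_cong) auto
    moreover have "L = (\<lambda>(a, b). commutator G a b) ` (A \<times> B)" by (auto simp: L_def)
    moreover have "{commutator H a b | a b. a \<in> h ` A \<and> b \<in> h ` B} = (\<lambda>(a, b). commutator H (h a) (h b)) ` (A \<times> B)"
      by auto
    ultimately show ?thesis by (simp add: image_image case_prod_beta)
  qed
  ultimately show ?thesis
    unfolding G.commutator_subgroup_altdef H.commutator_subgroup_altdef L_def[symmetric]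
    using generate_img by metis
qed

lemma lower_central_Suc:
  "i \<ge> 1 \<Longrightarrow> lower_central G (Suc i) = commutator_subgroup G (lower_central G i) (carrier G)"
  by (cases i) auto

context group
begin

lemma lower_central_normal: "lower_central G i \<lhd> G"
proof -
  have carrier: "carrier G \<lhd> G" by (simp add: normal_inv_iff subgroup_self)
  show ?thesis
  proof (induction i)
    case (Suc i)
    then show ?case
      using carrier normal_commutator_subgroup(1)[OF Suc] by (cases i) simp_all
  qed (simp add: carrier)
qed

lemma lower_central_decreasing: "i \<ge> 1 \<Longrightarrow> lower_central G (Suc i) \<subseteq> lower_central G i"
  using normal_commutator_subgroup(2)[OF lower_central_normal] by (simp add: lower_central_Suc)

lemma commutator_subgroup_mono:
  "A \<subseteq> A' \<Longrightarrow> B \<subseteq> B' \<Longrightarrow> commutator_subgroup G A B \<subseteq> commutator_subgroup G A' B'"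
  unfolding commutator_subgroup_altdef by (rule mono_generate) blast

lemma supplement_lower_central:
  assumes A: "subgroup A G"
    and AD: "A <#> commutator_subgroup G (carrier G) (carrier G) = carrier G" and "i \<ge> 1"
  shows "A <#> lower_central G i = carrier G"
  using \<open>i \<ge> 1\<close>
proof (induction i rule: nat_induct_at_least)
  case base
  show ?case using subgroup_mult_carrier[OF A] by simp
next
  case (Suc i)
  then show ?case
    using supplement_descends[OF A lower_central_normal _ AD] by (simp add: lower_central_Suc)
qed

end

lemma (in group_hom) image_lower_central:
  assumes "i \<ge> 1"
  shows "h ` lower_central G i \<subseteq> lower_central H i"
  using assms
proof (induction i rule: nat_induct_at_least)
  case (Suc i)
  have "h ` lower_central G (Suc i) = commutator_subgroup H (h ` lower_central G i) (h ` carrier G)"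
    unfolding lower_central_Suc[OF Suc.hyps]
    by (intro image_commutator_subgroup normal_imp_subgroup[OF G.lower_central_normal, THEN subgroup.subset] order.refl)
  also have "\<dots> \<subseteq> lower_central H (Suc i)"
    unfolding lower_central_Suc[OF Suc.hyps] using Suc.IH by (intro H.commutator_subgroup_mono) auto
  finally show ?case .
qed auto

lemma (in group_hom) surj_image_lower_central:
  assumes "i \<ge> 1" and surj: "h ` carrier G = carrier H"
  shows "h ` lower_central G i = lower_central H i"
  using assms(1)
proof (induction i rule: nat_induct_at_least)
  case (Suc i)
  have "h ` lower_central G (Suc i) = commutator_subgroup H (h ` lower_central G i) (h ` carrier G)"
    unfolding lower_central_Suc[OF Suc.hyps]
    by (intro image_commutator_subgroup normal_imp_subgroup[OF G.lower_central_normal, THEN subgroup.subset] order.refl)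
  also have "\<dots> = lower_central H (Suc i)"
    using lower_central_Suc[OF Suc.hyps, of H] Suc.IH surj by simp
  finally show ?case .
qed (simp add: surj)

text \<open>Each step lifts through the central extension $\Gamma/\gamma_{i+1} \to \Gamma/\gamma_i$; the induction
starts because $\Gamma/\gamma_1$ is trivial.\<close>

lemma closures_tower_maps_to_nilpotent_quotients:
  assumes \<Gamma>: "group \<Gamma>" and G: "group G" and \<phi>: "\<phi> \<in> hom \<Gamma> G"
    and tower: "normal_closures_tower \<Gamma> G \<phi> T acts ns \<phi>s" and "i \<ge> 1"
  shows "\<exists>f \<in> hom (T i) (\<Gamma> Mod lower_central \<Gamma> i).
    \<forall>x\<in>carrier \<Gamma>. f (\<phi>s i x) = lower_central \<Gamma> i #>\<^bsub>\<Gamma>\<^esub> x"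
  using \<open>i \<ge> 1\<close>
proof (induction i rule: nat_induct_at_least)
  case base
  interpret \<Gamma>: group \<Gamma> by fact
  interpret N: normal "lower_central \<Gamma> 1" \<Gamma> by (rule \<Gamma>.lower_central_normal)
  interpret Q: group "\<Gamma> Mod lower_central \<Gamma> 1" by (rule N.factorgroup_is_group)
  have "(\<lambda>_. \<one>\<^bsub>\<Gamma> Mod lower_central \<Gamma> 1\<^esub>) \<in> hom (T 1) (\<Gamma> Mod lower_central \<Gamma> 1)"
    by (rule homI) (use Q.one_closed Q.l_one[OF Q.one_closed] in auto)
  moreover have "lower_central \<Gamma> 1 #>\<^bsub>\<Gamma>\<^esub> x = \<one>\<^bsub>\<Gamma> Mod lower_central \<Gamma> 1\<^esub>" if "x \<in> carrier \<Gamma>" for x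
    using \<Gamma>.coset_join2[OF that \<Gamma>.subgroup_self that] by simp
  ultimately show ?case by (intro bexI[of _ "\<lambda>_. \<one>\<^bsub>\<Gamma> Mod lower_central \<Gamma> 1\<^esub>"]) auto
next
  case (Suc i)
  interpret \<Gamma>: group \<Gamma> by fact
  define N where "N = \<Gamma> Mod lower_central \<Gamma> (Suc i)"
  define B where "B = \<Gamma> Mod lower_central \<Gamma> i"
  define q where "q = (\<lambda>x. lower_central \<Gamma> (Suc i) #>\<^bsub>\<Gamma>\<^esub> x)"
  define r where "r = (\<lambda>x. lower_central \<Gamma> i #>\<^bsub>\<Gamma>\<^esub> x)"
  interpret LN: normal "lower_central \<Gamma> (Suc i)" \<Gamma> by (rule \<Gamma>.lower_central_normal)
  interpret LB: normal "lower_central \<Gamma> i" \<Gamma> by (rule \<Gamma>.lower_central_normal)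
  have "group N" unfolding N_def by (rule LN.factorgroup_is_group)
  then interpret N: group N .
  have "group B" unfolding B_def by (rule LB.factorgroup_is_group)
  then interpret B: group B .
  interpret q: group_hom \<Gamma> N q by unfold_locales (simp add: q_def N_def LN.r_coset_hom_Mod)
  interpret r: group_hom \<Gamma> B r by unfold_locales (simp add: r_def B_def LB.r_coset_hom_Mod)
  have q_carrier: "carrier N = q ` carrier \<Gamma>" by (simp add: N_def q_def carrier_FactGroup)
  have r_carrier: "carrier B = r ` carrier \<Gamma>" by (simp add: B_def r_def carrier_FactGroup)
  have q_one: "q x = \<one>\<^bsub>N\<^esub>" if "x \<in> lower_central \<Gamma> (Suc i)" for x
    using \<Gamma>.coset_join2[OF _ LN.is_subgroup that] that by (simp add: q_def N_def del: lower_central.simps)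
  have r_one_iff: "r x = \<one>\<^bsub>B\<^esub> \<longleftrightarrow> x \<in> lower_central \<Gamma> i" if "x \<in> carrier \<Gamma>" for x
    using \<Gamma>.coset_join2[OF that LB.is_subgroup] \<Gamma>.coset_join1[OF _ that LB.is_subgroup] by (auto simp: r_def B_def)
  have "lower_central \<Gamma> (Suc i) \<subseteq> kernel \<Gamma> B r"
    using \<Gamma>.lower_central_decreasing[OF Suc.hyps] r_one_iff LN.subset
    by (auto simp: kernel_def simp del: lower_central.simps)
  then obtain p where p: "p \<in> hom N B" "\<And>x. x \<in> carrier \<Gamma> \<Longrightarrow> p (q x) = r x"
    using r.FactGroup_universal_kernel[OF LN.normal_axioms] unfolding N_def q_def by blast
  interpret p: group_hom N B p by unfold_locales (rule p)
  have surj: "p ` carrier N = carrier B"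
    unfolding q_carrier r_carrier image_image using p(2) by (rule image_cong[OF refl])
  have central: "commutator N z w = \<one>\<^bsub>N\<^esub>" if z: "z \<in> kernel N B p" and w: "w \<in> carrier N" for z w
  proof -
    obtain x y where x: "z = q x" "x \<in> carrier \<Gamma>" and y: "w = q y" "y \<in> carrier \<Gamma>"
      using z w unfolding kernel_def q_carrier by blast
    have "x \<in> lower_central \<Gamma> i" using z x p(2) r_one_iff by (simp add: kernel_def)
    then have "commutator \<Gamma> x y \<in> lower_central \<Gamma> (Suc i)"
      unfolding lower_central_Suc[OF Suc.hyps] using y by (intro \<Gamma>.commutator_in_commutator_subgroup)
    then show ?thesis using q.hom_commutator[OF x(2) y(2)] q_one x y by simp
  qed
  obtain f where f: "f \<in> hom (T i) B" "\<And>x. x \<in> carrier \<Gamma> \<Longrightarrow> f (\<phi>s i x) = r x"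
    using Suc.IH unfolding B_def r_def by blast
  have nc: "is_normal_closure \<Gamma> (T i) (\<phi>s i) (T (Suc i)) (acts i) (ns i) (\<phi>s (Suc i))"
    using tower Suc.hyps by (simp add: normal_closures_tower_def)
  have \<phi>s: "\<phi>s i \<in> hom \<Gamma> (T i)"
  proof (cases "i = 1")
    case True
    then show ?thesis using tower \<phi> by (simp add: normal_closures_tower_def)
  next
    case False
    then obtain j where "i = Suc j" "j \<ge> 1" using Suc.hyps by (cases i) auto
    then show ?thesis using tower normal_closure_factorization(3) unfolding normal_closures_tower_def by metis
  qed
  obtain u where u: "u \<in> hom (T (Suc i)) N" "\<And>x. x \<in> carrier \<Gamma> \<Longrightarrow> u (\<phi>s (Suc i) x) = q x"
    by (rule normal_closure_lifts_to_central_extension[OF nc \<Gamma> \<phi>s p.group_hom_axioms surj central f(1) q.homh])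
       (use p f in auto)
  then show ?case unfolding N_def q_def by blast
qed

section \<open>Inverse limits of finite groups\<close>

text \<open>The composite of \<open>p (i + d - 1), \<dots>, p i\<close>, where \<open>p j\<close> maps level \<open>j + 1\<close> to level \<open>j\<close>.\<close>

fun descend :: "(nat \<Rightarrow> 'x \<Rightarrow> 'x) \<Rightarrow> nat \<Rightarrow> nat \<Rightarrow> 'x \<Rightarrow> 'x" where
  "descend p i 0 x = x"
| "descend p i (Suc d) x = descend p i d (p (i + d) x)"

lemma descend_Suc_left: "descend p i (Suc d) x = p i (descend p (Suc i) d x)"
proof (induction d arbitrary: x)
  case (Suc d)
  have "descend p i (Suc (Suc d)) x = descend p i (Suc d) (p (i + Suc d) x)" by simp
  also have "\<dots> = p i (descend p (Suc i) d (p (i + Suc d) x))" by (rule Suc.IH)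
  finally show ?case by simp
qed simp

lemma descend_thread:
  assumes "\<And>j. j \<ge> i \<Longrightarrow> p j (x (Suc j)) = x j"
  shows "descend p i d (x (i + d)) = x i"
  using assms by (induction d) auto

lemma descend_mem:
  assumes "\<And>j x. i \<le> j \<Longrightarrow> x \<in> V (Suc j) \<Longrightarrow> p j x \<in> V j"
  shows "x \<in> V (i + d) \<Longrightarrow> descend p i d x \<in> V i"
  using assms by (induction d arbitrary: x) auto

text \<open>Koenig's lemma. Fix one element of every level and let it descend. By the pigeonhole principle one can
choose, level by level, a value that infinitely many of these descents pass through.\<close>

lemma thread_exists:
  assumes fin: "\<And>i. finite (V i)" and ne: "\<And>i. V i \<noteq> {}"
    and p: "\<And>i x. x \<in> V (Suc i) \<Longrightarrow> p i x \<in> V i"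
  shows "\<exists>s. \<forall>i :: nat. s i \<in> V i \<and> p i (s (Suc i)) = s i"
proof -
  have "\<forall>n. \<exists>x. x \<in> V n" using ne by auto
  then obtain b where b: "\<And>n. b n \<in> V n" by metis
  define D where "D = (\<lambda>i a. {d. descend p i d (b (i + d)) = a})"
  have mem: "descend p i d (b (i + d)) \<in> V i" for i d
    by (rule descend_mem[where V = V]) (use p b in auto)
  have "\<exists>s. \<forall>i. (s i \<in> V i \<and> infinite (D i (s i))) \<and> p i (s (Suc i)) = s i"
  proof (rule dependent_nat_choice)
    have "finite ((\<lambda>d. descend p 0 d (b (0 + d))) ` UNIV)"
      by (rule finite_subset[OF _ fin[of 0]]) (use mem in blast)
    then obtain d where "infinite {d' \<in> UNIV. descend p 0 d' (b (0 + d')) = descend p 0 d (b (0 + d))}"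
      using pigeonhole_infinite[of UNIV "\<lambda>d. descend p 0 d (b (0 + d))"] by blast
    then show "\<exists>x. x \<in> V 0 \<and> infinite (D 0 x)"
      using mem[of 0 d] by (auto simp: D_def)
  next
    fix a i assume a: "a \<in> V i \<and> infinite (D i a)"
    define A where "A = {d. Suc d \<in> D i a}"
    have "D i a \<subseteq> insert 0 (Suc ` A)"
    proof
      fix d assume "d \<in> D i a"
      then show "d \<in> insert 0 (Suc ` A)" by (cases d) (auto simp: A_def)
    qed
    then have "infinite A" using a by (meson finite_imageI finite_insert finite_subset)
    moreover have "finite ((\<lambda>d. descend p (Suc i) d (b (Suc i + d))) ` A)"
      by (rule finite_subset[OF _ fin[of "Suc i"]]) (use mem in blast)
    ultimately obtain d where d: "d \<in> A"
        "infinite {d' \<in> A. descend p (Suc i) d' (b (Suc i + d')) = descend p (Suc i) d (b (Suc i + d))}"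
      using pigeonhole_infinite[of A "\<lambda>d. descend p (Suc i) d (b (Suc i + d))"] by blast
    define c where "c = descend p (Suc i) d (b (Suc i + d))"
    have "infinite (D (Suc i) c)"
      by (rule infinite_super[OF _ d(2)]) (auto simp: D_def c_def)
    moreover have "p i c = a"
      using d(1) descend_Suc_left[of p i d "b (Suc i + d)"] by (simp add: A_def D_def c_def)
    ultimately show "\<exists>c. (c \<in> V (Suc i) \<and> infinite (D (Suc i) c)) \<and> p i c = a"
      using mem[of "Suc i" d] c_def by blast
  qed
  then show ?thesis by blast
qed

locale finite_tower =
  fixes T :: "nat \<Rightarrow> 'u monoid" and ns :: "nat \<Rightarrow> 'u \<Rightarrow> 'u"
  assumes group_level: "i \<ge> 1 \<Longrightarrow> group (T i)"
    and finite_level: "i \<ge> 1 \<Longrightarrow> finite (carrier (T i))"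
    and hom_level: "i \<ge> 1 \<Longrightarrow> ns i \<in> hom (T (Suc i)) (T i)"
begin

abbreviation P where "P \<equiv> tower_limit T ns"

text \<open>The image of the limit in the \<open>i\<close>-th level. The maps of the tower restrict to surjections between these
subgroups, which need not be so for the levels themselves.\<close>

definition S :: "nat \<Rightarrow> 'u set" where "S i = (\<lambda>x. x i) ` carrier P"

lemma level_closed: "i \<ge> 1 \<Longrightarrow> x \<in> carrier (T (Suc i)) \<Longrightarrow> ns i x \<in> carrier (T i)"
  using hom_level by (auto simp: hom_def)

lemma level_group_hom: "i \<ge> 1 \<Longrightarrow> group_hom (T (Suc i)) (T i) (ns i)"
  using group_level hom_level by (simp add: group_hom_def group_hom_axioms_def)

lemma P_carrier: "x \<in> carrier P \<longleftrightarrow>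
    x \<in> extensional {1..} \<and> (\<forall>i\<ge>1. x i \<in> carrier (T i) \<and> ns i (x (Suc i)) = x i)"
  by (auto simp: tower_limit_def PiE_def Pi_def)

lemma P_extensional: "x \<in> carrier P \<Longrightarrow> x \<in> extensional {1..}"
  by (simp add: P_carrier)

lemma P_level: "x \<in> carrier P \<Longrightarrow> i \<ge> 1 \<Longrightarrow> x i \<in> carrier (T i)"
  and P_compat: "x \<in> carrier P \<Longrightarrow> i \<ge> 1 \<Longrightarrow> ns i (x (Suc i)) = x i"
  by (simp_all add: P_carrier)

lemma P_mult: "i \<ge> 1 \<Longrightarrow> (x \<otimes>\<^bsub>P\<^esub> y) i = x i \<otimes>\<^bsub>T i\<^esub> y i"
  by (simp add: tower_limit_def)

lemma P_eqI:
  assumes "x \<in> carrier P" "y \<in> carrier P" "\<And>i. i \<ge> 1 \<Longrightarrow> x i = y i"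
  shows "x = y"
  by (rule extensionalityI[OF P_extensional[OF assms(1)] P_extensional[OF assms(2)]]) (use assms(3) in auto)

lemma P_group: "group P"
proof -
  define Pr where "Pr = product_group {1..} T"
  have "group Pr" unfolding Pr_def by (rule product_group) (use group_level in auto)
  then interpret Pr: group Pr .
  have level: "x i \<in> carrier (T i)" if "x \<in> carrier Pr" "i \<ge> 1" for x i
    using that by (auto simp: Pr_def)
  have inv: "(inv\<^bsub>Pr\<^esub> x) i = inv\<^bsub>T i\<^esub> x i" if "x \<in> carrier Pr" "i \<ge> 1" for x i
    using that group_level unfolding Pr_def by (subst inv_product_group) auto
  have "subgroup {x \<in> carrier Pr. \<forall>i\<ge>1. ns i (x (Suc i)) = x i} Pr"
  proof (rule Pr.subgroupI)
    have "ns i (\<one>\<^bsub>Pr\<^esub> (Suc i)) = \<one>\<^bsub>Pr\<^esub> i" if "i \<ge> 1" for i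
      using group_hom.hom_one[OF level_group_hom[OF that]] that by (simp add: Pr_def)
    then show "{x \<in> carrier Pr. \<forall>i\<ge>1. ns i (x (Suc i)) = x i} \<noteq> {}"
      using Pr.one_closed by blast
  next
    fix x assume x: "x \<in> {x \<in> carrier Pr. \<forall>i\<ge>1. ns i (x (Suc i)) = x i}"
    have "ns i ((inv\<^bsub>Pr\<^esub> x) (Suc i)) = (inv\<^bsub>Pr\<^esub> x) i" if "i \<ge> 1" for i
      using x that inv[of x] level[of x] group_hom.hom_inv[OF level_group_hom[OF that], of "x (Suc i)"] by simp
    then show "inv\<^bsub>Pr\<^esub> x \<in> {x \<in> carrier Pr. \<forall>i\<ge>1. ns i (x (Suc i)) = x i}"
      using x by simp
  next
    fix x y assume xy: "x \<in> {x \<in> carrier Pr. \<forall>i\<ge>1. ns i (x (Suc i)) = x i}"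
      "y \<in> {x \<in> carrier Pr. \<forall>i\<ge>1. ns i (x (Suc i)) = x i}"
    have "ns i ((x \<otimes>\<^bsub>Pr\<^esub> y) (Suc i)) = (x \<otimes>\<^bsub>Pr\<^esub> y) i" if "i \<ge> 1" for i
      using xy that level[of x] level[of y] group_hom.hom_mult[OF level_group_hom[OF that], of "x (Suc i)" "y (Suc i)"]
      by (simp add: Pr_def)
    then show "x \<otimes>\<^bsub>Pr\<^esub> y \<in> {x \<in> carrier Pr. \<forall>i\<ge>1. ns i (x (Suc i)) = x i}"
      using xy by simp
  qed auto
  then show ?thesis
    unfolding tower_limit_def Pr_def[symmetric] by (rule Pr.subgroup_imp_group)
qed

lemma projection_hom: "i \<ge> 1 \<Longrightarrow> group_hom P (T i) (\<lambda>x. x i)"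
  using P_group group_level P_level P_mult by (auto simp: group_hom_def group_hom_axioms_def intro!: homI)

lemma S_subgroup: "i \<ge> 1 \<Longrightarrow> subgroup (S i) (T i)"
  unfolding S_def by (rule group_hom.img_is_subgroup[OF projection_hom])

lemma descend_hom: "i \<ge> 1 \<Longrightarrow> group_hom (T (i + d)) (T i) (descend ns i d)"
proof (induction d)
  case 0
  then show ?case using group_level by (auto simp: group_hom_def group_hom_axioms_def intro!: homI)
next
  case (Suc d)
  interpret a: group_hom "T (i + d)" "T i" "descend ns i d" using Suc by simp
  interpret b: group_hom "T (Suc (i + d))" "T (i + d)" "ns (i + d)" by (rule level_group_hom) (use Suc in simp)
  show ?case
    using a.H.is_group b.G.is_group by (auto simp: group_hom_def group_hom_axioms_def intro!: homI)
qed

lemma descend_P: "x \<in> carrier P \<Longrightarrow> i \<ge> 1 \<Longrightarrow> descend ns i d (x (i + d)) = x i"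
  using P_compat by (intro descend_thread) auto

text \<open>The lifts of \<open>s\<close> to the higher levels form an inverse system of nonempty finite sets.\<close>

lemma lifts_at_all_levels_in_S:
  assumes i: "i \<ge> 1" and lifts: "\<And>d. s \<in> descend ns i d ` carrier (T (i + d))"
  shows "s \<in> S i"
proof -
  define V where "V = (\<lambda>d. {t \<in> carrier (T (i + d)). descend ns i d t = s})"
  have "\<exists>t. \<forall>d. t d \<in> V d \<and> ns (i + d) (t (Suc d)) = t d"
  proof (rule thread_exists)
    show "finite (V d)" for d using finite_level[of "i + d"] i by (simp add: V_def)
    show "V d \<noteq> {}" for d using lifts[of d] by (auto simp: V_def)
    show "ns (i + d) t \<in> V d" if "t \<in> V (Suc d)" for d t
      using that level_closed[of "i + d" t] i by (simp add: V_def)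
  qed
  then obtain t where t: "\<And>d. t d \<in> V d" "\<And>d. ns (i + d) (t (Suc d)) = t d" by blast
  define x where "x = (\<lambda>j\<in>{1..}. if i \<le> j then t (j - i) else descend ns j (i - j) s)"
  have s: "t 0 = s" "s \<in> carrier (T i)" using t(1)[of 0] by (auto simp: V_def)
  have x_ge: "x (i + d) = t d" for d using i by (simp add: x_def)
  have x_lt: "x j = descend ns j (i - j) s" if "j \<ge> 1" "j \<le> i" for j
    using that s by (cases "j = i") (simp_all add: x_def)
  have "x \<in> carrier P"
    unfolding P_carrier
  proof (intro conjI allI impI)
    show "x \<in> extensional {1..}" by (simp add: x_def)
  next
    fix j :: nat assume j: "j \<ge> 1"
    show "x j \<in> carrier (T j)"
    proof (cases "i \<le> j")
      case True
      then obtain d where "j = i + d" using le_Suc_ex by blast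
      then show ?thesis using x_ge t(1)[of d] by (simp add: V_def)
    next
      case False
      then show ?thesis
        using group_hom.hom_closed[OF descend_hom[OF j, of "i - j"], of s] s x_lt[OF j] by simp
    qed
    show "ns j (x (Suc j)) = x j"
    proof (cases "i \<le> j")
      case True
      then obtain d where "j = i + d" using le_Suc_ex by blast
      then show ?thesis using x_ge[of d] x_ge[of "Suc d"] t(2)[of d] by simp
    next
      case False
      then have "i - j = Suc (i - Suc j)" by simp
      then show ?thesis
        using descend_Suc_left[of ns j "i - Suc j" s] x_lt[OF j] x_lt[of "Suc j"] False j by simp
    qed
  qed
  moreover have "x i = s" using x_ge[of 0] s by simp
  ultimately show ?thesis unfolding S_def by blast
qed

text \<open>A finite level has only finitely many elements outside \<open>S i\<close>, and each of them fails to lift to some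
level; beyond all those levels nothing outside \<open>S i\<close> lifts.\<close>

lemma stable_image:
  assumes i: "i \<ge> 1"
  obtains d where "descend ns i d ` carrier (T (i + d)) \<subseteq> S i"
proof -
  define I where "I = (\<lambda>d. descend ns i d ` carrier (T (i + d)))"
  have "I (Suc d) \<subseteq> I d" for d
    using level_closed[of "i + d"] i by (auto simp: I_def)
  then have anti: "I e \<subseteq> I d" if "d \<le> e" for d e
    using that lift_Suc_antimono_le[of I] by blast
  have "\<exists>d. s \<notin> I d" if "s \<notin> S i" for s
    using lifts_at_all_levels_in_S[OF i, of s] that by (auto simp: I_def)
  then obtain f where f: "\<And>s. s \<notin> S i \<Longrightarrow> s \<notin> I (f s)" by metis
  define d where "d = Max (insert 0 (f ` carrier (T i)))"
  have "s \<in> S i" if s: "s \<in> I d" for s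
  proof (rule ccontr)
    assume "s \<notin> S i"
    moreover have "s \<in> carrier (T i)"
      using s group_hom.hom_closed[OF descend_hom[OF i]] by (auto simp: I_def)
    then have "f s \<le> d" unfolding d_def using finite_level[OF i] by (intro Max_ge) auto
    ultimately show False using f anti[of "f s" d] s by blast
  qed
  then show thesis using that[of d] by (auto simp: I_def)
qed

end

section \<open>The tower of normal closures of a map of finite groups\<close>

text \<open>A conjugate of $a$ differs from $a$ by a commutator.\<close>

lemma (in group) supplement_of_normally_generating:
  assumes A: "subgroup A G"
    and gen: "generate G {inv g \<otimes> a \<otimes> g | a g. a \<in> A \<and> g \<in> carrier G} = carrier G"
  shows "A <#> commutator_subgroup G (carrier G) (carrier G) = carrier G"
proof -
  define D where "D = commutator_subgroup G (carrier G) (carrier G)"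
  have D: "D \<lhd> G" unfolding D_def by (rule normal_commutator_subgroup) (simp add: normal_inv_iff subgroup_self)
  interpret A: subgroup A G by (rule A)
  have B: "subgroup (A <#> D) G"
    using mult_norm_subgroup[OF D A] commut_normal[OF A D] by simp
  have "inv g \<otimes> a \<otimes> g \<in> A <#> D" if "a \<in> A" "g \<in> carrier G" for a g
  proof -
    have "inv g \<otimes> a \<otimes> g = a \<otimes> commutator G (inv a) (inv g)"
      using that by (simp add: commutator_def group_normalize)
    moreover have "commutator G (inv a) (inv g) \<in> D"
      unfolding D_def using that by (intro commutator_in_commutator_subgroup) auto
    ultimately show ?thesis using that by (auto simp: set_mult_def)
  qed
  then have "generate G {inv g \<otimes> a \<otimes> g | a g. a \<in> A \<and> g \<in> carrier G} \<subseteq> A <#> D"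
    by (intro generate_subgroup_incl[OF _ B]) blast
  then show ?thesis using gen subgroup.subset[OF B] by (auto simp: D_def)
qed

locale finite_closures_tower =
  fixes \<Gamma> :: "'a monoid" and G :: "'u monoid" and \<phi> :: "'a \<Rightarrow> 'u"
    and T :: "nat \<Rightarrow> 'u monoid" and acts :: "nat \<Rightarrow> 'u \<Rightarrow> 'u \<Rightarrow> 'u"
    and ns :: "nat \<Rightarrow> 'u \<Rightarrow> 'u" and \<phi>s :: "nat \<Rightarrow> 'a \<Rightarrow> 'u"
  assumes \<Gamma>: "group \<Gamma>" "finite (carrier \<Gamma>)" and G: "group G" "finite (carrier G)"
    and \<phi>: "\<phi> \<in> hom \<Gamma> G" and tower: "normal_closures_tower \<Gamma> G \<phi> T acts ns \<phi>s"
begin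

lemma closure: "i \<ge> 1 \<Longrightarrow> is_normal_closure \<Gamma> (T i) (\<phi>s i) (T (Suc i)) (acts i) (ns i) (\<phi>s (Suc i))"
  using tower by (simp add: normal_closures_tower_def)

lemma level_1: "T 1 = G" "\<phi>s 1 = \<phi>"
  using tower by (simp_all add: normal_closures_tower_def)

lemma level_properties: "i \<ge> 1 \<Longrightarrow> group (T i) \<and> finite (carrier (T i)) \<and> \<phi>s i \<in> hom \<Gamma> (T i)"
proof (induction i rule: nat_induct_at_least)
  case base
  show ?case unfolding level_1 using G \<phi> by blast
next
  case (Suc i)
  note nc = closure[OF Suc.hyps]
  show ?case
    using normal_mapD(1)[OF normal_closure_factorization(2)[OF nc]] normal_closure_finite[OF nc \<Gamma>]
      normal_closure_factorization(3)[OF nc] Suc.IH by blast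
qed

lemma closure_hom: "i \<ge> 1 \<Longrightarrow> ns i \<in> hom (T (Suc i)) (T i)"
  by (rule normal_mapD(3)[OF normal_closure_factorization(2)[OF closure]])

sublocale finite_tower T ns
  by (rule finite_tower.intro) (simp_all add: level_properties closure_hom)

lemma \<phi>s_hom: "i \<ge> 1 \<Longrightarrow> group_hom \<Gamma> (T i) (\<phi>s i)"
  using level_properties \<Gamma> by (simp add: group_hom_def group_hom_axioms_def)

lemma \<phi>s_compat: "i \<ge> 1 \<Longrightarrow> x \<in> carrier \<Gamma> \<Longrightarrow> ns i (\<phi>s (Suc i) x) = \<phi>s i x"
  by (rule normal_closure_factorization(4)[OF closure])

lemma limit_map_hom: "group_hom \<Gamma> P (tower_limit_map \<phi>s)"
proof -
  interpret \<Gamma>: group \<Gamma> by (rule \<Gamma>(1))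
  interpret P: group P by (rule P_group)
  have closed: "tower_limit_map \<phi>s x \<in> carrier P" if "x \<in> carrier \<Gamma>" for x
    using that group_hom.hom_closed[OF \<phi>s_hom] \<phi>s_compat by (simp add: P_carrier tower_limit_map_def)
  moreover have "tower_limit_map \<phi>s (x \<otimes>\<^bsub>\<Gamma>\<^esub> y) = tower_limit_map \<phi>s x \<otimes>\<^bsub>P\<^esub> tower_limit_map \<phi>s y"
    if "x \<in> carrier \<Gamma>" "y \<in> carrier \<Gamma>" for x y
  proof (rule P_eqI)
    fix i :: nat assume i: "i \<ge> 1"
    show "tower_limit_map \<phi>s (x \<otimes>\<^bsub>\<Gamma>\<^esub> y) i = (tower_limit_map \<phi>s x \<otimes>\<^bsub>P\<^esub> tower_limit_map \<phi>s y) i"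
      using group_hom.hom_mult[OF \<phi>s_hom[OF i]] that i by (simp add: P_mult tower_limit_map_def)
  qed (use closed that in simp_all)
  ultimately show ?thesis
    by (intro group_hom.intro group_hom_axioms.intro homI \<Gamma>(1) P_group)
qed

text \<open>Choose $j \ge i$ such that the image of $\Gamma_j$ in $\Gamma_i$ is contained in $S_i$. An element of $S_i$ lifts to
$\Gamma_{j+1}$, where it is a product of elements $c(x)^g$ with $g \in \Gamma_j$. These go to conjugates of $\varphi_j(x)$ by
$g$, and $g$ has its image in $S_i$.\<close>

lemma S_normally_generated:
  assumes i: "i \<ge> 1"
  shows "S i \<subseteq> generate (T i) {inv\<^bsub>T i\<^esub> g \<otimes>\<^bsub>T i\<^esub> \<phi>s i x \<otimes>\<^bsub>T i\<^esub> g | x g. x \<in> carrier \<Gamma> \<and> g \<in> S i}"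
proof
  fix s assume "s \<in> S i"
  then obtain x where x: "x \<in> carrier P" "s = x i" by (auto simp: S_def)
  obtain d where d: "descend ns i d ` carrier (T (i + d)) \<subseteq> S i" by (rule stable_image[OF i])
  define j where "j = i + d"
  have j: "j \<ge> 1" using i by (simp add: j_def)
  note nc = closure[OF j]
  note nm = normal_closure_factorization(2)[OF nc]
  interpret D: group_hom "T j" "T i" "descend ns i d" unfolding j_def by (rule descend_hom[OF i])
  interpret n: group_hom "T (Suc j)" "T j" "ns j" by (rule level_group_hom[OF j])
  interpret c: group_hom \<Gamma> "T (Suc j)" "\<phi>s (Suc j)" by (rule \<phi>s_hom) simp
  have "descend ns i d \<circ> ns j \<in> hom (T (Suc j)) (T i)"
    by (rule hom_compose[OF n.homh D.homh])
  then interpret h: group_hom "T (Suc j)" "T i" "descend ns i d \<circ> ns j"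
    by unfold_locales
  define L where "L = {acts j (\<phi>s (Suc j) y) g | y g. y \<in> carrier \<Gamma> \<and> g \<in> carrier (T j)}"
  have L: "L \<subseteq> carrier (T (Suc j))" using normal_mapD(5)[OF nm] by (auto simp: L_def)
  have descend_\<phi>s: "descend ns i d (\<phi>s j y) = \<phi>s i y" if "y \<in> carrier \<Gamma>" for y
    using descend_P[OF group_hom.hom_closed[OF limit_map_hom that] i, of d] i j
    by (simp add: tower_limit_map_def j_def)
  have "(descend ns i d \<circ> ns j) ` L \<subseteq>
      {inv\<^bsub>T i\<^esub> g \<otimes>\<^bsub>T i\<^esub> \<phi>s i x \<otimes>\<^bsub>T i\<^esub> g | x g. x \<in> carrier \<Gamma> \<and> g \<in> S i}"
  proof
    fix z assume "z \<in> (descend ns i d \<circ> ns j) ` L"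
    then obtain y g where z: "z = descend ns i d (ns j (acts j (\<phi>s (Suc j) y) g))" "y \<in> carrier \<Gamma>" "g \<in> carrier (T j)"
      by (auto simp: L_def)
    have \<phi>sj: "\<phi>s j y \<in> carrier (T j)" using group_hom.hom_closed[OF \<phi>s_hom[OF j] z(2)] .
    have "ns j (acts j (\<phi>s (Suc j) y) g) = inv\<^bsub>T j\<^esub> g \<otimes>\<^bsub>T j\<^esub> \<phi>s j y \<otimes>\<^bsub>T j\<^esub> g"
      using normal_mapD(8)[OF nm _ z(3)] z(2) \<phi>s_compat[OF j] by simp
    then have "z = inv\<^bsub>T i\<^esub> (descend ns i d g) \<otimes>\<^bsub>T i\<^esub> \<phi>s i y \<otimes>\<^bsub>T i\<^esub> (descend ns i d g)"
      using z \<phi>sj descend_\<phi>s by simp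
    moreover have "descend ns i d g \<in> S i" using d z(3) by (auto simp: j_def)
    ultimately show "z \<in> {inv\<^bsub>T i\<^esub> g \<otimes>\<^bsub>T i\<^esub> \<phi>s i x \<otimes>\<^bsub>T i\<^esub> g | x g. x \<in> carrier \<Gamma> \<and> g \<in> S i}"
      using z(2) by blast
  qed
  then have "generate (T i) ((descend ns i d \<circ> ns j) ` L) \<subseteq>
      generate (T i) {inv\<^bsub>T i\<^esub> g \<otimes>\<^bsub>T i\<^esub> \<phi>s i x \<otimes>\<^bsub>T i\<^esub> g | x g. x \<in> carrier \<Gamma> \<and> g \<in> S i}"
    by (rule D.H.mono_generate)
  moreover have "s \<in> (descend ns i d \<circ> ns j) ` carrier (T (Suc j))"
  proof (rule image_eqI)
    show "x (Suc j) \<in> carrier (T (Suc j))" using P_level x(1) by simp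
    show "s = (descend ns i d \<circ> ns j) (x (Suc j))"
      using P_compat[OF x(1) j] descend_P[OF x(1) i, of d] x(2) by (simp add: j_def)
  qed
  then have "s \<in> generate (T i) ((descend ns i d \<circ> ns j) ` L)"
    using h.generate_img[OF L] normal_closure_generated[OF nc] by (simp add: L_def)
  ultimately show "s \<in> generate (T i) {inv\<^bsub>T i\<^esub> g \<otimes>\<^bsub>T i\<^esub> \<phi>s i x \<otimes>\<^bsub>T i\<^esub> g | x g. x \<in> carrier \<Gamma> \<and> g \<in> S i}"
    by blast
qed

text \<open>The value of the bound of \<open>supplement_commutator_width\<close> at all levels at once, since the image of \<open>\<Gamma>\<close> in a level has at most \<open>order \<Gamma>\<close>
elements.\<close>

definition width :: nat where "width = order \<Gamma> + (order G)\<^sup>2 * order G"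

lemma \<phi>s_in_S: "i \<ge> 1 \<Longrightarrow> x \<in> carrier \<Gamma> \<Longrightarrow> \<phi>s i x \<in> S i"
  unfolding S_def using group_hom.hom_closed[OF limit_map_hom]
  by (intro image_eqI[of _ _ "tower_limit_map \<phi>s x"]) (simp_all add: tower_limit_map_def)

text \<open>An instance of \<open>supplement_commutator_width\<close>, with $S_i$ mapped to $G$ and with the chain of those elements of
$S_i$ that come from threads trivial at level $t+1$. The chain is central since the kernel of a normal map
is.\<close>

lemma S_commutator_width:
  assumes s: "s \<in> S (Suc m)"
  shows "\<exists>\<gamma> ps. \<gamma> \<in> carrier \<Gamma> \<and> set ps \<subseteq> S (Suc m) \<times> S (Suc m) \<and> length ps \<le> width \<and>
    s = \<phi>s (Suc m) \<gamma> \<otimes>\<^bsub>T (Suc m)\<^esub> list_prod (T (Suc m)) (map (\<lambda>(x, y). commutator (T (Suc m)) x y) ps)"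
proof -
  define i where "i = Suc m"
  have i: "i \<ge> 1" by (simp add: i_def)
  define E where "E = (T i)\<lparr>carrier := S i\<rparr>"
  interpret Ti: group "T i" by (rule group_level[OF i])
  have S: "subgroup (S i) (T i)" by (rule S_subgroup[OF i])
  interpret S: subgroup "S i" "T i" by (rule S)
  have "group E" unfolding E_def by (rule Ti.subgroup_imp_group[OF S])
  then interpret E: group E .
  have E_simps: "carrier E = S i" "x \<otimes>\<^bsub>E\<^esub> y = x \<otimes>\<^bsub>T i\<^esub> y" "\<one>\<^bsub>E\<^esub> = \<one>\<^bsub>T i\<^esub>" for x y
    by (simp_all add: E_def)
  have E_inv: "inv\<^bsub>E\<^esub> x = inv\<^bsub>T i\<^esub> x" if "x \<in> S i" for x
    unfolding E_def using Ti.m_inv_consistent[OF S that] .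
  have E_commutator: "commutator E x y = commutator (T i) x y" if "x \<in> S i" "y \<in> S i" for x y
    using that by (simp add: commutator_def E_simps E_inv)
  have E_list_prod: "list_prod E xs = list_prod (T i) xs" for xs
    by (induction xs) (simp_all add: E_simps)
  define D where "D = descend ns 1 m"
  have h: "group_hom E G D"
  proof -
    have "group_hom (T i) G D"
      using descend_hom[of 1 m] unfolding i_def level_1 D_def by (simp only: plus_1_eq_Suc le_refl)
    then interpret d: group_hom "T i" G "D" .
    have "D \<in> hom E G" by (rule homI) (simp_all add: E_simps)
    then show ?thesis using E.is_group G(1) by (simp add: group_hom_def group_hom_axioms_def)
  qed
  have descend: "D (x i) = x 1" if "x \<in> carrier P" for x
    using descend_P[OF that, of 1 m] by (simp add: i_def D_def)
  define A where "A = \<phi>s i ` carrier \<Gamma>"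
  interpret \<phi>i: group_hom \<Gamma> "T i" "\<phi>s i" by (rule \<phi>s_hom[OF i])
  have A_S: "A \<subseteq> S i" using \<phi>s_in_S[OF i] by (auto simp: A_def)
  have A: "subgroup A E"
    unfolding E_def A_def using Ti.subgroup_incl[OF \<phi>i.img_is_subgroup S] A_S by (simp add: A_def)
  define CE where "CE = {inv\<^bsub>E\<^esub> g \<otimes>\<^bsub>E\<^esub> a \<otimes>\<^bsub>E\<^esub> g | a g. a \<in> A \<and> g \<in> carrier E}"
  define CT where "CT = {inv\<^bsub>T i\<^esub> g \<otimes>\<^bsub>T i\<^esub> \<phi>s i x \<otimes>\<^bsub>T i\<^esub> g | x g. x \<in> carrier \<Gamma> \<and> g \<in> S i}"
  have CE: "CE \<subseteq> carrier E"
  proof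
    fix z assume "z \<in> CE"
    then obtain a g where z: "z = inv\<^bsub>E\<^esub> g \<otimes>\<^bsub>E\<^esub> a \<otimes>\<^bsub>E\<^esub> g" "a \<in> A" "g \<in> carrier E"
      unfolding CE_def by blast
    then have "a \<in> carrier E" using A_S by (auto simp: E_simps(1))
    then show "z \<in> carrier E" using z by simp
  qed
  have "CT \<subseteq> CE"
  proof
    fix z assume "z \<in> CT"
    then obtain x g where z: "z = inv\<^bsub>T i\<^esub> g \<otimes>\<^bsub>T i\<^esub> \<phi>s i x \<otimes>\<^bsub>T i\<^esub> g" "x \<in> carrier \<Gamma>" "g \<in> S i"
      unfolding CT_def by blast
    then have "z = inv\<^bsub>E\<^esub> g \<otimes>\<^bsub>E\<^esub> \<phi>s i x \<otimes>\<^bsub>E\<^esub> g" by (simp add: E_simps E_inv)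
    then show "z \<in> CE" unfolding CE_def A_def E_simps(1) using z(2,3) by blast
  qed
  moreover have "generate E CT = generate (T i) CT"
    unfolding E_def using \<open>CT \<subseteq> CE\<close> CE by (intro Ti.generate_consistent[OF _ S]) (auto simp: E_simps(1))
  ultimately have "carrier E \<subseteq> generate E CE"
    using S_normally_generated[OF i] E.mono_generate[of CT CE] unfolding CT_def E_simps(1) by blast
  then have "generate E CE = carrier E" using E.generate_incl[OF CE] by blast
  then have AD: "A <#>\<^bsub>E\<^esub> commutator_subgroup E (carrier E) (carrier E) = carrier E"
    unfolding CE_def by (rule E.supplement_of_normally_generating[OF A])
  define K where "K = (\<lambda>t. (\<lambda>x. x i) ` {x \<in> carrier P. x (Suc t) = \<one>\<^bsub>T (Suc t)\<^esub>})"
  have K_sub: "subgroup (K t) E" for t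
  proof -
    interpret pt: group_hom P "T (Suc t)" "\<lambda>x. x (Suc t)" by (rule projection_hom) simp
    interpret pi: group_hom P "T i" "\<lambda>x. x i" by (rule projection_hom[OF i])
    have "K t = (\<lambda>x. x i) ` kernel P (T (Suc t)) (\<lambda>x. x (Suc t))"
      by (simp add: K_def kernel_def)
    then have "subgroup (K t) (T i)"
      using pi.subgroup_img_is_subgroup[OF pt.subgroup_kernel] by simp
    then show ?thesis
      unfolding E_def using Ti.subgroup_incl[OF _ S] by (auto simp: K_def S_def)
  qed
  have K_step: "commutator E k g \<in> K (Suc t)" if k: "k \<in> K t" and g: "g \<in> carrier E" for t k g
  proof -
    obtain x y where x: "k = x i" "x \<in> carrier P" "x (Suc t) = \<one>\<^bsub>T (Suc t)\<^esub>" and y: "g = y i" "y \<in> carrier P"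
      using k g unfolding K_def E_simps(1) S_def by blast
    interpret P: group P by (rule P_group)
    have z: "commutator P x y \<in> carrier P" using x y by simp
    have z_level: "commutator P x y j = commutator (T j) (x j) (y j)" if "j \<ge> 1" for j
      using group_hom.hom_commutator[OF projection_hom[OF that] x(2) y(2)] .
    have "ns (Suc t) (x (Suc (Suc t))) = \<one>\<^bsub>T (Suc t)\<^esub>" using P_compat[OF x(2)] x(3) by simp
    then have "commutator P x y (Suc (Suc t)) = \<one>\<^bsub>T (Suc (Suc t))\<^esub>"
      using normal_map_kernel_central[OF normal_closure_factorization(2)[OF closure[of "Suc t"]]]
        P_level x(2) y(2) z_level by simp
    moreover have "commutator E k g = commutator P x y i"
      using z_level[OF i] E_commutator[of k g] x y by (auto simp: S_def)
    ultimately show ?thesis using z unfolding K_def by blast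
  qed
  have K_first: "K 0 = kernel E G D"
  proof -
    have "K 0 = {s \<in> S i. D s = \<one>\<^bsub>G\<^esub>}"
      unfolding K_def S_def One_nat_def[symmetric] level_1(1) using descend by auto
    then show ?thesis by (simp add: kernel_def E_simps)
  qed
  have K_last: "K m = {\<one>\<^bsub>E\<^esub>}"
  proof -
    interpret P: group P by (rule P_group)
    interpret pi: group_hom P "T i" "\<lambda>x. x i" by (rule projection_hom[OF i])
    have "\<one>\<^bsub>P\<^esub> i = \<one>\<^bsub>T i\<^esub>" by (rule pi.hom_one)
    then have "\<one>\<^bsub>T i\<^esub> \<in> K m" unfolding K_def i_def[symmetric] using P.one_closed by (metis (mono_tags, lifting) image_eqI mem_Collect_eq)
    then show ?thesis unfolding K_def i_def[symmetric] E_simps by auto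
  qed
  interpret h: group_hom E G "D" by (rule h)
  have fin_E: "finite (carrier E)"
    using finite_subset[OF S.subset finite_level[OF i]] by (simp add: E_simps)
  have "s \<in> carrier E" using s by (simp add: E_simps i_def)
  then obtain a ps where a: "a \<in> A" "set ps \<subseteq> carrier E \<times> carrier E"
      "length ps \<le> card A + (order G)\<^sup>2 * order G"
      "s = a \<otimes>\<^bsub>E\<^esub> list_prod E (map (\<lambda>(x, y). commutator E x y) ps)"
    using h.supplement_commutator_width[OF fin_E G(2) A AD K_sub K_step K_first K_last] by blast
  obtain \<gamma> where \<gamma>: "\<gamma> \<in> carrier \<Gamma>" "a = \<phi>s i \<gamma>" using a(1) by (auto simp: A_def)
  have "card A \<le> order \<Gamma>" unfolding A_def order_def by (rule card_image_le[OF \<Gamma>(2)])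
  then have "length ps \<le> width" using a(3) by (simp add: width_def)
  moreover have "map (\<lambda>(x, y). commutator E x y) ps = map (\<lambda>(x, y). commutator (T i) x y) ps"
    using a(2) E_commutator by (intro map_cong) (auto simp: E_simps)
  then have "s = \<phi>s i \<gamma> \<otimes>\<^bsub>T i\<^esub> list_prod (T i) (map (\<lambda>(x, y). commutator (T i) x y) ps)"
    using a(4) \<gamma>(2) by (simp only: E_simps(2) E_list_prod)
  ultimately show ?thesis
    using \<gamma>(1) a(2) unfolding i_def[symmetric] E_simps by blast
qed

text \<open>At every level $x$ equals $\varphi_i(\gamma)$ times a product of boundedly many commutators of elements of
$S_i$. For each $i$ there are finitely many such expressions, and the maps of the tower carry them to one another, so
there is a thread of expressions. Along it $\gamma$ and the number of commutators are constant, and the entries of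
the commutators form elements of the limit.\<close>

lemma limit_eq_image_times_commutators:
  "tower_limit_map \<phi>s ` carrier \<Gamma> <#>\<^bsub>P\<^esub> commutator_subgroup P (carrier P) (carrier P) = carrier P"
proof
  interpret P: group P by (rule P_group)
  interpret \<iota>: group_hom \<Gamma> P "tower_limit_map \<phi>s" by (rule limit_map_hom)
  have D: "subgroup (commutator_subgroup P (carrier P) (carrier P)) P"
    by (rule P.commutator_subgroup_is_subgroup) auto
  show "tower_limit_map \<phi>s ` carrier \<Gamma> <#>\<^bsub>P\<^esub> commutator_subgroup P (carrier P) (carrier P) \<subseteq> carrier P"
    using \<iota>.hom_closed by (intro P.set_mult_closed subgroup.subset[OF D]) blast
  show "carrier P \<subseteq> tower_limit_map \<phi>s ` carrier \<Gamma> <#>\<^bsub>P\<^esub> commutator_subgroup P (carrier P) (carrier P)"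
  proof
    fix x assume x: "x \<in> carrier P"
    define cp where "cp = (\<lambda>i ps. list_prod (T i) (map (\<lambda>(x, y). commutator (T i) x y) ps))"
    define V where "V = (\<lambda>m. {(\<gamma>, ps). \<gamma> \<in> carrier \<Gamma> \<and> set ps \<subseteq> S (Suc m) \<times> S (Suc m) \<and>
      length ps \<le> width \<and> x (Suc m) = \<phi>s (Suc m) \<gamma> \<otimes>\<^bsub>T (Suc m)\<^esub> cp (Suc m) ps})"
    define p where "p = (\<lambda>m (\<gamma> :: 'a, ps). (\<gamma>, map (map_prod (ns (Suc m)) (ns (Suc m))) ps))"
    have S_carrier: "S (Suc m) \<subseteq> carrier (T (Suc m))" for m
      using subgroup.subset[OF S_subgroup] by simp
    have "\<exists>t. \<forall>m. t m \<in> V m \<and> p m (t (Suc m)) = t m"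
    proof (rule thread_exists)
      fix m
      have "finite (S (Suc m))" using finite_subset[OF S_carrier] finite_level by simp
      then have "finite (carrier \<Gamma> \<times> {ps. set ps \<subseteq> S (Suc m) \<times> S (Suc m) \<and> length ps \<le> width})"
        using \<Gamma>(2) by (intro finite_cartesian_product finite_lists_length_le) auto
      then show "finite (V m)" by (rule finite_subset[rotated]) (auto simp: V_def)
      have "x (Suc m) \<in> S (Suc m)" using x by (auto simp: S_def)
      then show "V m \<noteq> {}" using S_commutator_width[of "x (Suc m)" m] by (auto simp: V_def cp_def)
    next
      fix m v assume "v \<in> V (Suc m)"
      then obtain \<gamma> ps where v: "v = (\<gamma>, ps)" "\<gamma> \<in> carrier \<Gamma>" "set ps \<subseteq> S (Suc (Suc m)) \<times> S (Suc (Suc m))"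
          "length ps \<le> width" "x (Suc (Suc m)) = \<phi>s (Suc (Suc m)) \<gamma> \<otimes>\<^bsub>T (Suc (Suc m))\<^esub> cp (Suc (Suc m)) ps"
        by (auto simp: V_def)
      interpret n: group_hom "T (Suc (Suc m))" "T (Suc m)" "ns (Suc m)" by (rule level_group_hom) simp
      have nS: "ns (Suc m) s \<in> S (Suc m)" if "s \<in> S (Suc (Suc m))" for s
        using that P_compat unfolding S_def by force
      have ps: "set ps \<subseteq> carrier (T (Suc (Suc m))) \<times> carrier (T (Suc (Suc m)))"
        using v(3) S_carrier[of "Suc m"] by blast
      then have cl: "set (map (\<lambda>(x, y). commutator (T (Suc (Suc m))) x y) ps) \<subseteq> carrier (T (Suc (Suc m)))"
        by auto
      have "ns (Suc m) (cp (Suc (Suc m)) ps) =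
          list_prod (T (Suc m)) (map (ns (Suc m)) (map (\<lambda>(x, y). commutator (T (Suc (Suc m))) x y) ps))"
        unfolding cp_def by (rule n.hom_list_prod[OF cl])
      also have "map (ns (Suc m)) (map (\<lambda>(x, y). commutator (T (Suc (Suc m))) x y) ps) =
          map (\<lambda>(x, y). commutator (T (Suc m)) x y) (map (map_prod (ns (Suc m)) (ns (Suc m))) ps)"
        using ps n.hom_commutator by auto
      finally have cp: "ns (Suc m) (cp (Suc (Suc m)) ps) = cp (Suc m) (map (map_prod (ns (Suc m)) (ns (Suc m))) ps)"
        by (simp add: cp_def)
      have "cp (Suc (Suc m)) ps \<in> carrier (T (Suc (Suc m)))"
        unfolding cp_def by (rule n.G.list_prod_closed[OF cl])
      then have "x (Suc m) = \<phi>s (Suc m) \<gamma> \<otimes>\<^bsub>T (Suc m)\<^esub> cp (Suc m) (map (map_prod (ns (Suc m)) (ns (Suc m))) ps)"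
        using P_compat[OF x, of "Suc m"] v(2,5) \<phi>s_compat[of "Suc m" \<gamma>] cp
          group_hom.hom_closed[OF \<phi>s_hom[of "Suc (Suc m)"] v(2)] by simp
      then show "p m v \<in> V m"
        using v nS by (auto simp: p_def V_def)
    qed
    then obtain t where t: "\<And>m. t m \<in> V m" "\<And>m. p m (t (Suc m)) = t m" by blast
    define \<gamma> where "\<gamma> = fst (t 0)"
    define ps where "ps = (\<lambda>m. snd (t m))"
    define l where "l = length (ps 0)"
    have ps_step: "ps m = map (map_prod (ns (Suc m)) (ns (Suc m))) (ps (Suc m))" for m
      using arg_cong[OF t(2)[of m], of snd] by (simp add: p_def ps_def case_prod_beta)
    have \<gamma>_eq: "fst (t m) = \<gamma>" for m
    proof (induction m)
      case (Suc m)
      then show ?case using arg_cong[OF t(2)[of m], of fst] by (simp add: p_def case_prod_beta)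
    qed (simp add: \<gamma>_def)
    have len: "length (ps m) = l" for m
    proof (induction m)
      case (Suc m)
      then show ?case using ps_step[of m] by simp
    qed (simp add: l_def)
    have t_eq: "t m = (\<gamma>, ps m)" for m using \<gamma>_eq[of m] by (simp add: ps_def prod_eq_iff)
    have \<gamma>: "\<gamma> \<in> carrier \<Gamma>" and ps_S: "set (ps m) \<subseteq> S (Suc m) \<times> S (Suc m)"
      and x_eq: "x (Suc m) = \<phi>s (Suc m) \<gamma> \<otimes>\<^bsub>T (Suc m)\<^esub> cp (Suc m) (ps m)" for m
      using t(1)[of m] by (simp_all add: t_eq V_def)
    \<comment> \<open>Level \<open>i\<close> of the tower is entry \<open>i - 1\<close> of the thread.\<close>
    define y where "y = (\<lambda>k. \<lambda>i\<in>{1..}. fst (ps (i - 1) ! k))"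
    define z where "z = (\<lambda>k. \<lambda>i\<in>{1..}. snd (ps (i - 1) ! k))"
    have in_S: "fst (ps m ! k) \<in> S (Suc m)" "snd (ps m ! k) \<in> S (Suc m)" if "k < l" for m k
    proof -
      have "ps m ! k \<in> S (Suc m) \<times> S (Suc m)" using ps_S[of m] that len[of m] by (metis nth_mem subsetD)
      then show "fst (ps m ! k) \<in> S (Suc m)" "snd (ps m ! k) \<in> S (Suc m)" by (simp_all add: mem_Times_iff)
    qed
    have step: "ns (Suc m) (fst (ps (Suc m) ! k)) = fst (ps m ! k)"
        "ns (Suc m) (snd (ps (Suc m) ! k)) = snd (ps m ! k)" if "k < l" for m k
      using ps_step[of m] that len[of "Suc m"] by simp_all
    have in_P: "y k \<in> carrier P" "z k \<in> carrier P" if k: "k < l" for k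
    proof -
      have "y k i \<in> carrier (T i) \<and> ns i (y k (Suc i)) = y k i"
        "z k i \<in> carrier (T i) \<and> ns i (z k (Suc i)) = z k i" if "i \<ge> 1" for i
        using in_S[OF k, of "i - 1"] step[OF k, of "i - 1"] S_carrier[of "i - 1"] that
        by (auto simp: y_def z_def)
      then show "y k \<in> carrier P" "z k \<in> carrier P"
        by (simp_all add: P_carrier) (simp_all add: y_def z_def)
    qed
    define c where "c = list_prod P (map (\<lambda>k. commutator P (y k) (z k)) [0..<l])"
    have cl: "set (map (\<lambda>k. commutator P (y k) (z k)) [0..<l]) \<subseteq> commutator_subgroup P (carrier P) (carrier P)"
      using in_P P.commutator_in_commutator_subgroup by auto
    have c: "c \<in> commutator_subgroup P (carrier P) (carrier P)"
      unfolding c_def by (rule P.list_prod_in_subgroup[OF D cl])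
    have cP: "c \<in> carrier P" using c subgroup.mem_carrier[OF D] by blast
    have "x = tower_limit_map \<phi>s \<gamma> \<otimes>\<^bsub>P\<^esub> c"
    proof (rule P_eqI[OF x])
      show "tower_limit_map \<phi>s \<gamma> \<otimes>\<^bsub>P\<^esub> c \<in> carrier P" using cP \<gamma> by simp
      fix i :: nat assume i: "i \<ge> 1"
      then obtain m where m: "i = Suc m" by (cases i) auto
      interpret pi: group_hom P "T i" "\<lambda>x. x i" by (rule projection_hom[OF i])
      have "c i = list_prod (T i) (map (\<lambda>x. x i) (map (\<lambda>k. commutator P (y k) (z k)) [0..<l]))"
        unfolding c_def by (rule pi.hom_list_prod) (use cl subgroup.subset[OF D] in blast)
      also have "map (\<lambda>x. x i) (map (\<lambda>k. commutator P (y k) (z k)) [0..<l]) =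
          map (\<lambda>(x, y). commutator (T i) x y) (ps m)"
      proof (rule nth_equalityI)
        fix k assume "k < length (map (\<lambda>x. x i) (map (\<lambda>k. commutator P (y k) (z k)) [0..<l]))"
        then have k: "k < l" by simp
        have "commutator P (y k) (z k) i = commutator (T i) (y k i) (z k i)"
          using pi.hom_commutator in_P[OF k] by blast
        also have "\<dots> = commutator (T i) (fst (ps m ! k)) (snd (ps m ! k))"
          by (simp add: y_def z_def m)
        finally show "map (\<lambda>x. x i) (map (\<lambda>k. commutator P (y k) (z k)) [0..<l]) ! k =
            map (\<lambda>(x, y). commutator (T i) x y) (ps m) ! k"
          using k len[of m] by (simp add: case_prod_beta)
      qed (simp add: len)
      finally have "c i = cp i (ps m)" by (simp add: cp_def)
      then show "x i = (tower_limit_map \<phi>s \<gamma> \<otimes>\<^bsub>P\<^esub> c) i"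
        using x_eq[of m] i by (simp add: P_mult m tower_limit_map_def)
    qed
    then show "x \<in> tower_limit_map \<phi>s ` carrier \<Gamma> <#>\<^bsub>P\<^esub> commutator_subgroup P (carrier P) (carrier P)"
      using \<gamma> c unfolding set_mult_def by blast
  qed
qed

text \<open>The limit maps onto $\Gamma/\gamma_i(\Gamma)$ through its \<open>i\<close>-th level, compatibly with $\Gamma$, and the \<open>i\<close>-th term of the
lower central series of this quotient is trivial.\<close>

lemma limit_map_reflects_lower_central:
  assumes i: "i \<ge> 1" and x: "x \<in> carrier \<Gamma>"
    and mem: "tower_limit_map \<phi>s x \<in> lower_central P i"
  shows "x \<in> lower_central \<Gamma> i"
proof -
  interpret \<iota>: group_hom \<Gamma> P "tower_limit_map \<phi>s" by (rule limit_map_hom)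
  define L where "L = lower_central \<Gamma> i"
  define Q where "Q = \<Gamma> Mod L"
  define q where "q = (\<lambda>x. L #>\<^bsub>\<Gamma>\<^esub> x)"
  interpret L: normal L \<Gamma> unfolding L_def by (rule \<iota>.G.lower_central_normal)
  have "group Q" unfolding Q_def by (rule L.factorgroup_is_group)
  then interpret Q: group Q .
  interpret q: group_hom \<Gamma> Q q by unfold_locales (simp add: q_def Q_def L.r_coset_hom_Mod)
  have q_surj: "q ` carrier \<Gamma> = carrier Q" by (simp add: Q_def q_def carrier_FactGroup)
  obtain f where f: "f \<in> hom (T i) Q" "\<And>x. x \<in> carrier \<Gamma> \<Longrightarrow> f (\<phi>s i x) = q x"
    using closures_tower_maps_to_nilpotent_quotients[OF \<Gamma>(1) G(1) \<phi> tower i]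
    unfolding q_def Q_def L_def by blast
  define F where "F = (\<lambda>x. f (x i))"
  interpret pi: group_hom P "T i" "\<lambda>x. x i" by (rule projection_hom[OF i])
  have "F \<in> hom P Q" using hom_compose[OF pi.homh f(1)] by (simp add: F_def comp_def)
  then interpret F: group_hom P Q F by unfold_locales
  have F_\<iota>: "F (tower_limit_map \<phi>s y) = q y" if "y \<in> carrier \<Gamma>" for y
    using f(2)[OF that] i by (simp add: F_def tower_limit_map_def)
  have "carrier Q \<subseteq> F ` carrier P"
  proof
    fix c assume "c \<in> carrier Q"
    then obtain y where "y \<in> carrier \<Gamma>" "c = q y" unfolding q_surj[symmetric] by blast
    then show "c \<in> F ` carrier P" using F_\<iota> \<iota>.hom_closed by (metis image_eqI)
  qed
  have "q x \<in> lower_central Q i"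
    using F.image_lower_central[OF i] mem F_\<iota>[OF x] by force
  also have "lower_central Q i = q ` L"
    unfolding L_def by (rule q.surj_image_lower_central[OF i q_surj, symmetric])
  finally obtain y where y: "y \<in> L" "q x = q y" by blast
  then have "q x = L"
    using \<iota>.G.coset_join2[OF L.mem_carrier L.is_subgroup] by (simp add: q_def)
  then show ?thesis
    using \<iota>.G.coset_join1[OF _ x L.is_subgroup] by (simp add: q_def L_def)
qed

end

theorem theorem2:
  fixes \<Gamma> :: "'a monoid" and G :: "'u monoid" and \<phi> :: "'a \<Rightarrow> 'u"
    and T :: "nat \<Rightarrow> 'u monoid" and acts :: "nat \<Rightarrow> 'u \<Rightarrow> 'u \<Rightarrow> 'u"
    and ns :: "nat \<Rightarrow> 'u \<Rightarrow> 'u" and \<phi>s :: "nat \<Rightarrow> 'a \<Rightarrow> 'u" and i :: nat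
  assumes "group \<Gamma>" "finite (carrier \<Gamma>)"
    and "group G" "finite (carrier G)"
    and "\<phi> \<in> hom \<Gamma> G"
    and "normal_closures_tower \<Gamma> G \<phi> T acts ns \<phi>s"
    and "i \<ge> 1"
  shows "\<exists>h \<in> iso (\<Gamma> Mod lower_central \<Gamma> i)
                  (tower_limit T ns Mod lower_central (tower_limit T ns) i).
           \<forall>x\<in>carrier \<Gamma>. h (lower_central \<Gamma> i #>\<^bsub>\<Gamma>\<^esub> x) =
             lower_central (tower_limit T ns) i #>\<^bsub>tower_limit T ns\<^esub> tower_limit_map \<phi>s x"
proof -
  interpret finite_closures_tower \<Gamma> G \<phi> T acts ns \<phi>s
    by (rule finite_closures_tower.intro) (fact assms)+
  interpret \<iota>: group_hom \<Gamma> P "tower_limit_map \<phi>s" by (rule limit_map_hom)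
  define L where "L = lower_central P i"
  interpret L: normal L P unfolding L_def by (rule \<iota>.H.lower_central_normal)
  have "group (P Mod L)" by (rule L.factorgroup_is_group)
  then interpret Q: group "P Mod L" .
  define q where "q = (\<lambda>x. L #>\<^bsub>P\<^esub> tower_limit_map \<phi>s x)"
  have "q \<in> hom \<Gamma> (P Mod L)"
    using hom_compose[OF \<iota>.homh L.r_coset_hom_Mod] by (simp add: q_def comp_def)
  then interpret q: group_hom \<Gamma> "P Mod L" q by unfold_locales
  have one_iff: "q x = \<one>\<^bsub>P Mod L\<^esub> \<longleftrightarrow> tower_limit_map \<phi>s x \<in> L" if "x \<in> carrier \<Gamma>" for x
    using \<iota>.H.coset_join1[OF _ \<iota>.hom_closed[OF that] L.is_subgroup]
      \<iota>.H.coset_join2[OF \<iota>.hom_closed[OF that] L.is_subgroup] by (auto simp: q_def)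
  have kernel: "kernel \<Gamma> (P Mod L) q = lower_central \<Gamma> i"
  proof
    show "kernel \<Gamma> (P Mod L) q \<subseteq> lower_central \<Gamma> i"
      using one_iff limit_map_reflects_lower_central[OF \<open>i \<ge> 1\<close>] by (auto simp: kernel_def L_def)
    show "lower_central \<Gamma> i \<subseteq> kernel \<Gamma> (P Mod L) q"
      using one_iff \<iota>.image_lower_central[OF \<open>i \<ge> 1\<close>] subgroup.subset[OF normal_imp_subgroup[OF \<iota>.G.lower_central_normal]]
      unfolding kernel_def L_def by blast
  qed
  have A: "subgroup (tower_limit_map \<phi>s ` carrier \<Gamma>) P" by (rule \<iota>.img_is_subgroup)
  have supplement: "tower_limit_map \<phi>s ` carrier \<Gamma> <#>\<^bsub>P\<^esub> L = carrier P"
    unfolding L_def by (rule \<iota>.H.supplement_lower_central[OF A limit_eq_image_times_commutators \<open>i \<ge> 1\<close>])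
  have "carrier (P Mod L) \<subseteq> q ` carrier \<Gamma>"
  proof
    fix c assume "c \<in> carrier (P Mod L)"
    then obtain y where y: "y \<in> carrier P" "c = L #>\<^bsub>P\<^esub> y" by (auto simp: carrier_FactGroup)
    then obtain x l where x: "x \<in> carrier \<Gamma>" "l \<in> L" "y = tower_limit_map \<phi>s x \<otimes>\<^bsub>P\<^esub> l"
      unfolding supplement[symmetric] by (auto simp: set_mult_def)
    have "c = (L #>\<^bsub>P\<^esub> tower_limit_map \<phi>s x) <#>\<^bsub>P\<^esub> (L #>\<^bsub>P\<^esub> l)"
      unfolding y(2) x(3) using x by (intro L.rcos_sum[symmetric]) auto
    also have "L #>\<^bsub>P\<^esub> l = \<one>\<^bsub>P Mod L\<^esub>" using \<iota>.H.coset_join2[OF _ L.is_subgroup x(2)] x(2) by simp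
    finally have "c = q x \<otimes>\<^bsub>P Mod L\<^esub> \<one>\<^bsub>P Mod L\<^esub>" by (simp add: q_def)
    then have "c = q x" using Q.r_one[OF q.hom_closed[OF x(1)]] by simp
    then show "c \<in> q ` carrier \<Gamma>" using x(1) by blast
  qed
  then have surj: "q ` carrier \<Gamma> = carrier (P Mod L)" using q.hom_closed by blast
  define h where "h = (\<lambda>C. the_elem (q ` C))"
  have "h \<in> iso (\<Gamma> Mod lower_central \<Gamma> i) (P Mod L)"
    using q.FactGroup_iso_set[OF surj] unfolding h_def kernel .
  moreover have "h (lower_central \<Gamma> i #>\<^bsub>\<Gamma>\<^esub> x) = q x" if x: "x \<in> carrier \<Gamma>" for x
  proof -
    have "q y = q x" if "y \<in> lower_central \<Gamma> i #>\<^bsub>\<Gamma>\<^esub> x" for y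
      using that x unfolding kernel[symmetric] by (auto simp: r_coset_def kernel_def simp del: one_FactGroup mult_FactGroup)
    moreover have "x \<in> lower_central \<Gamma> i #>\<^bsub>\<Gamma>\<^esub> x"
      by (rule \<iota>.G.rcos_self[OF x normal_imp_subgroup[OF \<iota>.G.lower_central_normal]])
    ultimately have "q ` (lower_central \<Gamma> i #>\<^bsub>\<Gamma>\<^esub> x) = {q x}" by blast
    then show ?thesis by (simp add: h_def)
  qed
  ultimately show ?thesis unfolding L_def q_def by blast
qed

end
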